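(* Let $m \ge 2$, $n \ge 0$, $t \ge 1$ be integers. The graded Betti number $\beta_{i,j}(I_{n,m}^t)$ is $0$ unless $j = i + tm + (m-1)\ell$ for some integer $\ell$ such that $0 \le \ell \le i$, and for such $\ell$ $$\beta_{i,i+tm+(m-1)\ell}(I_{n,m}^t)=\binom{t+\ell-1}{\ell}\binom{n-\ell m}{i-\ell}\binom{n+t-\ell m-i+\ell}{t-i+2\ell}.$$
   Context: Let $\mathrm{k}$ be an arbitrary field and $S=\mathrm{k}[x_1,\ldots,x_{n+m}]$ with the standard grading. The $m$-path ideal of a path on $n+m$ vertices is $$I_{n,m}=(x_1\cdots x_m,\ x_2\cdots x_{m+1},\ \ldots,\ x_{n+1}x_{n+2}\cdots x_{n+m})\subseteq S,$$ generated by the $n+1$ products of $m$ consecutive variables. For a finitely generated graded $S$-module $M$ and integers $i\ge 0$, $j$, $\beta_{i,j}(M)=\dim_{\mathrm{k}}\operatorname{Tor}_i^S(\mathrm{k},M)_j$; here $I_{n,m}^t$ is regarded as a graded $S$-module (not the quotient $S/I_{n,m}^t$). Convention for binomial coefficients: for integers $a,b$, $\binom{a}{b}=0$ if $a<0$, $b<0$ or $a<b$. *)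

theory Defs
  imports Complex_Main "HOL-Algebra.Ideal_Product" "HOL-Library.Poly_Mapping" "HOL-Library.Function_Algebras"
begin

section \<open>The polynomial ring\<close>

text \<open>Polynomials with coefficients in \<open>'k\<close> in the variables \<open>x\<^sub>0, x\<^sub>1, x\<^sub>2, \<dots>\<close>; a monomial is
  its exponent vector. The ring \<open>k[x\<^sub>1, \<dots>, x\<^sub>N]\<close> is the carrier \<open>polys N\<close> inside this type.\<close>

type_synonym 'k mpoly = "(nat \<Rightarrow>\<^sub>0 nat) \<Rightarrow>\<^sub>0 'k"

definition pvar :: "nat \<Rightarrow> 'k::field mpoly"
  where "pvar v = Poly_Mapping.single (Poly_Mapping.single v 1) 1"

definition mon_deg :: "(nat \<Rightarrow>\<^sub>0 nat) \<Rightarrow> nat"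
  where "mon_deg e = (\<Sum>v\<in>Poly_Mapping.keys e. Poly_Mapping.lookup e v)"

definition homogeneous :: "int \<Rightarrow> 'k::field mpoly \<Rightarrow> bool"
  where "homogeneous d p \<longleftrightarrow> (\<forall>e\<in>Poly_Mapping.keys p. int (mon_deg e) = d)"

definition polys :: "nat \<Rightarrow> 'k::field mpoly set"
  where "polys N = {p. \<forall>e\<in>Poly_Mapping.keys p. Poly_Mapping.keys e \<subseteq> {1..N}}"

definition poly_ring :: "nat \<Rightarrow> 'k::field mpoly ring"
  where "poly_ring N = \<lparr>carrier = polys N, mult = (*), one = 1, zero = 0, add = (+)\<rparr>"

lemma polys_closed:
  fixes p q :: "'k::field mpoly"
  shows "(0 :: 'k mpoly) \<in> polys N" and "(1 :: 'k mpoly) \<in> polys N"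
    and "p \<in> polys N \<Longrightarrow> q \<in> polys N \<Longrightarrow> p + q \<in> polys N"
    and "p \<in> polys N \<Longrightarrow> q \<in> polys N \<Longrightarrow> p * q \<in> polys N"
    and "p \<in> polys N \<Longrightarrow> - p \<in> polys N"
proof -
  show "(0 :: 'k mpoly) \<in> polys N" "(1 :: 'k mpoly) \<in> polys N"
    by (auto simp: polys_def)
  show "p + q \<in> polys N" if "p \<in> polys N" "q \<in> polys N"
    using that Poly_Mapping.keys_add[of p q] by (auto simp: polys_def)
  show "- p \<in> polys N" if "p \<in> polys N"
    using that by (auto simp: polys_def in_keys_iff)
  show "p * q \<in> polys N" if pq: "p \<in> polys N" "q \<in> polys N"
    unfolding polys_def
  proof (intro CollectI ballI)
    fix e assume "e \<in> Poly_Mapping.keys (p * q)"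
    then obtain a b where "e = a + b" "a \<in> Poly_Mapping.keys p" "b \<in> Poly_Mapping.keys q"
      using Poly_Mapping.keys_mult[of p q] by blast
    then show "Poly_Mapping.keys e \<subseteq> {1..N}"
      using pq Poly_Mapping.keys_add[of a b] unfolding polys_def by blast
  qed
qed

lemma cring_poly_ring: "cring (poly_ring N :: 'k::field mpoly ring)"
proof (rule cringI)
  show "abelian_group (poly_ring N :: 'k mpoly ring)"
  proof (rule abelian_groupI)
    fix x :: "'k mpoly" assume "x \<in> carrier (poly_ring N)"
    then show "\<exists>y\<in>carrier (poly_ring N). y \<oplus>\<^bsub>poly_ring N\<^esub> x = \<zero>\<^bsub>poly_ring N\<^esub>"
      by (intro bexI[of _ "- x"]) (simp_all add: poly_ring_def polys_closed)
  qed (simp_all add: poly_ring_def polys_closed algebra_simps)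
  show "comm_monoid (poly_ring N :: 'k mpoly ring)"
    by (rule comm_monoidI) (simp_all add: poly_ring_def polys_closed algebra_simps)
qed (simp add: poly_ring_def algebra_simps)


section \<open>Graded Betti numbers\<close>

definition mat_app :: "nat \<Rightarrow> nat \<Rightarrow> (nat \<Rightarrow> nat \<Rightarrow> 'r::semiring_0) \<Rightarrow> (nat \<Rightarrow> 'r) \<Rightarrow> nat \<Rightarrow> 'r"
  where "mat_app r s A v = (\<lambda>a. if a < r then \<Sum>b<s. A a b * v b else 0)"

text \<open>The free module \<open>S\<^sup>r\<close> over \<open>S = k[x\<^sub>1, \<dots>, x\<^sub>N]\<close>. Vectors are continued by \<open>0\<close>, so that
  equality of vectors is equality of functions.\<close>

definition free_mod :: "nat \<Rightarrow> nat \<Rightarrow> (nat \<Rightarrow> 'k::field mpoly) set"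
  where "free_mod N r = {v. (\<forall>a<r. v a \<in> polys N) \<and> (\<forall>a\<ge>r. v a = 0)}"

text \<open>The data of an augmented complex \<open>\<dots> \<rightarrow> F\<^sub>2 \<rightarrow> F\<^sub>1 \<rightarrow> F\<^sub>0 \<rightarrow> S\<close>, where
  \<open>F\<^sub>i = \<Oplus>\<^sub>a S(-shift i a)\<close> over \<open>a < rnk i\<close>. The matrix of \<open>F\<^sub>i\<^sub>+\<^sub>1 \<rightarrow> F\<^sub>i\<close> is \<open>dmat i\<close> (rows are
  indexed by the basis of the target \<open>F\<^sub>i\<close>) and the \<open>a\<close>-th basis element of \<open>F\<^sub>0\<close> is sent to
  \<open>aug a\<close>.\<close>

record 'r free_complex =
  rnk :: "nat \<Rightarrow> nat"
  shift :: "nat \<Rightarrow> nat \<Rightarrow> int"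
  dmat :: "nat \<Rightarrow> nat \<Rightarrow> nat \<Rightarrow> 'r"
  aug :: "nat \<Rightarrow> 'r"

definition cdiff :: "'k::field mpoly free_complex \<Rightarrow> nat \<Rightarrow> (nat \<Rightarrow> 'k mpoly) \<Rightarrow> nat \<Rightarrow> 'k mpoly"
  where "cdiff F i = mat_app (rnk F i) (rnk F (Suc i)) (dmat F i)"

definition aug_map :: "'k::field mpoly free_complex \<Rightarrow> (nat \<Rightarrow> 'k mpoly) \<Rightarrow> 'k mpoly"
  where "aug_map F v = (\<Sum>b<rnk F 0. v b * aug F b)"

text \<open>\<open>F\<close> is a resolution of the graded submodule \<open>M\<close> of \<open>S\<close> by graded free \<open>S\<close>-modules of finite
  rank, with maps of degree \<open>0\<close>. The zero polynomial is homogeneous of every degree.\<close>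

definition graded_free_resolution :: "nat \<Rightarrow> 'k::field mpoly set \<Rightarrow> 'k mpoly free_complex \<Rightarrow> bool"
  where "graded_free_resolution N M F \<longleftrightarrow>
    (\<forall>b<rnk F 0. aug F b \<in> polys N \<and> homogeneous (shift F 0 b) (aug F b)) \<and>
    (\<forall>i. \<forall>a<rnk F i. \<forall>b<rnk F (Suc i).
       dmat F i a b \<in> polys N \<and> homogeneous (shift F (Suc i) b - shift F i a) (dmat F i a b)) \<and>
    aug_map F ` free_mod N (rnk F 0) = M \<and>
    {v \<in> free_mod N (rnk F 0). aug_map F v = 0} = cdiff F 0 ` free_mod N (rnk F 1) \<and>
    (\<forall>i. {v \<in> free_mod N (rnk F (Suc i)). cdiff F i v = 0}
       = cdiff F (Suc i) ` free_mod N (rnk F (Suc (Suc i))))"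

text \<open>The complex \<open>k \<otimes>\<^sub>S F\<close>, where \<open>k = S/(x\<^sub>1, \<dots>, x\<^sub>N)\<close>: the module \<open>k \<otimes>\<^sub>S F\<^sub>i\<close> is the \<open>k\<close>-space
  on the basis of \<open>F\<^sub>i\<close>, its part of degree \<open>j\<close> is spanned by the basis elements of degree \<open>j\<close>, and
  the differential is given by the constant coefficients of \<open>dmat\<close>.\<close>

definition fibre :: "'k::field mpoly free_complex \<Rightarrow> nat \<Rightarrow> int \<Rightarrow> (nat \<Rightarrow> 'k) set"
  where "fibre F i j = {v. \<forall>a. v a \<noteq> 0 \<longrightarrow> a < rnk F i \<and> shift F i a = j}"

definition fibre_diff :: "'k::field mpoly free_complex \<Rightarrow> nat \<Rightarrow> (nat \<Rightarrow> 'k) \<Rightarrow> nat \<Rightarrow> 'k"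
  where "fibre_diff F i = mat_app (rnk F i) (rnk F (Suc i)) (\<lambda>a b. Poly_Mapping.lookup (dmat F i a b) 0)"

definition tor_cycles :: "'k::field mpoly free_complex \<Rightarrow> nat \<Rightarrow> int \<Rightarrow> (nat \<Rightarrow> 'k) set"
  where "tor_cycles F i j =
    (case i of 0 \<Rightarrow> fibre F 0 j | Suc i' \<Rightarrow> {v \<in> fibre F i j. fibre_diff F i' v = 0})"

definition tor_boundaries :: "'k::field mpoly free_complex \<Rightarrow> nat \<Rightarrow> int \<Rightarrow> (nat \<Rightarrow> 'k) set"
  where "tor_boundaries F i j = fibre_diff F i ` fibre F (Suc i) j"

definition vscale :: "'k::field \<Rightarrow> (nat \<Rightarrow> 'k) \<Rightarrow> nat \<Rightarrow> 'k"
  where "vscale c v = (\<lambda>a. c * v a)"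

lemma vector_space_vscale: "vector_space (vscale :: 'k::field \<Rightarrow> _)"
  by unfold_locales (auto simp: vscale_def fun_eq_iff algebra_simps)

text \<open>The dimension of the quotient of cycles by boundaries. Both spaces are finite-dimensional,
  and the boundaries are contained in the cycles when \<open>F\<close> is a resolution.\<close>

definition tor_dim :: "'k::field mpoly free_complex \<Rightarrow> nat \<Rightarrow> int \<Rightarrow> nat"
  where "tor_dim F i j =
    vector_space.dim vscale (tor_cycles F i j) - vector_space.dim vscale (tor_boundaries F i j)"

text \<open>\<open>\<beta>\<^sub>i\<^sub>,\<^sub>j(M) = dim\<^sub>k Tor\<^sub>i\<^sup>S(k, M)\<^sub>j\<close> for a graded submodule (homogeneous ideal) \<open>M\<close> of
  \<open>S = k[x\<^sub>1, \<dots>, x\<^sub>N]\<close>, computed from a chosen graded free resolution of \<open>M\<close>. As usual, the value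
  does not depend on the choice.\<close>

definition graded_betti :: "nat \<Rightarrow> 'k::field mpoly set \<Rightarrow> nat \<Rightarrow> int \<Rightarrow> nat"
  where "graded_betti N M i j = tor_dim (SOME F. graded_free_resolution N M F) i j"


section \<open>Path ideals\<close>

definition path_ideal :: "nat \<Rightarrow> nat \<Rightarrow> 'k::field mpoly set"
  where "path_ideal n m =
    genideal (poly_ring (n + m)) ((\<lambda>s. \<Prod>v\<in>{s+1..s+m}. pvar v) ` {0..n})"

definition path_ideal_power :: "nat \<Rightarrow> nat \<Rightarrow> nat \<Rightarrow> 'k::field mpoly set"
  where "path_ideal_power n m t = path_ideal n m [^]\<^bsub>ideals_set (poly_ring (n + m))\<^esub> t"


section \<open>Binomial coefficients\<close>

definition binom :: "int \<Rightarrow> int \<Rightarrow> nat"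
  where "binom a b = (if a < 0 \<or> b < 0 \<or> a < b then 0 else nat a choose nat b)"

end

theory Submission
  imports Defs
begin

text \<open>Write \<open>I\<^sub>k\<close> for the ideal of the first \<open>k\<close> path monomials \<open>u\<^sub>0, \<dots>, u\<^bsub>k-1\<^esub>\<close>. For \<open>n \<ge> 1\<close> one has
  \<open>I\<^bsub>n+1\<^esub>\<^sup>t = I\<^sub>n\<^sup>t + u\<^sub>n I\<^bsub>n+1\<^esub>\<^bsup>t-1\<^esup>\<close>, the two summands meet in \<open>u\<^sub>n (x\<^sub>n I\<^sub>n\<^bsup>t-1\<^esup> + I\<^bsub>n-m\<^esub>\<^sup>t)\<close>, and
  \<open>x\<^sub>n I\<^sub>n\<^bsup>t-1\<^esup> \<inter> I\<^bsub>n-m\<^esub>\<^sup>t = x\<^sub>n I\<^bsub>n-m\<^esub>\<^sup>t\<close>. Both sums are Betti splittings: every monomial of the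
  intersection can be divided by a variable, chosen consistently, so that the quotient lies in either
  summand. Hence the inclusions lift to maps of multigraded minimal resolutions that strictly raise
  degrees, and their mapping cones are again minimal. The resulting recursion for the Betti numbers is
  solved by the product of binomial coefficients. Comparing resolutions shows that any graded free
  resolution gives the same numbers.\<close>

section \<open>Minimal multigraded resolutions\<close>

text \<open>The resolutions are built over the field alone: in a fixed multidegree a monomial matrix
  acts by its scalar entries, so lifting and exactness are linear algebra, and the polynomial ring
  enters only when a finished resolution is turned into a \<open>free_complex\<close>. An arbitrary
  lift of an inclusion preserves multidegrees, which does not exclude unit entries; sending a
  generator of degree \<alpha> into degree \<open>lower k \<alpha>\<close> does.

  The number l in the formula has its origin in the intersection. In the step to power t+1, the part
  x_n I_n^t starts in degree tm + 1 and the part I_(n-m)^(t+1) in degree (t+1)m, which is m - 1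
  higher. Each passage to the second part moves n to n - m and l to l + 1, so n - lm is preserved;
  the other passages stay in the same strand. In the coordinates N = n - lm and p = i - l the
  recursion is Pascal's rule for three factors at once. For m >= 2 different l mean different
  degrees, so a function of i and l describes the whole Betti table.\<close>

definition mx :: "'a set \<Rightarrow> ('c \<Rightarrow> 'a \<Rightarrow> 'k::field) \<Rightarrow> ('a \<Rightarrow> 'k) \<Rightarrow> 'c \<Rightarrow> 'k"
  where "mx A C x = (\<lambda>a. \<Sum>b\<in>A. C a b * x b)"

text \<open>The degree \<alpha> part of the free module on \<open>A\<close>: a generator
  \<open>b\<close> contributes the multiples of x^(\<alpha> - deg b), hence one dimension if
  \<open>deg b \<le> \<alpha>\<close> and none otherwise.\<close>

definition chain_space :: "'a set \<Rightarrow> ('a \<Rightarrow> nat \<Rightarrow> nat) \<Rightarrow> (nat \<Rightarrow> nat) \<Rightarrow> ('a \<Rightarrow> 'k::field) set"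
  where "chain_space A deg \<alpha> = {x. \<forall>b. x b \<noteq> 0 \<longrightarrow> b \<in> A \<and> deg b \<le> \<alpha>}"

lemma mx_add: "mx A C (x + y) = mx A C x + mx A C y"
  by (simp add: mx_def fun_eq_iff algebra_simps sum.distrib)

lemma mx_diff: "mx A C (x - y) = mx A C x - mx A C y"
  by (simp add: mx_def fun_eq_iff algebra_simps sum_subtractf)

lemma mx_uminus: "mx A C (- x) = - mx A C x"
  by (simp add: mx_def fun_eq_iff sum_negf)

lemma mx_zero: "mx A C 0 = 0"
  by (simp add: mx_def fun_eq_iff)

lemma mx_mx: "mx A C (mx B D x) = mx B (\<lambda>a b. mx A C (\<lambda>c. D c b) a) x"
  by (simp add: mx_def fun_eq_iff sum_distrib_left sum_distrib_right mult.assoc)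
     (subst sum.swap, simp)

lemma mx_cong: "(\<And>a b. b \<in> A \<Longrightarrow> C a b = D a b) \<Longrightarrow> mx A C x = mx A D x"
  by (simp add: mx_def)

lemma mx_single: "finite A \<Longrightarrow> b \<in> A \<Longrightarrow> mx A C (\<lambda>c. if c = b then 1 else 0) = (\<lambda>a. C a b)"
  by (simp add: mx_def fun_eq_iff if_distrib[of "\<lambda>z. _ * z"] sum.delta' cong: if_cong)

text \<open>The augmentation sends every generator to its own monomial, so in each multidegree it is
  the sum of the coefficients. As an all-ones matrix it repeats this value in every row, and its
  kernel consists of the vectors with sum 0.\<close>

lemma mx_one: "mx A (\<lambda>a b. 1) x = (\<lambda>_. sum x A)"
  by (simp add: mx_def)

lemma chain_space_add: "x \<in> chain_space A deg \<alpha> \<Longrightarrow> y \<in> chain_space A deg \<alpha> \<Longrightarrow> x + y \<in> chain_space A deg \<alpha>"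
  by (auto simp: chain_space_def) (metis add_cancel_left_left)+

lemma chain_space_uminus: "x \<in> chain_space A deg \<alpha> \<Longrightarrow> - x \<in> chain_space A deg \<alpha>"
  by (auto simp: chain_space_def)

lemma chain_space_diff: "x \<in> chain_space A deg \<alpha> \<Longrightarrow> y \<in> chain_space A deg \<alpha> \<Longrightarrow> x - y \<in> chain_space A deg \<alpha>"
  using chain_space_add[of x A deg \<alpha> "- y"] chain_space_uminus[of y A deg \<alpha>] by simp

lemma chain_space_zero: "0 \<in> chain_space A deg \<alpha>"
  by (simp add: chain_space_def)

lemma mx_nonzeroE:
  assumes "mx A C x a \<noteq> 0"
  obtains b where "b \<in> A" "C a b \<noteq> 0" "x b \<noteq> 0"
  using assms sum.neutral[of A "\<lambda>b. C a b * x b"] unfolding mx_def by fastforce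

lemma mx_chain_space:
  assumes "\<And>a b. C a b \<noteq> 0 \<Longrightarrow> a \<in> A' \<and> deg' a \<le> deg b" and "x \<in> chain_space A deg \<alpha>"
  shows "mx A C x \<in> chain_space A' deg' \<alpha>"
proof -
  have "a \<in> A' \<and> deg' a \<le> \<alpha>" if "mx A C x a \<noteq> 0" for a
  proof -
    obtain b where "C a b \<noteq> 0" "x b \<noteq> 0" using mx_nonzeroE[OF \<open>mx A C x a \<noteq> 0\<close>] by blast
    then show ?thesis using assms order_trans unfolding chain_space_def by blast
  qed
  then show ?thesis by (simp add: chain_space_def)
qed

text \<open>A multigraded minimal resolution of the monomial ideal with exponent set \<open>M\<close>. The entry of the
  \<open>i\<close>-th differential at \<open>(a, b)\<close> is the scalar \<open>C i a b\<close> times the monomial of exponent \<open>deg b - deg a\<close>,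
  and \<open>C 0\<close> is the augmentation. In each multidegree the complex becomes a complex of vector spaces,
  spanned by the generators of smaller degree; minimality is \<open>deg a < deg b\<close>.\<close>

definition min_res :: "nat \<Rightarrow> (nat \<Rightarrow> nat) set \<Rightarrow> (nat \<Rightarrow> 'a set) \<Rightarrow> ('a \<Rightarrow> nat \<Rightarrow> nat)
    \<Rightarrow> (nat \<Rightarrow> 'a \<Rightarrow> 'a \<Rightarrow> 'k::field) \<Rightarrow> bool"
  where "min_res N M B deg C \<longleftrightarrow>
    (\<forall>i. finite (B i)) \<and>
    (\<forall>i. \<forall>b\<in>B i. deg b \<in> M \<and> {v. deg b v \<noteq> 0} \<subseteq> {1..N}) \<and>
    C 0 = (\<lambda>a b. 1) \<and>
    (\<forall>i a b. C (Suc i) a b \<noteq> 0 \<longrightarrow> a \<in> B i \<and> b \<in> B (Suc i) \<and> deg a < deg b) \<and>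
    (\<forall>i x. mx (B i) (C i) (mx (B (Suc i)) (C (Suc i)) x) = 0) \<and>
    (\<forall>\<alpha>\<in>M. \<exists>b\<in>B 0. deg b \<le> \<alpha>) \<and>
    (\<forall>i \<alpha>. \<forall>x\<in>chain_space (B i) deg \<alpha>. mx (B i) (C i) x = 0 \<longrightarrow>
       (\<exists>y\<in>chain_space (B (Suc i)) deg \<alpha>. mx (B (Suc i)) (C (Suc i)) y = x))"

lemma min_resD:
  assumes "min_res N M B deg C"
  shows "finite (B i)" and "b \<in> B i \<Longrightarrow> deg b \<in> M" and "b \<in> B i \<Longrightarrow> {v. deg b v \<noteq> 0} \<subseteq> {1..N}"
    and "C 0 = (\<lambda>a b. 1)"
    and "C (Suc i) a b \<noteq> 0 \<Longrightarrow> a \<in> B i \<and> b \<in> B (Suc i) \<and> deg a < deg b"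
    and "mx (B i) (C i) (mx (B (Suc i)) (C (Suc i)) x) = 0"
    and "\<alpha> \<in> M \<Longrightarrow> \<exists>b\<in>B 0. deg b \<le> \<alpha>"
    and "x \<in> chain_space (B i) deg \<alpha> \<Longrightarrow> mx (B i) (C i) x = 0 \<Longrightarrow>
       \<exists>y\<in>chain_space (B (Suc i)) deg \<alpha>. mx (B (Suc i)) (C (Suc i)) y = x"
  using assms unfolding min_res_def by (blast)+

text \<open>The variable \<open>pivot k \<alpha>\<close> is the first one of the support of \<open>\<alpha>\<close> in a fixed order of the variables
  with \<open>k\<close> in front. This consistency makes \<open>lower k\<close> monotone, which is what the lifting needs.\<close>

definition pivot :: "nat \<Rightarrow> (nat \<Rightarrow> nat) \<Rightarrow> nat"
  where "pivot k \<alpha> = (if 0 < \<alpha> k then k else LEAST v. 0 < \<alpha> v)"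

definition lower :: "nat \<Rightarrow> (nat \<Rightarrow> nat) \<Rightarrow> nat \<Rightarrow> nat"
  where "lower k \<alpha> = \<alpha>(pivot k \<alpha> := \<alpha> (pivot k \<alpha>) - 1)"

lemma pivot_pos: "0 < \<alpha> v \<Longrightarrow> 0 < \<alpha> (pivot k \<alpha>)"
  unfolding pivot_def by (auto intro: LeastI)

text \<open>The support of \<alpha> lies in that of \<beta>. Hence the first variable of the larger
  support is also first in the smaller one as soon as it belongs to it.\<close>

lemma pivot_mono:
  assumes "\<alpha> \<le> \<beta>" "0 < \<alpha> (pivot k \<beta>)"
  shows "pivot k \<alpha> = pivot k \<beta>"
proof -
  have le: "\<alpha> v \<le> \<beta> v" for v using assms(1) by (simp add: le_fun_def)
  show ?thesis
  proof (cases "0 < \<beta> k")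
    case True
    then show ?thesis using assms(2) by (simp add: pivot_def)
  next
    case False
    then have "\<not> 0 < \<alpha> k" using le[of k] by simp
    moreover have "(LEAST v. 0 < \<alpha> v) = (LEAST v. 0 < \<beta> v)"
    proof (rule Least_equality)
      show "0 < \<alpha> (LEAST v. 0 < \<beta> v)" using False assms(2) by (simp add: pivot_def)
      show "(LEAST v. 0 < \<beta> v) \<le> y" if "0 < \<alpha> y" for y
        using that le[of y] by (intro Least_le) simp
    qed
    ultimately show ?thesis using False by (simp add: pivot_def)
  qed
qed

lemma lower_le: "lower k \<alpha> \<le> \<alpha>"
  by (simp add: lower_def le_fun_def)

text \<open>If \<alpha> contains the variable removed from \<beta>, the same variable is removed
  from both. Otherwise \<alpha> is already 0 in the one coordinate where
  \<open>lower k \<beta>\<close> differs from \<beta>.\<close>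

lemma lower_mono:
  assumes "\<alpha> \<le> \<beta>"
  shows "lower k \<alpha> \<le> lower k \<beta>"
proof (cases "0 < \<alpha> (pivot k \<beta>)")
  case True
  then have "pivot k \<alpha> = pivot k \<beta>" using pivot_mono[OF assms] by blast
  then show ?thesis using assms by (auto simp: lower_def le_fun_def intro: diff_le_mono)
next
  case False
  then have "lower k \<alpha> (pivot k \<beta>) = 0"
    using lower_le[of k \<alpha>] by (simp add: le_fun_def)  (metis le_zero_eq)
  moreover have "lower k \<alpha> v \<le> \<beta> v" for v
    using order_trans[OF lower_le assms] by (simp add: le_fun_def)
  ultimately show ?thesis by (simp add: lower_def[of k \<beta>] le_fun_def)
qed

lemma lower_less:
  assumes "0 < \<alpha> v"
  shows "lower k \<alpha> < \<alpha>"
proof -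
  have "lower k \<alpha> (pivot k \<alpha>) < \<alpha> (pivot k \<alpha>)"
    using pivot_pos[of \<alpha> v k] assms by (simp add: lower_def)
  then have "\<not> \<alpha> \<le> lower k \<alpha>" unfolding le_fun_def by (meson not_less)
  then show ?thesis using lower_le by (simp add: less_le_not_le)
qed

text \<open>A comparison map lifted column by column, but with a generator \<open>b\<close> sent
  into degree \<open>lower k (deg b)\<close> instead of \<open>deg b\<close>. Exactness of the
  target in the smaller degree supplies the lift, monotonicity of \<open>lower\<close> keeps the
  image of the boundary of \<open>b\<close> inside that degree, and \<open>lower_less\<close> gives
  the strict inequality that excludes unit entries.\<close>

lemma lift_exists:
  fixes C :: "nat \<Rightarrow> 'a \<Rightarrow> 'a \<Rightarrow> 'k::field" and C' :: "nat \<Rightarrow> 'b \<Rightarrow> 'b \<Rightarrow> 'k"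
  assumes L: "min_res N I B deg C" and F: "min_res N J B' deg' C'"
    and IJ: "\<And>\<alpha>. \<alpha> \<in> I \<Longrightarrow> (\<exists>v. 0 < \<alpha> v) \<and> lower k \<alpha> \<in> J"
  obtains \<phi> where "\<And>i a b. \<phi> i a b \<noteq> 0 \<Longrightarrow> a \<in> B' i \<and> b \<in> B i \<and> deg' a < deg b"
    and "\<And>x. mx (B' 0) (C' 0) (mx (B 0) (\<phi> 0) x) = (\<lambda>_. sum x (B 0))"
    and "\<And>i x. mx (B' (Suc i)) (C' (Suc i)) (mx (B (Suc i)) (\<phi> (Suc i)) x)
           = mx (B i) (\<phi> i) (mx (B (Suc i)) (C (Suc i)) x)"
proof -
  \<comment> \<open>The last clause, that cycles go to cycles, is the part of the chain map property
    that concerns one stage alone. It is what the choice of the next stage needs, whereas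
    \<open>Q\<close> couples two stages.\<close>
  define P where "P i f \<longleftrightarrow> (\<forall>b. (\<lambda>a. f a b) \<in> chain_space (B' i) deg' (lower k (deg b))) \<and>
      (\<forall>a b. b \<notin> B i \<longrightarrow> f a b = 0) \<and>
      (i = 0 \<longrightarrow> (\<forall>x. mx (B' 0) (C' 0) (mx (B 0) f x) = (\<lambda>_. sum x (B 0)))) \<and>
      (\<forall>x. mx (B i) (C i) x = 0 \<longrightarrow> mx (B' i) (C' i) (mx (B i) f x) = 0)"
    for i and f :: "'b \<Rightarrow> 'a \<Rightarrow> 'k"
  define Q where "Q i f g \<longleftrightarrow> (\<forall>x. mx (B' (Suc i)) (C' (Suc i)) (mx (B (Suc i)) g x)
           = mx (B i) f (mx (B (Suc i)) (C (Suc i)) x))" for i and f g :: "'b \<Rightarrow> 'a \<Rightarrow> 'k"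
  have base: "\<exists>f. P 0 f"
  proof -
    have "\<exists>c\<in>B' 0. deg' c \<le> lower k (deg b)" if "b \<in> B 0" for b
      using min_resD(7)[OF F] IJ min_resD(2)[OF L that] by blast
    then obtain g where g: "\<And>b. b \<in> B 0 \<Longrightarrow> g b \<in> B' 0 \<and> deg' (g b) \<le> lower k (deg b)" by metis
    define f where "f a b = (if b \<in> B 0 \<and> a = g b then 1 else 0::'k)" for a b
    have 1: "mx (B' 0) (C' 0) (\<lambda>a. f a b) c = 1" if "b \<in> B 0" for b c
      using g[OF that] min_resD(1)[OF F, of 0] that
      by (simp add: mx_def f_def min_resD(4)[OF F] sum.delta)
    have 2: "mx (B' 0) (C' 0) (mx (B 0) f x) = (\<lambda>_. sum x (B 0))" for x
    proof -
      have "mx (B' 0) (C' 0) (mx (B 0) f x) = mx (B 0) (\<lambda>a b. 1) x"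
        unfolding mx_mx by (rule mx_cong) (simp add: 1)
      then show ?thesis by (simp add: mx_one)
    qed
    have "P 0 f"
      unfolding P_def
    proof (intro conjI allI impI)
      show "(\<lambda>a. f a b) \<in> chain_space (B' 0) deg' (lower k (deg b))" for b
        using g[of b] by (simp add: f_def chain_space_def)
      show "f a b = 0" if "b \<notin> B 0" for a b using that by (simp add: f_def)
      show "mx (B' 0) (C' 0) (mx (B 0) f x) = (\<lambda>_. sum x (B 0))" for x by (rule 2)
      show "mx (B' 0) (C' 0) (mx (B 0) f x) = 0" if "mx (B 0) (C 0) x = 0" for x
        using that by (simp add: 2 min_resD(4)[OF L] mx_one fun_eq_iff)
    qed
    then show ?thesis by (rule exI[of "P 0" f])
  qed
  have step: "\<exists>g. P (Suc i) g \<and> Q i f g" if P: "P i f" for f i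
  proof -
    define z where "z b = mx (B i) f (\<lambda>a. C (Suc i) a b)" for b
    have "\<exists>y. y \<in> chain_space (B' (Suc i)) deg' (lower k (deg b)) \<and> mx (B' (Suc i)) (C' (Suc i)) y = z b"
      if b: "b \<in> B (Suc i)" for b
    proof -
      have "mx (B i) (C i) (\<lambda>a. C (Suc i) a b) = 0"
        using min_resD(6)[OF L, of i "\<lambda>c. if c = b then 1 else 0"]
        by (simp only: mx_single[OF min_resD(1)[OF L] b])
      then have "mx (B' i) (C' i) (z b) = 0" using P by (simp add: P_def z_def)
      moreover have "z b \<in> chain_space (B' i) deg' (lower k (deg b))"
      proof -
        have "s \<in> B' i \<and> deg' s \<le> lower k (deg b)" if zs: "z b s \<noteq> 0" for s
        proof -
          obtain a where "f s a \<noteq> 0" "C (Suc i) a b \<noteq> 0"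
            using mx_nonzeroE[of "B i" f "\<lambda>a. C (Suc i) a b" s] zs unfolding z_def by blast
          then have "s \<in> B' i" "deg' s \<le> lower k (deg a)" "deg a \<le> deg b"
            using P min_resD(5)[OF L, of i a b] by (auto simp: P_def chain_space_def)
          then show ?thesis using lower_mono[of "deg a" "deg b" k] by auto
        qed
        then show ?thesis by (simp add: chain_space_def)
      qed
      ultimately show ?thesis using min_resD(8)[OF F] by blast
    qed
    then obtain Y where Y: "\<And>b. b \<in> B (Suc i) \<Longrightarrow> Y b \<in> chain_space (B' (Suc i)) deg' (lower k (deg b))
        \<and> mx (B' (Suc i)) (C' (Suc i)) (Y b) = z b" by metis
    define g where "g a b = (if b \<in> B (Suc i) then Y b a else 0)" for a b
    have Q: "Q i f g"
      unfolding Q_def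
    proof
      fix x
      show "mx (B' (Suc i)) (C' (Suc i)) (mx (B (Suc i)) g x) = mx (B i) f (mx (B (Suc i)) (C (Suc i)) x)"
        unfolding mx_mx using Y by (intro mx_cong) (simp add: g_def z_def)
    qed
    moreover have "P (Suc i) g"
      unfolding P_def
    proof (intro conjI allI impI)
      show "(\<lambda>a. g a b) \<in> chain_space (B' (Suc i)) deg' (lower k (deg b))" for b
        using Y[of b] by (cases "b \<in> B (Suc i)") (auto simp: g_def chain_space_def)
      show "g a b = 0" if "b \<notin> B (Suc i)" for a b using that by (simp add: g_def)
      show "mx (B' (Suc i)) (C' (Suc i)) (mx (B (Suc i)) g x) = 0" if "mx (B (Suc i)) (C (Suc i)) x = 0" for x
        using Q that by (simp add: Q_def mx_zero)
    qed simp
    ultimately have "P (Suc i) g \<and> Q i f g" by simp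
    then show ?thesis by (rule exI[of "\<lambda>g. P (Suc i) g \<and> Q i f g" g])
  qed
  have "\<exists>\<phi>. \<forall>i. P i (\<phi> i) \<and> Q i (\<phi> i) (\<phi> (Suc i))"
    using dependent_nat_choice[of P Q] base step by simp
  then obtain \<phi> where \<phi>: "\<And>i. P i (\<phi> i)" "\<And>i. Q i (\<phi> i) (\<phi> (Suc i))" by blast
  show ?thesis
  proof (rule that[of \<phi>])
    show "a \<in> B' i \<and> b \<in> B i \<and> deg' a < deg b" if "\<phi> i a b \<noteq> 0" for i a b
    proof -
      have b: "b \<in> B i" and a: "a \<in> B' i" "deg' a \<le> lower k (deg b)"
        using that \<phi>(1)[of i] by (auto simp: P_def chain_space_def)
      then have "deg' a < deg b"
        using IJ[OF min_resD(2)[OF L b]] lower_less order.strict_trans1 by metis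
      then show ?thesis using a b by blast
    qed
  qed (use \<phi>(1)[of 0] \<phi>(2) in \<open>auto simp: P_def Q_def\<close>)
qed

section \<open>Mapping cones\<close>

text \<open>Formal labels closed under the three-fold disjoint union of a cone, so that all iterated
  cones live over one type. \<open>Leaf\<close> labels the generator of the unit ideal.\<close>

datatype lab = Leaf | InF lab | InG lab | InL lab

fun cone_basis :: "(nat \<Rightarrow> lab set) \<Rightarrow> (nat \<Rightarrow> lab set) \<Rightarrow> (nat \<Rightarrow> lab set) \<Rightarrow> nat \<Rightarrow> lab set" where
  "cone_basis BF BG BL 0 = InF ` BF 0 \<union> InG ` BG 0"
| "cone_basis BF BG BL (Suc i) = InF ` BF (Suc i) \<union> InG ` BG (Suc i) \<union> InL ` BL i"

fun cone_deg :: "(lab \<Rightarrow> nat \<Rightarrow> nat) \<Rightarrow> (lab \<Rightarrow> nat \<Rightarrow> nat) \<Rightarrow> (lab \<Rightarrow> nat \<Rightarrow> nat) \<Rightarrow> lab \<Rightarrow> nat \<Rightarrow> nat" where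
  "cone_deg dF dG dL Leaf = 0"
| "cone_deg dF dG dL (InF b) = dF b"
| "cone_deg dF dG dL (InG b) = dG b"
| "cone_deg dF dG dL (InL b) = dL b"

text \<open>Cone of the map (\<open>\<phi>\<close>, \<open>- \<psi>\<close>) from the resolution of
  the intersection to the direct sum of the other two; the opposite signs make the common
  augmentation vanish on its image. In cone degree 1 the block from \<open>InL\<close> to
  \<open>InL\<close> is 0, because \<open>CL 0\<close> is the augmentation and not a
  differential.\<close>

fun cone_mat :: "(nat \<Rightarrow> lab \<Rightarrow> lab \<Rightarrow> 'k::field) \<Rightarrow> (nat \<Rightarrow> lab \<Rightarrow> lab \<Rightarrow> 'k) \<Rightarrow> (nat \<Rightarrow> lab \<Rightarrow> lab \<Rightarrow> 'k)
    \<Rightarrow> (nat \<Rightarrow> lab \<Rightarrow> lab \<Rightarrow> 'k) \<Rightarrow> (nat \<Rightarrow> lab \<Rightarrow> lab \<Rightarrow> 'k) \<Rightarrow> nat \<Rightarrow> lab \<Rightarrow> lab \<Rightarrow> 'k" where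
  "cone_mat CF CG CL \<phi> \<psi> 0 a b = 1"
| "cone_mat CF CG CL \<phi> \<psi> (Suc i) (InF a) (InF b) = CF (Suc i) a b"
| "cone_mat CF CG CL \<phi> \<psi> (Suc i) (InG a) (InG b) = CG (Suc i) a b"
| "cone_mat CF CG CL \<phi> \<psi> (Suc i) (InF a) (InL b) = \<phi> i a b"
| "cone_mat CF CG CL \<phi> \<psi> (Suc i) (InG a) (InL b) = - \<psi> i a b"
| "cone_mat CF CG CL \<phi> \<psi> (Suc i) (InL a) (InL b) = (if i = 0 then 0 else - CL i a b)"
| "cone_mat CF CG CL \<phi> \<psi> (Suc i) _ _ = 0"

fun glue :: "(lab \<Rightarrow> 'k::field) \<Rightarrow> (lab \<Rightarrow> 'k) \<Rightarrow> (lab \<Rightarrow> 'k) \<Rightarrow> lab \<Rightarrow> 'k" where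
  "glue f g l Leaf = 0"
| "glue f g l (InF b) = f b"
| "glue f g l (InG b) = g b"
| "glue f g l (InL b) = l b"

lemma glue_eqI:
  assumes "x Leaf = 0" "\<And>b. x (InF b) = f b" "\<And>b. x (InG b) = g b" "\<And>b. x (InL b) = l b"
  shows "x = glue f g l"
proof
  fix a show "x a = glue f g l a" using assms by (cases a) auto
qed

lemma glue_eq_0: "glue f g l = 0 \<longleftrightarrow> f = 0 \<and> g = 0 \<and> l = 0"
proof
  assume j: "glue f g l = 0"
  have "f b = 0" "g b = 0" "l b = 0" for b
    using fun_cong[OF j, of "InF b"] fun_cong[OF j, of "InG b"] fun_cong[OF j, of "InL b"] by auto
  then show "f = 0 \<and> g = 0 \<and> l = 0" by (simp add: fun_eq_iff)
next
  assume "f = 0 \<and> g = 0 \<and> l = 0"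
  then show "glue f g l = 0" by (auto simp: fun_eq_iff intro: glue.elims[of f g l] simp flip: glue_eqI)
qed

lemma sum_cone_basis_Suc:
  assumes "finite (BF (Suc i))" "finite (BG (Suc i))" "finite (BL i)"
  shows "sum h (cone_basis BF BG BL (Suc i))
    = (\<Sum>b\<in>BF (Suc i). h (InF b)) + (\<Sum>b\<in>BG (Suc i). h (InG b)) + (\<Sum>b\<in>BL i. h (InL b))"
proof -
  have "sum h (cone_basis BF BG BL (Suc i))
    = sum h (InF ` BF (Suc i)) + sum h (InG ` BG (Suc i)) + sum h (InL ` BL i)"
    unfolding cone_basis.simps using assms
    by (subst sum.union_disjoint, simp, simp, force)+ simp
  then show ?thesis by (simp add: sum.reindex inj_on_def)
qed

lemma sum_cone_basis_0:
  assumes "finite (BF 0)" "finite (BG 0)"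
  shows "sum h (cone_basis BF BG BL 0) = (\<Sum>b\<in>BF 0. h (InF b)) + (\<Sum>b\<in>BG 0. h (InG b))"
  using assms
  by (subst cone_basis.simps, subst sum.union_disjoint)
    (auto simp: sum.reindex inj_on_def)

lemma mx_cone_0:
  assumes "finite (BF 0)" "finite (BG 0)"
  shows "mx (cone_basis BF BG BL 0) (cone_mat CF CG CL \<phi> \<psi> 0) (glue f g l)
    = (\<lambda>_. sum f (BF 0) + sum g (BG 0))"
  using assms by (simp add: mx_def sum_cone_basis_0 del: cone_basis.simps)

lemma mx_cone_Suc:
  assumes "finite (BF (Suc i))" "finite (BG (Suc i))" "finite (BL i)"
  shows "mx (cone_basis BF BG BL (Suc i)) (cone_mat CF CG CL \<phi> \<psi> (Suc i)) (glue f g l)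
    = glue (mx (BF (Suc i)) (CF (Suc i)) f + mx (BL i) (\<phi> i) l)
           (mx (BG (Suc i)) (CG (Suc i)) g - mx (BL i) (\<psi> i) l)
           (if i = 0 then 0 else - mx (BL i) (CL i) l)"
  using assms
  by (intro glue_eqI) (simp_all add: mx_def sum_cone_basis_Suc sum_negf del: cone_basis.simps)

lemma glue_chain_space:
  assumes "glue f g l \<in> chain_space (cone_basis BF BG BL i) (cone_deg dF dG dL) \<alpha>"
  shows "f \<in> chain_space (BF i) dF \<alpha>" "g \<in> chain_space (BG i) dG \<alpha>"
    "l \<in> chain_space (case i of 0 \<Rightarrow> {} | Suc j \<Rightarrow> BL j) dL \<alpha>"
proof -
  have *: "glue f g l a \<noteq> 0 \<Longrightarrow> a \<in> cone_basis BF BG BL i \<and> cone_deg dF dG dL a \<le> \<alpha>" for a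
    using assms by (simp add: chain_space_def)
  show "f \<in> chain_space (BF i) dF \<alpha>" using *[of "InF _"] by (cases i) (auto simp: chain_space_def)
  show "g \<in> chain_space (BG i) dG \<alpha>" using *[of "InG _"] by (cases i) (auto simp: chain_space_def)
  show "l \<in> chain_space (case i of 0 \<Rightarrow> {} | Suc j \<Rightarrow> BL j) dL \<alpha>"
    using *[of "InL _"] by (cases i) (auto simp: chain_space_def)
qed

lemma chain_space_glueI:
  assumes "f \<in> chain_space (BF (Suc i)) dF \<alpha>" "g \<in> chain_space (BG (Suc i)) dG \<alpha>" "l \<in> chain_space (BL i) dL \<alpha>"
  shows "glue f g l \<in> chain_space (cone_basis BF BG BL (Suc i)) (cone_deg dF dG dL) \<alpha>"
proof -
  have "a \<in> cone_basis BF BG BL (Suc i) \<and> cone_deg dF dG dL a \<le> \<alpha>" if "glue f g l a \<noteq> 0" for a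
    using that assms by (cases a) (auto simp: chain_space_def)
  then show ?thesis by (simp add: chain_space_def)
qed

lemma chain_space_is_glue:
  assumes "x \<in> chain_space (cone_basis BF BG BL i) deg \<alpha>"
  obtains f g l where "x = glue f g l"
proof -
  have "x Leaf = 0" using assms by (cases i) (auto simp: chain_space_def)
  then have "x = glue (\<lambda>b. x (InF b)) (\<lambda>b. x (InG b)) (\<lambda>b. x (InL b))" by (intro glue_eqI) auto
  then show ?thesis using that by blast
qed

definition upset :: "'a::order set \<Rightarrow> bool"
  where "upset M \<longleftrightarrow> (\<forall>\<alpha>\<in>M. \<forall>\<beta>. \<alpha> \<le> \<beta> \<longrightarrow> \<beta> \<in> M)"

text \<open>In each multidegree the cone realises the exact sequence with the ideal of
  \<open>J \<inter> K\<close>, the direct sum of the ideals of \<open>J\<close> and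
  \<open>K\<close>, and the ideal of \<open>J \<union> K\<close>. Minimality of the new blocks is
  the strict inequality of degrees assumed of \<open>\<phi>\<close> and
  \<open>\<psi>\<close>.\<close>

lemma min_res_cone:
  assumes F: "min_res N J BF dF CF" and G: "min_res N K BG dG CG" and L: "min_res N (J \<inter> K) BL dL CL"
    and up: "upset J" "upset K"
    and \<phi>: "\<And>i a b. \<phi> i a b \<noteq> 0 \<Longrightarrow> a \<in> BF i \<and> b \<in> BL i \<and> dF a < dL b"
      "\<And>x. mx (BF 0) (CF 0) (mx (BL 0) (\<phi> 0) x) = (\<lambda>_. sum x (BL 0))"
      "\<And>i x. mx (BF (Suc i)) (CF (Suc i)) (mx (BL (Suc i)) (\<phi> (Suc i)) x)
           = mx (BL i) (\<phi> i) (mx (BL (Suc i)) (CL (Suc i)) x)"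
    and \<psi>: "\<And>i a b. \<psi> i a b \<noteq> 0 \<Longrightarrow> a \<in> BG i \<and> b \<in> BL i \<and> dG a < dL b"
      "\<And>x. mx (BG 0) (CG 0) (mx (BL 0) (\<psi> 0) x) = (\<lambda>_. sum x (BL 0))"
      "\<And>i x. mx (BG (Suc i)) (CG (Suc i)) (mx (BL (Suc i)) (\<psi> (Suc i)) x)
           = mx (BL i) (\<psi> i) (mx (BL (Suc i)) (CL (Suc i)) x)"
  shows "min_res N (J \<union> K) (cone_basis BF BG BL) (cone_deg dF dG dL) (cone_mat CF CG CL \<phi> \<psi>)"
proof -
  note fin = min_resD(1)[OF F] min_resD(1)[OF G] min_resD(1)[OF L]
  note mx0 = mx_cone_0[OF fin(1,2)] and mxS = mx_cone_Suc[OF fin]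
  have augs: "mx A (CF 0) x = (\<lambda>_. sum x A)" "mx A (CG 0) x = (\<lambda>_. sum x A)"
    "mx A (CL 0) x = (\<lambda>_. sum x A)" for A x
    using min_resD(4)[OF F] min_resD(4)[OF G] min_resD(4)[OF L] by (simp_all add: mx_one)
  have \<phi>0: "sum (mx (BL 0) (\<phi> 0) x) (BF 0) = sum x (BL 0)" for x
    using \<phi>(2)[of x] by (simp add: augs fun_eq_iff)
  have \<psi>0: "sum (mx (BL 0) (\<psi> 0) x) (BG 0) = sum x (BL 0)" for x
    using \<psi>(2)[of x] by (simp add: augs fun_eq_iff)
  have ss: "sum (mx (BF (Suc 0)) (CF (Suc 0)) x) (BF 0) = 0"
    "sum (mx (BG (Suc 0)) (CG (Suc 0)) x) (BG 0) = 0"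
    "sum (mx (BL (Suc 0)) (CL (Suc 0)) x) (BL 0) = 0" for x
    using min_resD(6)[OF F, of 0 x] min_resD(6)[OF G, of 0 x] min_resD(6)[OF L, of 0 x]
    by (simp_all add: augs fun_eq_iff)
  have \<phi>ch: "mx (BL i) (\<phi> i) x \<in> chain_space (BF i) dF \<alpha>" if "x \<in> chain_space (BL i) dL \<alpha>" for i x \<alpha>
    by (rule mx_chain_space[OF _ that]) (use \<phi>(1) in \<open>auto simp: less_imp_le\<close>)
  have \<psi>ch: "mx (BL i) (\<psi> i) x \<in> chain_space (BG i) dG \<alpha>" if "x \<in> chain_space (BL i) dL \<alpha>" for i x \<alpha>
    by (rule mx_chain_space[OF _ that]) (use \<psi>(1) in \<open>auto simp: less_imp_le\<close>)
  show ?thesis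
    unfolding min_res_def
  proof (intro conjI allI ballI impI)
    show "finite (cone_basis BF BG BL i)" for i
      using fin by (cases i) auto
    show "cone_deg dF dG dL b \<in> J \<union> K" "{v. cone_deg dF dG dL b v \<noteq> 0} \<subseteq> {1..N}"
      if "b \<in> cone_basis BF BG BL i" for i b
      using that min_resD(2,3)[OF F] min_resD(2,3)[OF G] min_resD(2,3)[OF L]
      by (cases i; fastforce)+
    show "cone_mat CF CG CL \<phi> \<psi> 0 = (\<lambda>a b. 1)" by (simp add: fun_eq_iff)
    show "a \<in> cone_basis BF BG BL i" "b \<in> cone_basis BF BG BL (Suc i)" "cone_deg dF dG dL a < cone_deg dF dG dL b"
      if "cone_mat CF CG CL \<phi> \<psi> (Suc i) a b \<noteq> 0" for i a b
    proof -
      have "a \<in> cone_basis BF BG BL i \<and> b \<in> cone_basis BF BG BL (Suc i) \<and> cone_deg dF dG dL a < cone_deg dF dG dL b"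
        using that min_resD(5)[OF F] min_resD(5)[OF G] min_resD(5)[OF L] \<phi>(1) \<psi>(1)
        by (cases i; cases a; cases b) (auto split: if_splits)
      then show "a \<in> cone_basis BF BG BL i" "b \<in> cone_basis BF BG BL (Suc i)"
        "cone_deg dF dG dL a < cone_deg dF dG dL b" by auto
    qed
    show "\<exists>b\<in>cone_basis BF BG BL 0. cone_deg dF dG dL b \<le> \<alpha>" if "\<alpha> \<in> J \<union> K" for \<alpha>
      using that min_resD(7)[OF F, of \<alpha>] min_resD(7)[OF G, of \<alpha>] by (simp add: bex_Un) blast
  next
    fix i and x :: "lab \<Rightarrow> 'a"
    let ?x = "glue (\<lambda>b. x (InF b)) (\<lambda>b. x (InG b)) (\<lambda>b. x (InL b))"
    have "mx (cone_basis BF BG BL (Suc i)) C x = mx (cone_basis BF BG BL (Suc i)) C ?x"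
      for C :: "lab \<Rightarrow> lab \<Rightarrow> 'a"
      unfolding mx_def by (intro ext sum.cong) auto
    moreover have "mx (cone_basis BF BG BL i) (cone_mat CF CG CL \<phi> \<psi> i)
        (mx (cone_basis BF BG BL (Suc i)) (cone_mat CF CG CL \<phi> \<psi> (Suc i)) (glue f g l)) = 0" for f g l
    proof (cases i)
      case 0
      then show ?thesis
        by (simp add: mxS mx0 sum.distrib sum_subtractf \<phi>0 \<psi>0 ss fun_eq_iff del: cone_basis.simps)
    next
      case (Suc j)
      have a: "mx (BF (Suc j)) (CF (Suc j)) (mx (BF (Suc (Suc j))) (CF (Suc (Suc j))) f) = 0"
        "mx (BG (Suc j)) (CG (Suc j)) (mx (BG (Suc (Suc j))) (CG (Suc (Suc j))) g) = 0"
        "mx (BL j) (CL j) (mx (BL (Suc j)) (CL (Suc j)) l) = 0"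
        using min_resD(6)[OF F] min_resD(6)[OF G] min_resD(6)[OF L] by auto
      show ?thesis
        unfolding Suc mxS by (simp add: mx_add mx_diff mx_uminus a \<phi>(3) \<psi>(3) glue_eq_0)
    qed
    ultimately show "mx (cone_basis BF BG BL i) (cone_mat CF CG CL \<phi> \<psi> i)
        (mx (cone_basis BF BG BL (Suc i)) (cone_mat CF CG CL \<phi> \<psi> (Suc i)) x) = 0" by simp
  next
    fix i \<alpha> x
    let ?D = "\<lambda>i. mx (cone_basis BF BG BL i) (cone_mat CF CG CL \<phi> \<psi> i)"
    assume x: "x \<in> chain_space (cone_basis BF BG BL i) (cone_deg dF dG dL) \<alpha>" and z: "?D i x = 0"
    obtain f g l where xj: "x = glue f g l" using chain_space_is_glue[OF x] by blast
    note ch = glue_chain_space[OF x[unfolded xj]]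
    \<comment> \<open>A cycle (f, g, l) is a boundary once \<open>l\<close> is minus the boundary of
      some \<open>k\<close> in the same multidegree for which the corrected \<open>f\<close> and
      \<open>g\<close> are cycles; exactness of the two outer resolutions does the rest. In degree
      0, where \<open>l\<close> is 0, only the two corrections are asked of
      \<open>k\<close>.\<close>
    have solve: "\<exists>y\<in>chain_space (cone_basis BF BG BL (Suc i)) (cone_deg dF dG dL) \<alpha>. ?D (Suc i) y = x"
      if k: "k \<in> chain_space (BL i) dL \<alpha>" and kl: "(if i = 0 then 0 else - mx (BL i) (CL i) k) = l"
        and f: "mx (BF i) (CF i) (f - mx (BL i) (\<phi> i) k) = 0"
        and g: "mx (BG i) (CG i) (g + mx (BL i) (\<psi> i) k) = 0" for k
    proof -
      obtain f' where f': "f' \<in> chain_space (BF (Suc i)) dF \<alpha>" "mx (BF (Suc i)) (CF (Suc i)) f' = f - mx (BL i) (\<phi> i) k"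
        using min_resD(8)[OF F chain_space_diff[OF ch(1) \<phi>ch[OF k]] f] by blast
      obtain g' where g': "g' \<in> chain_space (BG (Suc i)) dG \<alpha>" "mx (BG (Suc i)) (CG (Suc i)) g' = g + mx (BL i) (\<psi> i) k"
        using min_resD(8)[OF G chain_space_add[OF ch(2) \<psi>ch[OF k]] g] by blast
      show ?thesis
      proof
        show "glue f' g' k \<in> chain_space (cone_basis BF BG BL (Suc i)) (cone_deg dF dG dL) \<alpha>"
          using chain_space_glueI[of f' BF i dF \<alpha> g' BG dG k BL dL] f' g' k by blast
        show "?D (Suc i) (glue f' g' k) = x" unfolding mxS using f' g' kl by (simp add: xj)
      qed
    qed
    show "\<exists>y\<in>chain_space (cone_basis BF BG BL (Suc i)) (cone_deg dF dG dL) \<alpha>. ?D (Suc i) y = x"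
    proof (cases i)
      case 0
      have fg: "sum f (BF 0) + sum g (BG 0) = 0"
        using z unfolding xj 0 by (simp add: mx0 fun_eq_iff del: cone_basis.simps)
      have "\<exists>k\<in>chain_space (BL 0) dL \<alpha>. sum k (BL 0) = sum f (BF 0)"
      proof (cases "sum f (BF 0) = 0")
        case True
        then show ?thesis using chain_space_zero by (intro bexI[of _ 0]) auto
      next
        case False
        \<comment> \<open>The two sums are opposite, so both are nonzero and generators of both
          ideals divide the multidegree \<alpha>. Then \<alpha> lies in the intersection, and the
          whole sum can be placed on one of its generators.\<close>
        then obtain a b where "a \<in> BF 0" "f a \<noteq> 0" "b \<in> BG 0" "g b \<noteq> 0"
          using fg by (metis add.right_neutral sum.neutral)
        then have "dF a \<le> \<alpha>" "dG b \<le> \<alpha>" "dF a \<in> J" "dG b \<in> K"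
          using ch(1,2) min_resD(2)[OF F] min_resD(2)[OF G] by (auto simp: chain_space_def)
        then have "\<alpha> \<in> J \<inter> K" using up unfolding upset_def by blast
        then obtain c where c: "c \<in> BL 0" "dL c \<le> \<alpha>" using min_resD(7)[OF L] by blast
        then show ?thesis
          using fin(3)[of 0] by (intro bexI[of _ "\<lambda>b. if b = c then sum f (BF 0) else 0"]) (auto simp: chain_space_def)
      qed
      then obtain k where k: "k \<in> chain_space (BL 0) dL \<alpha>" "sum k (BL 0) = sum f (BF 0)" by blast
      have "l = 0" using ch(3) 0 by (simp add: chain_space_def fun_eq_iff)
      moreover have "mx (BF 0) (CF 0) (f - mx (BL 0) (\<phi> 0) k) = 0" "mx (BG 0) (CG 0) (g + mx (BL 0) (\<psi> 0) k) = 0"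
        using k fg by (simp_all add: augs sum_subtractf sum.distrib \<phi>0 \<psi>0 fun_eq_iff add.commute)
      ultimately show ?thesis using solve[of k] k 0 by simp
    next
      case (Suc j)
      have z': "mx (BF i) (CF i) f + mx (BL j) (\<phi> j) l = 0" "mx (BG i) (CG i) g - mx (BL j) (\<psi> j) l = 0"
        "j \<noteq> 0 \<Longrightarrow> mx (BL j) (CL j) l = 0"
        using z unfolding xj Suc mxS by (auto simp: glue_eq_0)
      \<comment> \<open>For \<open>j = 0\<close> the cone differential does not contain the
        augmentation of the intersection. It is recovered by summing the first component of the
        cycle condition: boundaries have sum 0 and \<open>\<phi>\<close> preserves sums.\<close>
      have "mx (BL j) (CL j) l = 0"
      proof (cases j)
        case j: 0
        have "0 = sum (mx (BF i) (CF i) f + mx (BL j) (\<phi> j) l) (BF 0)" by (simp add: z')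
        also have "\<dots> = sum l (BL 0)" by (simp add: sum.distrib Suc j ss \<phi>0)
        finally show ?thesis by (simp add: j augs fun_eq_iff)
      qed (use z' in simp)
      moreover have "l \<in> chain_space (BL j) dL \<alpha>" using ch(3) Suc by simp
      ultimately obtain l' where l': "l' \<in> chain_space (BL (Suc j)) dL \<alpha>" "mx (BL (Suc j)) (CL (Suc j)) l' = l"
        using min_resD(8)[OF L] by blast
      have "mx (BF i) (CF i) (f - mx (BL i) (\<phi> i) (- l')) = mx (BF i) (CF i) f + mx (BL j) (\<phi> j) l"
        "mx (BG i) (CG i) (g + mx (BL i) (\<psi> i) (- l')) = mx (BG i) (CG i) g - mx (BL j) (\<psi> j) l"
        unfolding Suc by (simp_all add: mx_add mx_diff mx_uminus \<phi>(3) \<psi>(3) l')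
      then show ?thesis using solve[of "- l'"] chain_space_uminus[OF l'(1)] l'(2) z' by (simp add: Suc mx_uminus)
    qed
  qed
qed

definition shifted :: "(nat \<Rightarrow> nat) \<Rightarrow> (nat \<Rightarrow> nat) set \<Rightarrow> (nat \<Rightarrow> nat) set"
  where "shifted u M = {\<alpha>. u \<le> \<alpha> \<and> \<alpha> - u \<in> M}"

text \<open>Multiplication by the monomial with exponent \<open>u\<close> is injective and only
  translates degrees, so the scalar matrices stay the same. In multidegrees not above
  \<open>u\<close> all chain spaces are zero.\<close>

lemma min_res_shifted:
  assumes F: "min_res N M B deg C" and u: "{v. u v \<noteq> 0} \<subseteq> {1..N}"
  shows "min_res N (shifted u M) B (\<lambda>b. deg b + u) C"
proof -
  have le: "d + u \<le> \<alpha> \<longleftrightarrow> u \<le> \<alpha> \<and> d \<le> \<alpha> - u" for d \<alpha> :: "nat \<Rightarrow> nat"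
    by (auto simp: le_fun_def) (metis add_leE, metis add_le_imp_le_diff, metis le_diff_conv2)
  have ch: "chain_space A (\<lambda>b. deg b + u) \<alpha> = (if u \<le> \<alpha> then chain_space A deg (\<alpha> - u) else {0})"
    for A \<alpha> by (auto simp: chain_space_def le fun_eq_iff)
  show ?thesis
    unfolding min_res_def
  proof (intro conjI allI ballI impI)
    show "deg b + u \<in> shifted u M" if "b \<in> B i" for i b
      using min_resD(2)[OF F that] by (simp add: shifted_def le_fun_def)
    show "{v. (deg b + u) v \<noteq> 0} \<subseteq> {1..N}" if "b \<in> B i" for i b
      using min_resD(3)[OF F that] u by auto
    show "a \<in> B i" "b \<in> B (Suc i)" "deg a + u < deg b + u" if "C (Suc i) a b \<noteq> 0" for i a b
      using min_resD(5)[OF F that] by auto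
    show "\<exists>b\<in>B 0. deg b + u \<le> \<alpha>" if "\<alpha> \<in> shifted u M" for \<alpha>
      using min_resD(7)[OF F] that by (auto simp: le shifted_def)
    show "\<exists>y\<in>chain_space (B (Suc i)) (\<lambda>b. deg b + u) \<alpha>. mx (B (Suc i)) (C (Suc i)) y = x"
      if "x \<in> chain_space (B i) (\<lambda>b. deg b + u) \<alpha>" "mx (B i) (C i) x = 0" for i \<alpha> x
    proof (cases "u \<le> \<alpha>")
      case True
      then show ?thesis using min_resD(8)[OF F _ that(2), of "\<alpha> - u"] that(1) by (simp add: ch)
    next
      case False
      then show ?thesis using that(1) by (simp add: ch mx_zero)
    qed
  qed (use min_resD(1,4,6)[OF F] in auto)
qed

lemma min_res_empty: "min_res N {} (\<lambda>_. {}) deg (\<lambda>i a b. if i = 0 then 1 else 0)"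
  by (auto simp: min_res_def mx_def fun_eq_iff chain_space_def)

lemma min_res_UNIV: "min_res N UNIV (\<lambda>i. if i = 0 then {a} else {}) (\<lambda>_. 0) (\<lambda>i a b. if i = 0 then 1 else 0)"
  by (auto simp: min_res_def mx_def fun_eq_iff chain_space_def le_fun_def split: if_splits)

text \<open>Only the numbers of generators in each homological and total degree are kept, since the
  recursion concerns nothing else. The argument of type \<open>itself\<close> fixes the coefficient
  field, which the other arguments do not mention.\<close>

definition has_min_res :: "'k::field itself \<Rightarrow> nat \<Rightarrow> (nat \<Rightarrow> nat) set \<Rightarrow> (nat \<Rightarrow> nat \<Rightarrow> nat) \<Rightarrow> bool"
  where "has_min_res T N M \<beta> \<longleftrightarrow> (\<exists>B deg (C :: nat \<Rightarrow> lab \<Rightarrow> lab \<Rightarrow> 'k). min_res N M B deg C \<and>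
    (\<forall>i j. card {b \<in> B i. (\<Sum>v\<in>{1..N}. deg b v) = j} = \<beta> i j))"

lemma has_min_res_empty: "has_min_res T N {} (\<lambda>i j. 0)"
  unfolding has_min_res_def using min_res_empty by (intro exI conjI) (assumption | simp)+

lemma has_min_res_UNIV: "has_min_res T N UNIV (\<lambda>i j. if i = 0 \<and> j = 0 then 1 else 0)"
  unfolding has_min_res_def
  by (rule exI[of _ "\<lambda>i. if i = 0 then {Leaf} else {}"], rule exI[of _ "\<lambda>_. 0"],
      rule exI[of _ "\<lambda>i a b. if i = 0 then 1 else 0"]) (auto simp: min_res_UNIV)

lemma has_min_res_shifted:
  assumes "has_min_res T N M \<beta>" "{v. u v \<noteq> 0} \<subseteq> {1..N}" "(\<Sum>v\<in>{1..N}. u v) = s"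
  shows "has_min_res T N (shifted u M) (\<lambda>i j. if s \<le> j then \<beta> i (j - s) else 0)"
proof -
  obtain B deg and C :: "nat \<Rightarrow> lab \<Rightarrow> lab \<Rightarrow> 'a" where F: "min_res N M B deg C"
    and c: "\<And>i j. card {b \<in> B i. (\<Sum>v\<in>{1..N}. deg b v) = j} = \<beta> i j"
    using assms(1) unfolding has_min_res_def by blast
  have eq: "(\<Sum>v\<in>{1..N}. (deg b + u) v) = (\<Sum>v\<in>{1..N}. deg b v) + s" for b
    using assms(3) by (simp add: sum.distrib)
  have "card {b \<in> B i. (\<Sum>v\<in>{1..N}. (deg b + u) v) = j} = (if s \<le> j then \<beta> i (j - s) else 0)" for i j
  proof (cases "s \<le> j")
    case True
    then have "(\<Sum>v\<in>{1..N}. (deg b + u) v) = j \<longleftrightarrow> (\<Sum>v\<in>{1..N}. deg b v) = j - s" for b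
      unfolding eq by auto
    then show ?thesis using c[of i "j - s"] True by simp
  next
    case False
    then have *: "{b \<in> B i. (\<Sum>v\<in>{1..N}. (deg b + u) v) = j} = {}" unfolding eq by auto
    show ?thesis unfolding * using False by simp
  qed
  then show ?thesis using min_res_shifted[OF F assms(2)] unfolding has_min_res_def by blast
qed

text \<open>A criterion for a Betti splitting; the front variables \<open>p\<close> and
  \<open>q\<close> may be chosen separately for the two summands. The numbers add because the cone
  is again minimal and its basis is a disjoint union, with the generators of the intersection moved
  up by one homological degree.\<close>

lemma has_min_res_Un:
  assumes J: "has_min_res T N J \<beta>\<^sub>1" and K: "has_min_res T N K \<beta>\<^sub>2" and L: "has_min_res T N (J \<inter> K) \<beta>\<^sub>3"
    and up: "upset J" "upset K"
    and pos: "\<And>\<alpha>. \<alpha> \<in> J \<inter> K \<Longrightarrow> \<exists>v. 0 < \<alpha> v"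
    and low: "\<And>\<alpha>. \<alpha> \<in> J \<inter> K \<Longrightarrow> lower p \<alpha> \<in> J" "\<And>\<alpha>. \<alpha> \<in> J \<inter> K \<Longrightarrow> lower q \<alpha> \<in> K"
  shows "has_min_res T N (J \<union> K)
    (\<lambda>i j. \<beta>\<^sub>1 i j + \<beta>\<^sub>2 i j + (case i of 0 \<Rightarrow> 0 | Suc i' \<Rightarrow> \<beta>\<^sub>3 i' j))"
proof -
  obtain BF dF and CF :: "nat \<Rightarrow> lab \<Rightarrow> lab \<Rightarrow> 'a" where F: "min_res N J BF dF CF"
    and cF: "\<And>i j. card {b \<in> BF i. (\<Sum>v\<in>{1..N}. dF b v) = j} = \<beta>\<^sub>1 i j"
    using J unfolding has_min_res_def by blast
  obtain BG dG and CG :: "nat \<Rightarrow> lab \<Rightarrow> lab \<Rightarrow> 'a" where G: "min_res N K BG dG CG"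
    and cG: "\<And>i j. card {b \<in> BG i. (\<Sum>v\<in>{1..N}. dG b v) = j} = \<beta>\<^sub>2 i j"
    using K unfolding has_min_res_def by blast
  obtain BL dL and CL :: "nat \<Rightarrow> lab \<Rightarrow> lab \<Rightarrow> 'a" where L: "min_res N (J \<inter> K) BL dL CL"
    and cL: "\<And>i j. card {b \<in> BL i. (\<Sum>v\<in>{1..N}. dL b v) = j} = \<beta>\<^sub>3 i j"
    using L unfolding has_min_res_def by blast
  obtain \<phi> where \<phi>: "\<And>i a b. \<phi> i a b \<noteq> 0 \<Longrightarrow> a \<in> BF i \<and> b \<in> BL i \<and> dF a < dL b"
      "\<And>x. mx (BF 0) (CF 0) (mx (BL 0) (\<phi> 0) x) = (\<lambda>_. sum x (BL 0))"
      "\<And>i x. mx (BF (Suc i)) (CF (Suc i)) (mx (BL (Suc i)) (\<phi> (Suc i)) x)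
           = mx (BL i) (\<phi> i) (mx (BL (Suc i)) (CL (Suc i)) x)"
    using lift_exists[OF L F, of p] pos low(1) by metis
  obtain \<psi> where \<psi>: "\<And>i a b. \<psi> i a b \<noteq> 0 \<Longrightarrow> a \<in> BG i \<and> b \<in> BL i \<and> dG a < dL b"
      "\<And>x. mx (BG 0) (CG 0) (mx (BL 0) (\<psi> 0) x) = (\<lambda>_. sum x (BL 0))"
      "\<And>i x. mx (BG (Suc i)) (CG (Suc i)) (mx (BL (Suc i)) (\<psi> (Suc i)) x)
           = mx (BL i) (\<psi> i) (mx (BL (Suc i)) (CL (Suc i)) x)"
    using lift_exists[OF L G, of q] pos low(2) by metis
  have R: "min_res N (J \<union> K) (cone_basis BF BG BL) (cone_deg dF dG dL) (cone_mat CF CG CL \<phi> \<psi>)"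
    by (rule min_res_cone[where \<phi> = \<phi> and \<psi> = \<psi>, OF F G L up \<phi> \<psi>])
  have "card {b \<in> cone_basis BF BG BL i. (\<Sum>v\<in>{1..N}. cone_deg dF dG dL b v) = j}
      = \<beta>\<^sub>1 i j + \<beta>\<^sub>2 i j + (case i of 0 \<Rightarrow> 0 | Suc i' \<Rightarrow> \<beta>\<^sub>3 i' j)" for i j
  proof -
    have card: "card {b \<in> A. P b} = (\<Sum>b\<in>A. if P b then 1 else 0)" if "finite A" for A and P :: "lab \<Rightarrow> bool"
      using that by (simp add: sum.If_cases Int_def)
    have fin: "finite (cone_basis BF BG BL i)" by (rule min_resD(1)[OF R])
    note fins = min_resD(1)[OF F] min_resD(1)[OF G] min_resD(1)[OF L]
    show ?thesis
      unfolding card[OF fin] cF[symmetric] cG[symmetric] cL[symmetric]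
      by (cases i) (simp_all add: sum_cone_basis_0 sum_cone_basis_Suc fins card del: cone_basis.simps)
  qed
  then show ?thesis using R unfolding has_min_res_def by blast
qed

section \<open>Comparison of graded free resolutions\<close>

abbreviation lookup :: "('a \<Rightarrow>\<^sub>0 'b::zero) \<Rightarrow> 'a \<Rightarrow> 'b"
  where "lookup \<equiv> Poly_Mapping.lookup"

lemma mon_deg_superset:
  assumes "finite S" "Poly_Mapping.keys e \<subseteq> S"
  shows "mon_deg e = (\<Sum>v\<in>S. lookup e v)"
  unfolding mon_deg_def using assms by (intro sum.mono_neutral_left) (auto simp: in_keys_iff)

lemma mon_deg_add: "mon_deg (a + b) = mon_deg a + mon_deg b"
proof -
  let ?S = "Poly_Mapping.keys a \<union> Poly_Mapping.keys b"
  have "Poly_Mapping.keys (a + b) \<subseteq> ?S" using Poly_Mapping.keys_add[of a b] by auto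
  then show ?thesis
    by (simp add: mon_deg_superset[of ?S] lookup_add sum.distrib)
qed

lemma homogeneous_0: "homogeneous d 0"
  by (simp add: homogeneous_def)

lemma homogeneous_1: "homogeneous 0 1"
  by (simp add: homogeneous_def mon_deg_def)

lemma homogeneous_add: "homogeneous d p \<Longrightarrow> homogeneous d q \<Longrightarrow> homogeneous d (p + q)"
  using Poly_Mapping.keys_add[of p q] unfolding homogeneous_def by blast

lemma homogeneous_uminus: "homogeneous d p \<Longrightarrow> homogeneous d (- p)"
  unfolding homogeneous_def by (simp add: in_keys_iff)

lemma homogeneous_mult: "homogeneous d p \<Longrightarrow> homogeneous d' q \<Longrightarrow> homogeneous (d + d') (p * q)"
  using Poly_Mapping.keys_mult[of p q] unfolding homogeneous_def by (fastforce simp: mon_deg_add)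

lemma homogeneous_sum: "(\<And>x. x \<in> A \<Longrightarrow> homogeneous d (f x)) \<Longrightarrow> homogeneous d (sum f A)"
  by (induction A rule: infinite_finite_induct) (auto simp: homogeneous_0 homogeneous_add)

lemma polys_sum: "(\<And>x. x \<in> A \<Longrightarrow> f x \<in> polys N) \<Longrightarrow> sum f A \<in> polys N"
  by (induction A rule: infinite_finite_induct) (auto simp: polys_closed)

lemma polys_diff: "p \<in> polys N \<Longrightarrow> q \<in> polys N \<Longrightarrow> p - q \<in> polys N"
  using polys_closed(3)[of p N "- q"] polys_closed(5)[of q N] by simp

lemma homogeneous_diff: "homogeneous d p \<Longrightarrow> homogeneous d q \<Longrightarrow> homogeneous d (p - q)"
  using homogeneous_add[of d p "- q"] homogeneous_uminus[of d q] by simp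

section \<open>Homogeneous components and constant coefficients\<close>

definition hcomp :: "int \<Rightarrow> 'k::field mpoly \<Rightarrow> 'k mpoly"
  where "hcomp d p = (\<Sum>e\<in>{e\<in>Poly_Mapping.keys p. int (mon_deg e) = d}. Poly_Mapping.single e (lookup p e))"

lemma lookup_hcomp: "lookup (hcomp d p) e = (if int (mon_deg e) = d then lookup p e else 0)"
  by (auto simp: hcomp_def lookup_sum lookup_single when_def in_keys_iff)

lemma hcomp_add: "hcomp d (p + q) = hcomp d p + hcomp d q"
  by (rule poly_mapping_eqI) (simp add: lookup_hcomp lookup_add)

lemma hcomp_0: "hcomp d 0 = 0"
  by (simp add: hcomp_def)

lemma hcomp_sum: "hcomp d (sum f A) = (\<Sum>x\<in>A. hcomp d (f x))"
  by (induction A rule: infinite_finite_induct) (auto simp: hcomp_0 hcomp_add)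

lemma homogeneous_hcomp: "homogeneous d (hcomp d p)"
  by (auto simp: homogeneous_def in_keys_iff lookup_hcomp split: if_splits)

lemma hcomp_homogeneous: "homogeneous d p \<Longrightarrow> hcomp d' p = (if d = d' then p else 0)"
  by (rule poly_mapping_eqI) (auto simp: lookup_hcomp homogeneous_def in_keys_iff)

lemma hcomp_polys: "p \<in> polys N \<Longrightarrow> hcomp d p \<in> polys N"
  by (auto simp: polys_def in_keys_iff lookup_hcomp split: if_splits)

lemma sum_hcomp:
  obtains D where "finite D" "p = (\<Sum>d\<in>D. hcomp d p)"
proof
  let ?D = "(\<lambda>e. int (mon_deg e)) ` Poly_Mapping.keys p"
  show "finite ?D" by simp
  show "p = (\<Sum>d\<in>?D. hcomp d p)"
    by (rule poly_mapping_eqI) (auto simp: lookup_sum lookup_hcomp in_keys_iff)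
qed

lemma hcomp_mult:
  assumes "homogeneous c q"
  shows "hcomp d (q * p) = q * hcomp (d - c) p"
proof -
  have "\<exists>D. finite D \<and> p = (\<Sum>d\<in>D. hcomp d p)" using sum_hcomp[of p] by metis
  then obtain D where D: "finite D" "p = (\<Sum>d\<in>D. hcomp d p)" by blast
  have "hcomp d (q * p) = (\<Sum>d'\<in>D. hcomp d (q * hcomp d' p))"
    by (subst D(2)) (simp add: sum_distrib_left hcomp_sum)
  also have "\<dots> = (\<Sum>d'\<in>D. q * hcomp (d - c) (hcomp d' p))"
  proof (rule sum.cong)
    fix d'
    show "hcomp d (q * hcomp d' p) = q * hcomp (d - c) (hcomp d' p)"
      using hcomp_homogeneous[OF homogeneous_mult[OF assms homogeneous_hcomp[of d' p]], of d]
        hcomp_homogeneous[OF homogeneous_hcomp[of d' p], of "d - c"] by auto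
  qed simp
  also have "\<dots> = q * hcomp (d - c) p"
    by (subst (2) D(2)) (simp add: sum_distrib_left hcomp_sum)
  finally show ?thesis .
qed

definition const_coeff :: "'k::field mpoly \<Rightarrow> 'k"
  where "const_coeff p = lookup p 0"

lemma const_coeff_simps:
  "const_coeff 0 = 0" "const_coeff 1 = 1" "const_coeff (p + q) = const_coeff p + const_coeff q"
  "const_coeff (- p) = - const_coeff p" "const_coeff (p - q) = const_coeff p - const_coeff q"
  by (simp_all add: const_coeff_def lookup_add lookup_minus lookup_one)

lemma const_coeff_sum: "const_coeff (sum f A) = (\<Sum>x\<in>A. const_coeff (f x))"
  by (simp add: const_coeff_def lookup_sum)

text \<open>A sum of exponent vectors is 0 only if both summands are. So taking constant
  coefficients is the ring homomorphism from S to k, through which matrix identities over S pass to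
  the complex obtained by tensoring with k.\<close>

lemma const_coeff_mult: "const_coeff (p * q) = const_coeff p * const_coeff q"
proof -
  have z: "0 = a + b \<longleftrightarrow> a = 0 \<and> b = 0" for a b :: "nat \<Rightarrow>\<^sub>0 nat"
    by (auto simp: poly_mapping_eq_iff fun_eq_iff lookup_add)
  have "(lookup q b when 0 = a + b) = (lookup q 0 when a = 0 when b = 0)" for a b
    by (auto simp: z when_def)
  then have "prod_fun (lookup p) (lookup q) 0
      = (\<Sum>a. lookup p a * (lookup q 0 when a = 0))"
    by (simp add: prod_fun_def)
  also have "(\<lambda>a. lookup p a * (lookup q 0 when a = 0))
      = (\<lambda>a. lookup p 0 * lookup q 0 when a = 0)"
    by (rule ext) (simp add: when_def)
  also have "(\<Sum>a. lookup p 0 * lookup q 0 when a = (0 :: nat \<Rightarrow>\<^sub>0 nat))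
      = lookup p 0 * lookup q 0"
    by simp
  finally show ?thesis by (simp only: const_coeff_def lookup_mult prod_fun_def)
qed

lemma const_coeff_homogeneous: "homogeneous d p \<Longrightarrow> const_coeff p \<noteq> 0 \<Longrightarrow> d = 0"
  using in_keys_iff[of 0 p] by (auto simp: homogeneous_def const_coeff_def mon_deg_def)

text \<open>The module \<open>S\<close> itself is put in position \<open>0\<close>, so that the augmentation becomes the first
  differential.\<close>

definition ext_rank :: "'r free_complex \<Rightarrow> nat \<Rightarrow> nat"
  where "ext_rank F i = (case i of 0 \<Rightarrow> 1 | Suc i' \<Rightarrow> rnk F i')"

definition ext_shift :: "'r free_complex \<Rightarrow> nat \<Rightarrow> nat \<Rightarrow> int"
  where "ext_shift F i a = (case i of 0 \<Rightarrow> 0 | Suc i' \<Rightarrow> shift F i' a)"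

definition ext_mat :: "'r free_complex \<Rightarrow> nat \<Rightarrow> nat \<Rightarrow> nat \<Rightarrow> 'r"
  where "ext_mat F i a b = (case i of 0 \<Rightarrow> aug F b | Suc i' \<Rightarrow> dmat F i' a b)"

definition hvec :: "nat \<Rightarrow> 'k::field mpoly free_complex \<Rightarrow> nat \<Rightarrow> int \<Rightarrow> (nat \<Rightarrow> 'k mpoly) \<Rightarrow> bool"
  where "hvec N F i D v \<longleftrightarrow> (\<forall>a<ext_rank F i. v a \<in> polys N \<and> homogeneous (D - ext_shift F i a) (v a))"

definition mm :: "nat \<Rightarrow> (nat \<Rightarrow> nat \<Rightarrow> 'r::semiring_0) \<Rightarrow> (nat \<Rightarrow> nat \<Rightarrow> 'r) \<Rightarrow> nat \<Rightarrow> nat \<Rightarrow> 'r"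
  where "mm n A B a b = (\<Sum>c<n. A a c * B c b)"

lemma mm_assoc: "mm n (mm n' A B) C = mm n' A (mm n B C)"
  by (simp add: mm_def fun_eq_iff sum_distrib_left sum_distrib_right mult.assoc) (subst sum.swap, simp)

lemma mm_cong: "(\<And>c. c < n \<Longrightarrow> A a c = A' a c) \<Longrightarrow> (\<And>c. c < n \<Longrightarrow> B c b = B' c b) \<Longrightarrow> mm n A B a b = mm n A' B' a b"
  by (simp add: mm_def)

lemma hvec_mm:
  assumes A: "\<And>a c. a < ext_rank G i \<Longrightarrow> c < n \<Longrightarrow> A a c \<in> polys N \<and> homogeneous (d c - ext_shift G i a) (A a c)"
    and v: "\<And>c. c < n \<Longrightarrow> B c b \<in> polys N \<and> homogeneous (D - d c) (B c b)"
  shows "hvec N G i D (\<lambda>a. mm n A B a b)"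
  unfolding hvec_def mm_def
proof (intro allI impI conjI)
  fix a assume a: "a < ext_rank G i"
  show "(\<Sum>c<n. A a c * B c b) \<in> polys N" using A[OF a] v by (intro polys_sum polys_closed) auto
  have "homogeneous (D - ext_shift G i a) (A a c * B c b)" if "c < n" for c
    using homogeneous_mult[of "d c - ext_shift G i a" "A a c" "D - d c" "B c b"] A[OF a that] v[OF that] by simp
  then show "homogeneous (D - ext_shift G i a) (\<Sum>c<n. A a c * B c b)" by (intro homogeneous_sum) auto
qed

lemma ext_mat_graded:
  assumes "graded_free_resolution N M F" "a < ext_rank F i" "b < ext_rank F (Suc i)"
  shows "ext_mat F i a b \<in> polys N" "homogeneous (ext_shift F (Suc i) b - ext_shift F i a) (ext_mat F i a b)"
  using assms unfolding graded_free_resolution_def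
  by (cases i; simp add: ext_mat_def ext_shift_def ext_rank_def)+

lemma aug_in_module:
  assumes F: "graded_free_resolution N M F" and b: "b < rnk F 0"
  shows "aug F b \<in> M"
proof -
  let ?v = "\<lambda>c. if c = b then 1 else 0"
  have "?v \<in> free_mod N (rnk F 0)" using b by (auto simp: free_mod_def polys_closed)
  moreover have "aug_map F ?v = aug F b" using b by (simp add: aug_map_def if_distrib[of "\<lambda>z. z * _"] cong: if_cong)
  moreover have "aug_map F ` free_mod N (rnk F 0) = M" using F by (simp add: graded_free_resolution_def)
  ultimately show ?thesis by (metis imageI)
qed

lemma ext_mat_complex:
  assumes F: "graded_free_resolution N M F" and a: "a < ext_rank F i" and b: "b < ext_rank F (Suc (Suc i))"
  shows "mm (ext_rank F (Suc i)) (ext_mat F i) (ext_mat F (Suc i)) a b = 0"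
proof -
  let ?v = "\<lambda>c. if c = b then 1 else 0"
  have v: "?v \<in> free_mod N (rnk F (Suc i))" using b by (auto simp: free_mod_def polys_closed ext_rank_def)
  have e: "cdiff F i ?v = (\<lambda>a. if a < rnk F i then dmat F i a b else 0)"
    using b by (auto simp: cdiff_def mat_app_def ext_rank_def if_distrib[of "\<lambda>z. _ * z"] fun_eq_iff cong: if_cong)
  show ?thesis
  proof (cases i)
    case 0
    have "aug_map F (cdiff F 0 ?v) = 0" using F v unfolding graded_free_resolution_def 0 by auto
    then show ?thesis using e by (simp add: 0 aug_map_def mm_def ext_rank_def ext_mat_def mult.commute)
  next
    case (Suc j)
    have "cdiff F j (cdiff F i ?v) = 0" using F v unfolding graded_free_resolution_def Suc by blast
    then have "cdiff F j (cdiff F i ?v) a = 0" by simp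
    then show ?thesis using e a
      by (simp add: Suc cdiff_def[of F j] mat_app_def mm_def ext_rank_def ext_mat_def)
  qed
qed

text \<open>The matrix entries are homogeneous of matching degrees, so replacing each coordinate of
  any solution by its component of the required degree leaves the equations valid. This makes the
  lifts in the comparison homogeneous.\<close>

lemma homogeneous_preimage:
  assumes F: "graded_free_resolution N M F" and w: "\<And>b. b < ext_rank F (Suc i) \<Longrightarrow> w b \<in> polys N"
    and v: "\<And>a. a < ext_rank F i \<Longrightarrow> homogeneous (D - ext_shift F i a) (v a)"
      "\<And>a. a < ext_rank F i \<Longrightarrow> (\<Sum>b<ext_rank F (Suc i). ext_mat F i a b * w b) = v a"
  shows "\<exists>w. hvec N F (Suc i) D w \<and> (\<forall>a<ext_rank F i. (\<Sum>b<ext_rank F (Suc i). ext_mat F i a b * w b) = v a)"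
proof (intro exI conjI allI impI)
  let ?w = "\<lambda>b. hcomp (D - ext_shift F (Suc i) b) (w b)"
  show "hvec N F (Suc i) D ?w"
    using w by (simp add: hvec_def hcomp_polys homogeneous_hcomp)
  fix a assume a: "a < ext_rank F i"
  have "v a = hcomp (D - ext_shift F i a) (\<Sum>b<ext_rank F (Suc i). ext_mat F i a b * w b)"
    using v[OF a] by (simp add: hcomp_homogeneous)
  also have "\<dots> = (\<Sum>b<ext_rank F (Suc i). ext_mat F i a b * ?w b)"
    unfolding hcomp_sum
    by (intro sum.cong refl) (simp add: hcomp_mult[OF ext_mat_graded(2)[OF F a]])
  finally show "(\<Sum>b<ext_rank F (Suc i). ext_mat F i a b * ?w b) = v a" by simp
qed

lemma ext_exact:
  assumes F: "graded_free_resolution N M F" and v: "hvec N F (Suc i) D v"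
    and z: "\<And>a. a < ext_rank F i \<Longrightarrow> (\<Sum>b<ext_rank F (Suc i). ext_mat F i a b * v b) = 0"
  shows "\<exists>w. hvec N F (Suc (Suc i)) D w \<and>
    (\<forall>a<ext_rank F (Suc i). (\<Sum>b<ext_rank F (Suc (Suc i)). ext_mat F (Suc i) a b * w b) = v a)"
proof -
  let ?v = "\<lambda>a. if a < rnk F i then v a else 0"
  have vm: "?v \<in> free_mod N (rnk F i)" using v by (auto simp: free_mod_def hvec_def ext_rank_def)
  have "\<exists>w\<in>free_mod N (rnk F (Suc i)). cdiff F i w = ?v"
  proof (cases i)
    case 0
    have "aug_map F ?v = 0" using z[of 0] by (simp add: aug_map_def 0 ext_rank_def ext_mat_def mult.commute)
    then have "?v \<in> cdiff F 0 ` free_mod N (rnk F 1)"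
      using F vm unfolding graded_free_resolution_def 0 by blast
    then show ?thesis unfolding 0 by (elim imageE) auto
  next
    case (Suc j)
    have "cdiff F j ?v = 0"
      using z by (simp add: cdiff_def mat_app_def fun_eq_iff Suc ext_rank_def ext_mat_def)
    then have "?v \<in> cdiff F (Suc j) ` free_mod N (rnk F (Suc (Suc j)))"
      using F vm unfolding graded_free_resolution_def Suc by blast
    then show ?thesis unfolding Suc by (elim imageE) auto
  qed
  then obtain w where w: "w \<in> free_mod N (rnk F (Suc i))" "cdiff F i w = ?v" by blast
  show ?thesis
  proof (rule homogeneous_preimage[OF F])
    show "w b \<in> polys N" if "b < ext_rank F (Suc (Suc i))" for b
      using that w by (simp add: free_mod_def ext_rank_def)
    show "homogeneous (D - ext_shift F (Suc i) a) (v a)" if "a < ext_rank F (Suc i)" for a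
      using v that by (simp add: hvec_def)
    show "(\<Sum>b<ext_rank F (Suc (Suc i)). ext_mat F (Suc i) a b * w b) = v a" if "a < ext_rank F (Suc i)" for a
      using fun_cong[OF w(2), of a] that by (simp add: cdiff_def mat_app_def ext_rank_def ext_mat_def)
  qed
qed

lemma ext_image:
  assumes F: "graded_free_resolution N M F" and "p \<in> M" "homogeneous D p"
  shows "\<exists>w. hvec N F 1 D w \<and> (\<Sum>b<ext_rank F 1. ext_mat F 0 0 b * w b) = p"
proof -
  have "p \<in> aug_map F ` free_mod N (rnk F 0)" using assms by (simp add: graded_free_resolution_def)
  then obtain w where w: "w \<in> free_mod N (rnk F 0)" "aug_map F w = p" by blast
  have "\<exists>w. hvec N F (Suc 0) D w \<and> (\<forall>a<ext_rank F 0. (\<Sum>b<ext_rank F (Suc 0). ext_mat F 0 a b * w b) = p)"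
  proof (rule homogeneous_preimage[OF F])
    show "w b \<in> polys N" if "b < ext_rank F (Suc 0)" for b
      using that w by (simp add: free_mod_def ext_rank_def)
    show "homogeneous (D - ext_shift F 0 a) p" if "a < ext_rank F 0" for a
      using assms by (simp add: ext_shift_def)
    show "(\<Sum>b<ext_rank F (Suc 0). ext_mat F 0 a b * w b) = p" if "a < ext_rank F 0" for a
      using w by (simp add: aug_map_def ext_rank_def ext_mat_def mult.commute)
  qed
  then show ?thesis by (auto simp: ext_rank_def)
qed

text \<open>The function \<open>r\<close> gives the target position, so that chain maps
  (\<open>\<lambda>i. i\<close>) and homotopies (\<open>Suc\<close>) fall under one notion.\<close>

definition graded_map :: "nat \<Rightarrow> 'k::field mpoly free_complex \<Rightarrow> 'k mpoly free_complex \<Rightarrow> (nat \<Rightarrow> nat) \<Rightarrow>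
    (nat \<Rightarrow> nat \<Rightarrow> nat \<Rightarrow> 'k mpoly) \<Rightarrow> bool"
  where "graded_map N F G r \<phi> \<longleftrightarrow> (\<forall>i. \<forall>b<ext_rank F i. hvec N G (r i) (ext_shift F i b) (\<lambda>a. \<phi> i a b))"

definition chain_map :: "'k::field mpoly free_complex \<Rightarrow> 'k mpoly free_complex \<Rightarrow> (nat \<Rightarrow> nat \<Rightarrow> nat \<Rightarrow> 'k mpoly) \<Rightarrow> bool"
  where "chain_map F G \<phi> \<longleftrightarrow> (\<forall>i. \<forall>a<ext_rank G i. \<forall>b<ext_rank F (Suc i).
    mm (ext_rank G (Suc i)) (ext_mat G i) (\<phi> (Suc i)) a b = mm (ext_rank F i) (\<phi> i) (ext_mat F i) a b)"

lemma choose_columns: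
  assumes "\<And>b. b < n \<Longrightarrow> \<exists>w. P b w"
  shows "\<exists>f. \<forall>b<n. P b (\<lambda>a. f a b)"
proof -
  have "\<exists>g. \<forall>b<n. P b (g b)" using assms by (intro choice) blast
  then obtain g where "\<forall>b<n. P b (g b)" by blast
  then show ?thesis by (intro exI[of _ "\<lambda>a b. g b a"]) simp
qed

text \<open>In position 0 both complexes are S itself, and the map is normalised to be 1 there. It
  therefore lifts the identity of \<open>M\<close>, and a composite of two such maps agrees with the
  identity in position 0.\<close>

lemma comparison_map:
  assumes F: "graded_free_resolution N M F" and G: "graded_free_resolution N M G"
  obtains \<phi> where "graded_map N F G (\<lambda>i. i) \<phi>" "chain_map F G \<phi>" "\<phi> 0 0 0 = 1"
proof -
  \<comment> \<open>By the last clause, \<open>f\<close> composed with the next differential of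
    \<open>F\<close> is killed by the differential of \<open>G\<close>, so its columns are cycles
    that can be lifted.\<close>
  define P where "P i f \<longleftrightarrow> (\<forall>b<ext_rank F i. hvec N G i (ext_shift F i b) (\<lambda>a. f a b)) \<and>
      (i = 0 \<longrightarrow> f 0 0 = 1) \<and>
      (\<forall>j. i = Suc j \<longrightarrow> (\<forall>a<ext_rank G j. \<forall>b<ext_rank F (Suc i).
        mm (ext_rank G i) (ext_mat G j) (mm (ext_rank F i) f (ext_mat F i)) a b = 0))"
    for i and f :: "nat \<Rightarrow> nat \<Rightarrow> 'a mpoly"
  define Q where "Q i f g \<longleftrightarrow> (\<forall>a<ext_rank G i. \<forall>b<ext_rank F (Suc i).
    mm (ext_rank G (Suc i)) (ext_mat G i) g a b = mm (ext_rank F i) f (ext_mat F i) a b)"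
    for i and f g :: "nat \<Rightarrow> nat \<Rightarrow> 'a mpoly"
  have base: "P 0 (\<lambda>a b. 1)"
    by (simp add: P_def hvec_def ext_rank_def ext_shift_def polys_closed homogeneous_1)
  have step: "\<exists>g. P (Suc i) g \<and> Q i f g" if P: "P i f" for f i
  proof -
    define R where "R b w \<longleftrightarrow> hvec N G (Suc i) (ext_shift F (Suc i) b) w \<and>
      (\<forall>a<ext_rank G i. (\<Sum>c<ext_rank G (Suc i). ext_mat G i a c * w c) = mm (ext_rank F i) f (ext_mat F i) a b)"
      for b w
    have "\<exists>w. R b w" if b: "b < ext_rank F (Suc i)" for b
    proof (cases i)
      case 0
      have "aug F b \<in> M" "homogeneous (ext_shift F (Suc 0) b) (aug F b)"
        using aug_in_module[OF F, of b] ext_mat_graded(2)[OF F, of 0 0 b] b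
        by (simp_all add: 0 ext_rank_def ext_shift_def ext_mat_def)
      then show ?thesis
        using ext_image[OF G, of "aug F b" "ext_shift F (Suc 0) b"] P
        by (auto simp: R_def 0 P_def mm_def ext_rank_def[of _ 0] ext_mat_def[of F 0])
    next
      case (Suc j)
      show ?thesis
        unfolding R_def Suc
      proof (rule ext_exact[OF G])
        show "hvec N G (Suc j) (ext_shift F (Suc (Suc j)) b) (\<lambda>a. mm (ext_rank F (Suc j)) f (ext_mat F (Suc j)) a b)"
          using P ext_mat_graded[OF F _ b] unfolding Suc
          by (intro hvec_mm[where d = "ext_shift F (Suc j)"]) (auto simp: P_def hvec_def)
        show "(\<Sum>c<ext_rank G (Suc j). ext_mat G j a c * mm (ext_rank F (Suc j)) f (ext_mat F (Suc j)) c b) = 0"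
          if "a < ext_rank G j" for a
          using P b that unfolding Suc P_def mm_def by simp
      qed
    qed
    then obtain g where "\<forall>b<ext_rank F (Suc i). R b (\<lambda>a. g a b)"
      using choose_columns[of "ext_rank F (Suc i)" R] by blast
    note g = this[unfolded R_def]
    have Q: "Q i f g" using g by (simp add: Q_def mm_def)
    have "mm (ext_rank G (Suc i)) (ext_mat G i) (mm (ext_rank F (Suc i)) g (ext_mat F (Suc i))) a b = 0"
      if "a < ext_rank G i" "b < ext_rank F (Suc (Suc i))" for a b
    proof -
      have "mm (ext_rank G (Suc i)) (ext_mat G i) (mm (ext_rank F (Suc i)) g (ext_mat F (Suc i))) a b
        = mm (ext_rank F (Suc i)) (mm (ext_rank F i) f (ext_mat F i)) (ext_mat F (Suc i)) a b"
        unfolding mm_assoc[symmetric] using Q that by (intro mm_cong) (auto simp: Q_def)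
      also have "\<dots> = mm (ext_rank F i) f (\<lambda>a b. 0) a b"
        unfolding mm_assoc using ext_mat_complex[OF F _ that(2)] by (intro mm_cong) auto
      finally show ?thesis by (simp add: mm_def)
    qed
    then have "P (Suc i) g" using g by (simp add: P_def)
    then show ?thesis using Q by blast
  qed
  have "\<exists>\<phi>. \<forall>i. P i (\<phi> i) \<and> Q i (\<phi> i) (\<phi> (Suc i))"
    using dependent_nat_choice[of P Q] base step by blast
  then obtain \<phi> where \<phi>: "\<And>i. P i (\<phi> i)" "\<And>i. Q i (\<phi> i) (\<phi> (Suc i))" by blast
  show ?thesis
  proof (rule that[of \<phi>])
    show "graded_map N F G (\<lambda>i. i) \<phi>" using \<phi>(1) by (simp add: graded_map_def P_def)
    show "chain_map F G \<phi>" using \<phi>(2) by (simp add: chain_map_def Q_def)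
    show "\<phi> 0 0 0 = 1" using \<phi>(1)[of 0] by (simp add: P_def)
  qed
qed

text \<open>Applied to the difference of a composite comparison map and the identity. As
  \<open>h\<close> vanishes in position 0, the homotopy can start with 0 there; each further column
  comes from exactness, since \<open>h (Suc i)\<close> minus the composite of \<open>s i\<close>
  with the differential consists of cycles.\<close>

lemma null_homotopy:
  assumes F: "graded_free_resolution N M F" and h: "graded_map N F F (\<lambda>i. i) h" "chain_map F F h" "h 0 0 0 = 0"
  obtains s where "graded_map N F F Suc s" "\<And>a b. s 0 a b = 0"
    "\<And>i a b. a < ext_rank F (Suc i) \<Longrightarrow> b < ext_rank F (Suc i) \<Longrightarrow>
      h (Suc i) a b = mm (ext_rank F (Suc (Suc i))) (ext_mat F (Suc i)) (s (Suc i)) a b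
        + mm (ext_rank F i) (s i) (ext_mat F i) a b"
proof -
  \<comment> \<open>With d for the differential, the last clause reads h d = d s d, which says that
    the columns to be lifted next are cycles.\<close>
  define P where "P i f \<longleftrightarrow> (\<forall>b<ext_rank F i. hvec N F (Suc i) (ext_shift F i b) (\<lambda>a. f a b)) \<and>
      (i = 0 \<longrightarrow> f = (\<lambda>a b. 0)) \<and>
      (\<forall>a<ext_rank F i. \<forall>b<ext_rank F (Suc i).
        mm (ext_rank F i) (h i) (ext_mat F i) a b
        = mm (ext_rank F (Suc i)) (ext_mat F i) (mm (ext_rank F i) f (ext_mat F i)) a b)"
    for i and f :: "nat \<Rightarrow> nat \<Rightarrow> 'a mpoly"
  define Q where "Q i f g \<longleftrightarrow> (\<forall>a<ext_rank F (Suc i). \<forall>b<ext_rank F (Suc i).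
      h (Suc i) a b = mm (ext_rank F (Suc (Suc i))) (ext_mat F (Suc i)) g a b
        + mm (ext_rank F i) f (ext_mat F i) a b)"
    for i and f g :: "nat \<Rightarrow> nat \<Rightarrow> 'a mpoly"
  have base: "P 0 (\<lambda>a b. 0)"
    using h(3) by (simp add: P_def hvec_def polys_closed homogeneous_0 mm_def ext_rank_def)
  have step: "\<exists>g. P (Suc i) g \<and> Q i f g" if P: "P i f" for f i
  proof -
    define z where "z a b = h (Suc i) a b - mm (ext_rank F i) f (ext_mat F i) a b" for a b
    define R where "R b w \<longleftrightarrow> hvec N F (Suc (Suc i)) (ext_shift F (Suc i) b) w \<and>
      (\<forall>a<ext_rank F (Suc i). (\<Sum>c<ext_rank F (Suc (Suc i)). ext_mat F (Suc i) a c * w c) = z a b)"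
      for b w
    have "\<exists>w. R b w" if b: "b < ext_rank F (Suc i)" for b
      unfolding R_def
    proof (rule ext_exact[OF F])
      have "hvec N F (Suc i) (ext_shift F (Suc i) b) (\<lambda>a. mm (ext_rank F i) f (ext_mat F i) a b)"
        using P ext_mat_graded[OF F _ b]
        by (intro hvec_mm[where d = "ext_shift F i"]) (auto simp: P_def hvec_def)
      then show "hvec N F (Suc i) (ext_shift F (Suc i) b) (\<lambda>a. z a b)"
        using h(1) b by (simp add: z_def hvec_def graded_map_def polys_diff homogeneous_diff)
      fix a assume a: "a < ext_rank F i"
      have "mm (ext_rank F (Suc i)) (ext_mat F i) (h (Suc i)) a b
        = mm (ext_rank F (Suc i)) (ext_mat F i) (mm (ext_rank F i) f (ext_mat F i)) a b"
        using h(2) P a b by (simp add: chain_map_def P_def)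
      then show "(\<Sum>c<ext_rank F (Suc i). ext_mat F i a c * z c b) = 0"
        by (simp add: z_def mm_def algebra_simps sum_subtractf)
    qed
    then obtain g where "\<forall>b<ext_rank F (Suc i). R b (\<lambda>a. g a b)"
      using choose_columns[of "ext_rank F (Suc i)" R] by blast
    note g = this[unfolded R_def]
    have Q: "Q i f g" using g by (simp add: Q_def mm_def z_def)
    have "mm (ext_rank F (Suc i)) (h (Suc i)) (ext_mat F (Suc i)) a b
        = mm (ext_rank F (Suc (Suc i))) (ext_mat F (Suc i)) (mm (ext_rank F (Suc i)) g (ext_mat F (Suc i))) a b"
      if ab: "a < ext_rank F (Suc i)" "b < ext_rank F (Suc (Suc i))" for a b
    proof -
      have 0: "mm (ext_rank F (Suc i)) (mm (ext_rank F i) f (ext_mat F i)) (ext_mat F (Suc i)) a b = 0"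
      proof -
        have "mm (ext_rank F (Suc i)) (mm (ext_rank F i) f (ext_mat F i)) (ext_mat F (Suc i)) a b
          = mm (ext_rank F i) f (\<lambda>a b. 0) a b"
          unfolding mm_assoc using ext_mat_complex[OF F _ ab(2)] by (intro mm_cong) auto
        then show ?thesis by (simp add: mm_def)
      qed
      have "mm (ext_rank F (Suc i)) (h (Suc i)) (ext_mat F (Suc i)) a b
        = mm (ext_rank F (Suc i)) (\<lambda>a b. mm (ext_rank F (Suc (Suc i))) (ext_mat F (Suc i)) g a b
          + mm (ext_rank F i) f (ext_mat F i) a b) (ext_mat F (Suc i)) a b"
        using Q ab by (intro mm_cong) (auto simp: Q_def)
      also have "\<dots> = mm (ext_rank F (Suc i)) (mm (ext_rank F (Suc (Suc i))) (ext_mat F (Suc i)) g) (ext_mat F (Suc i)) a b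
          + mm (ext_rank F (Suc i)) (mm (ext_rank F i) f (ext_mat F i)) (ext_mat F (Suc i)) a b"
        by (simp add: mm_def[of "ext_rank F (Suc i)"] algebra_simps sum.distrib)
      finally show ?thesis unfolding 0 by (simp add: mm_assoc)
    qed
    then have "P (Suc i) g" using g by (simp add: P_def)
    then show ?thesis using Q by blast
  qed
  have "\<exists>\<phi>. \<forall>i. P i (\<phi> i) \<and> Q i (\<phi> i) (\<phi> (Suc i))"
    using dependent_nat_choice[of P Q] base step by blast
  then obtain s where s: "\<And>i. P i (s i)" "\<And>i. Q i (s i) (s (Suc i))" by blast
  show ?thesis
  proof (rule that[of s])
    show "graded_map N F F Suc s" using s(1) by (simp add: graded_map_def P_def)
    show "s 0 a b = 0" for a b using s(1)[of 0] by (simp add: P_def)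
    show "h (Suc i) a b = mm (ext_rank F (Suc (Suc i))) (ext_mat F (Suc i)) (s (Suc i)) a b
        + mm (ext_rank F i) (s i) (ext_mat F i) a b"
      if "a < ext_rank F (Suc i)" "b < ext_rank F (Suc i)" for i a b
      using s(2)[of i] that by (simp add: Q_def)
  qed
qed

section \<open>Independence of the resolution\<close>

context vector_space
begin

text \<open>The spans of \<open>S\<close> and \<open>S'\<close> play the role of the subspaces
  divided out, and \<open>inj\<close> is injectivity of the induced map on quotients. Elements
  \<open>z\<close> of \<open>T\<close> are added one at a time: a relation f z = f u + w with
  \<open>u\<close> in the span of \<open>T\<close> and \<open>w\<close> in the span of
  \<open>S'\<close> would put z - u into the span of \<open>S\<close>, against independence.\<close>

lemma independent_image_Un:
  assumes f: "\<And>x y. f (x + y) = f x + f y" "\<And>c x. f (scale c x) = scale c (f x)"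
    and T: "finite T" "independent (T \<union> S)" "T \<inter> S = {}" and S: "independent S'"
    and inj: "\<And>z. z \<in> span (T \<union> S) \<Longrightarrow> f z \<in> span S' \<Longrightarrow> z \<in> span S"
  shows "independent (f ` T \<union> S') \<and> inj_on f T \<and> f ` T \<inter> S' = {}"
  using T inj
proof (induction T rule: finite_induct)
  case empty
  then show ?case using S by simp
next
  case (insert z T)
  have indep: "independent (T \<union> S)" using independent_mono[OF insert.prems(1)] by blast
  have IH: "independent (f ` T \<union> S') \<and> inj_on f T \<and> f ` T \<inter> S' = {}"
  proof (rule insert.IH)
    show "z' \<in> span S" if "z' \<in> span (T \<union> S)" "f z' \<in> span S'" for z'
      using insert.prems(3)[OF _ that(2)] that(1) span_mono[of "T \<union> S" "insert z T \<union> S"] by blast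
  qed (use indep insert.prems in auto)
  have z: "z \<notin> span (T \<union> S)"
    using insert.prems(1,2) insert.hyps by (auto simp: independent_insert)
  have f0: "f 0 = 0" using f(2)[of 0 0] by simp
  have fd: "f (x - y) = f x - f y" for x y
    using f(1)[of "x - y" y] by (simp add: algebra_simps)
  have fz: "f z \<notin> span (f ` T \<union> S')"
  proof
    assume fz: "f z \<in> span (f ` T \<union> S')"
    let ?X = "{f u + w |u w. u \<in> span T \<and> w \<in> span S'}"
    have "span (f ` T \<union> S') \<subseteq> ?X"
    proof (rule span_minimal)
      show "f ` T \<union> S' \<subseteq> ?X"
      proof
        fix x assume "x \<in> f ` T \<union> S'"
        then consider u where "u \<in> T" "x = f u" | "x \<in> S'" by blast
        then show "x \<in> ?X"
        proof cases
          case 1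
          then have "x = f u + 0" "u \<in> span T" "0 \<in> span S'" by (auto simp: span_base span_zero)
          then show ?thesis by blast
        next
          case 2
          then have "x = f 0 + x" "0 \<in> span T" "x \<in> span S'" by (auto simp: span_base span_zero f0)
          then show ?thesis by blast
        qed
      qed
      show "subspace ?X"
      proof (rule subspaceI)
        have "0 = f 0 + 0" by (simp add: f0)
        then show "0 \<in> ?X" using span_zero by blast
        show "x + y \<in> ?X" if xy: "x \<in> ?X" "y \<in> ?X" for x y
        proof -
          obtain u w u' w' where "x = f u + w" "u \<in> span T" "w \<in> span S'" "y = f u' + w'" "u' \<in> span T" "w' \<in> span S'"
            using xy by blast
          then have "x + y = f (u + u') + (w + w')" "u + u' \<in> span T" "w + w' \<in> span S'"
            by (auto simp: f span_add algebra_simps)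
          then show ?thesis by blast
        qed
        show "scale c x \<in> ?X" if xX: "x \<in> ?X" for c x
        proof -
          obtain u w where "x = f u + w" "u \<in> span T" "w \<in> span S'" using xX by blast
          then have "scale c x = f (scale c u) + scale c w" "scale c u \<in> span T" "scale c w \<in> span S'"
            by (auto simp: f span_scale scale_right_distrib)
          then show ?thesis by blast
        qed
      qed
    qed
    then obtain u w where uw: "f z = f u + w" "u \<in> span T" "w \<in> span S'" using fz by blast
    then have "f (z - u) \<in> span S'" by (simp add: fd)
    moreover have "z - u \<in> span (insert z T \<union> S)"
    proof (rule span_diff)
      show "z \<in> span (insert z T \<union> S)" by (simp add: span_base)
      show "u \<in> span (insert z T \<union> S)" using uw(2) span_mono[of T "insert z T \<union> S"] by blast
    qed
    ultimately have "z - u \<in> span S" using insert.prems(3) by blast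
    then have "(z - u) + u \<in> span (T \<union> S)"
      using uw(2) span_mono[of T "T \<union> S"] span_mono[of S "T \<union> S"] by (intro span_add) auto
    then show False using z by simp
  qed
  then have "f z \<notin> f ` T \<union> S'" using span_base[of "f z" "f ` T \<union> S'"] by blast
  moreover have "independent (insert (f z) (f ` T \<union> S'))"
    using IH fz by (simp add: independent_insert)
  ultimately show ?case using IH insert.hyps by auto
qed

text \<open>An injection of Z/B into Z'/B', expressed by bases because \<open>tor_dim\<close> is a
  difference of dimensions: the part of a basis of \<open>Z\<close> outside a basis of
  \<open>B\<close> is mapped to vectors that stay independent together with a basis of
  \<open>B'\<close>.\<close>

lemma dim_quotient_le:
  assumes sub: "subspace Z" "subspace B" "B \<subseteq> Z" "subspace Z'" "subspace B'" "B' \<subseteq> Z'"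
    and fin: "finite A" "Z \<subseteq> span A" "finite A'" "Z' \<subseteq> span A'"
    and f: "\<And>x y. f (x + y) = f x + f y" "\<And>c x. f (scale c x) = scale c (f x)"
    and ZZ: "\<And>z. z \<in> Z \<Longrightarrow> f z \<in> Z'" and inj: "\<And>z. z \<in> Z \<Longrightarrow> f z \<in> B' \<Longrightarrow> z \<in> B"
  shows "dim Z - dim B \<le> dim Z' - dim B'"
proof -
  obtain S where S: "S \<subseteq> B" "independent S" "B \<subseteq> span S" "card S = dim B"
    using basis_exists[of B] by blast
  obtain R where R: "S \<subseteq> R" "R \<subseteq> Z" "independent R" "Z \<subseteq> span R"
    using maximal_independent_subset_extend[of S Z] S sub(3) by blast
  obtain S' where S': "S' \<subseteq> B'" "independent S'" "B' \<subseteq> span S'" "card S' = dim B'"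
    using basis_exists[of B'] by blast
  obtain R' where R': "S' \<subseteq> R'" "R' \<subseteq> Z'" "independent R'" "Z' \<subseteq> span R'"
    using maximal_independent_subset_extend[of S' Z'] S' sub(6) by blast
  have finR: "finite R" using independent_span_bound[of A R] fin R by blast
  have finR': "finite R'" using independent_span_bound[of A' R'] fin R' by blast
  have dZ: "dim Z = card R" using dim_unique[OF R(2,4,3)] by blast
  have dZ': "dim Z' = card R'" using dim_unique[OF R'(2,4,3)] by blast
  have spS: "span S = B" using S span_minimal[OF S(1) sub(2)] by blast
  have spS': "span S' = B'" using S' span_minimal[OF S'(1) sub(5)] by blast
  have spR: "span R = Z" using R span_minimal[OF R(2) sub(1)] by blast
  have spR': "span R' = Z'" using R' span_minimal[OF R'(2) sub(4)] by blast
  have RS: "R \<union> S = R" using R by blast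
  have *: "independent (f ` (R - S) \<union> S') \<and> inj_on f (R - S) \<and> f ` (R - S) \<inter> S' = {}"
    by (rule independent_image_Un[OF f, of _ S])
      (use finR R S' inj in \<open>auto simp: RS spS spS' spR\<close>)
  have sub': "f ` (R - S) \<union> S' \<subseteq> span R'"
    using ZZ R(2) S' sub(6) spR' by blast
  have "card (f ` (R - S) \<union> S') \<le> card R'"
    using independent_span_bound[OF finR' conjunct1[OF *] sub'] by blast
  moreover have "card (f ` (R - S) \<union> S') = card (R - S) + card S'"
    using * finR finR' R'(1) by (subst card_Un_disjoint) (auto simp: card_image finite_subset)
  moreover have "card (R - S) = card R - card S"
    using R(1) finR by (intro card_Diff_subset) (auto simp: finite_subset)
  ultimately show ?thesis using S(4) S'(4) dZ dZ' by linarith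
qed

end

section \<open>Maps induced on Tor\<close>

lemma mat_app_add: "mat_app r s A (v + w) = mat_app r s A v + mat_app r s A w"
  by (simp add: mat_app_def fun_eq_iff algebra_simps sum.distrib)

lemma mat_app_vscale: "mat_app r s A (vscale c v) = vscale c (mat_app r s A v)"
  by (simp add: mat_app_def vscale_def fun_eq_iff sum_distrib_left mult.left_commute)

lemma mat_app_mat_app: "mat_app r s A (mat_app s u B v) = mat_app r u (mm s A B) v"
  by (simp add: mat_app_def mm_def fun_eq_iff sum_distrib_left sum_distrib_right mult.assoc)
     (subst sum.swap, simp)

lemma mat_app_cong: "(\<And>a b. a < r \<Longrightarrow> b < s \<Longrightarrow> A a b = B a b) \<Longrightarrow> mat_app r s A v = mat_app r s B v"
  by (simp add: mat_app_def fun_eq_iff)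

lemma mat_app_mat_add: "mat_app r s (\<lambda>a b. A a b + B a b) v = mat_app r s A v + mat_app r s B v"
  by (simp add: mat_app_def fun_eq_iff algebra_simps sum.distrib)

lemma mat_app_zero: "mat_app r s (\<lambda>a b. 0) v = 0" "mat_app r s A 0 = 0"
  by (simp_all add: mat_app_def fun_eq_iff)

definition const_mat :: "(nat \<Rightarrow> nat \<Rightarrow> 'k::field mpoly) \<Rightarrow> nat \<Rightarrow> nat \<Rightarrow> 'k"
  where "const_mat A = (\<lambda>a b. const_coeff (A a b))"

lemma const_mat_mm: "const_mat (mm n A B) = mm n (const_mat A) (const_mat B)"
  by (simp add: const_mat_def mm_def fun_eq_iff const_coeff_sum const_coeff_mult)

text \<open>The index grows by one because the extended complex has S in position 0.\<close>

lemma fibre_diff_eq: "fibre_diff F i = mat_app (rnk F i) (rnk F (Suc i)) (const_mat (ext_mat F (Suc i)))"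
  by (simp add: fibre_diff_def const_mat_def ext_mat_def const_coeff_def fun_eq_iff)

lemma fibre_mat_app:
  assumes "\<And>a b. a < rnk G i' \<Longrightarrow> b < rnk F i \<Longrightarrow> A a b \<noteq> 0 \<Longrightarrow> shift F i b = shift G i' a" and "v \<in> fibre F i j"
  shows "mat_app (rnk G i') (rnk F i) A v \<in> fibre G i' j"
proof -
  have "a < rnk G i' \<and> shift G i' a = j" if "mat_app (rnk G i') (rnk F i) A v a \<noteq> 0" for a
  proof -
    have a: "a < rnk G i'" using that by (auto simp: mat_app_def split: if_splits)
    then have "(\<Sum>b<rnk F i. A a b * v b) \<noteq> 0" using that by (simp add: mat_app_def)
    then obtain b where "b < rnk F i" "A a b \<noteq> 0" "v b \<noteq> 0"
      using sum.neutral[of "{..<rnk F i}" "\<lambda>b. A a b * v b"] by fastforce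
    then show ?thesis using a assms by (auto simp: fibre_def)
  qed
  then show ?thesis by (simp add: fibre_def)
qed

lemma graded_map_const:
  assumes "graded_map N F G r \<phi>" "a < ext_rank G (r i)" "b < ext_rank F i" "const_mat (\<phi> i) a b \<noteq> 0"
  shows "ext_shift F i b = ext_shift G (r i) a"
  using assms const_coeff_homogeneous[of "ext_shift F i b - ext_shift G (r i) a" "\<phi> i a b"]
  by (auto simp: graded_map_def hvec_def const_mat_def)

lemma ext_mat_const:
  assumes "graded_free_resolution N M F" "a < ext_rank F i" "b < ext_rank F (Suc i)" "const_mat (ext_mat F i) a b \<noteq> 0"
  shows "ext_shift F (Suc i) b = ext_shift F i a"
  using ext_mat_graded[OF assms(1-3)] assms(4)
    const_coeff_homogeneous[of "ext_shift F (Suc i) b - ext_shift F i a" "ext_mat F i a b"]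
  by (auto simp: const_mat_def)

lemma fibre_diff_fibre:
  assumes "graded_free_resolution N M F" "v \<in> fibre F (Suc i) j"
  shows "fibre_diff F i v \<in> fibre F i j"
  unfolding fibre_diff_eq
  by (rule fibre_mat_app[OF _ assms(2)])
    (use ext_mat_const[OF assms(1), where i = "Suc i"] in \<open>simp add: ext_rank_def ext_shift_def\<close>)

lemma fibre_add: "v \<in> fibre F i j \<Longrightarrow> w \<in> fibre F i j \<Longrightarrow> v + w \<in> fibre F i j"
  by (auto simp: fibre_def) (metis add_cancel_left_left)+

lemma fibre_vscale: "v \<in> fibre F i j \<Longrightarrow> vscale c v \<in> fibre F i j"
  by (auto simp: fibre_def vscale_def)

lemma fibre_0: "0 \<in> fibre F i j"
  by (simp add: fibre_def)

lemma fibre_span: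
  "fibre F i j \<subseteq> module.span vscale ((\<lambda>b a. if a = b then 1 else 0) ` {b. b < rnk F i \<and> shift F i b = j})"
    (is "_ \<subseteq> module.span _ (?e ` ?A)")
proof
  interpret vs: vector_space "vscale :: 'a \<Rightarrow> _" by (rule vector_space_vscale)
  fix v :: "nat \<Rightarrow> 'a" assume v: "v \<in> fibre F i j"
  have "v = (\<Sum>b\<in>?A. vscale (v b) (?e b))"
  proof
    fix a
    have fn: "finite ?A" by simp
    have "(\<Sum>b\<in>?A. vscale (v b) (?e b)) a = (\<Sum>b\<in>?A. vscale (v b) (?e b) a)"
      by (induction rule: finite_induct[OF fn]) auto
    also have "\<dots> = (\<Sum>b\<in>?A. if b = a then v b else 0)"
      by (intro sum.cong) (auto simp: vscale_def)
    also have "\<dots> = v a" using v by (auto simp: sum.delta' fibre_def)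
    finally show "v a = (\<Sum>b\<in>?A. vscale (v b) (?e b)) a" by simp
  qed
  moreover have "(\<Sum>b\<in>?A. vscale (v b) (?e b)) \<in> vs.span (?e ` ?A)"
    by (intro vs.span_sum vs.span_scale vs.span_base) auto
  ultimately show "v \<in> vs.span (?e ` ?A)" by simp
qed

text \<open>One inequality is enough, by symmetry in \<open>F\<close> and \<open>G\<close>. It
  follows because the map on Tor induced by a comparison map from \<open>F\<close> to
  \<open>G\<close> is injective: followed by a comparison map back, it becomes the identity up to
  homotopy.\<close>

lemma tor_dim_le:
  assumes F: "graded_free_resolution N M F" and G: "graded_free_resolution N M G"
  shows "tor_dim F i j \<le> tor_dim G i j"
proof -
  interpret vs: vector_space "vscale :: 'a \<Rightarrow> _" by (rule vector_space_vscale)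
  obtain \<phi> where \<phi>: "graded_map N F G (\<lambda>i. i) \<phi>" "chain_map F G \<phi>" "\<phi> 0 0 0 = 1"
    using comparison_map[OF F G] by blast
  obtain \<psi> where \<psi>: "graded_map N G F (\<lambda>i. i) \<psi>" "chain_map G F \<psi>" "\<psi> 0 0 0 = 1"
    using comparison_map[OF G F] by blast
  \<comment> \<open>Composite minus identity. Both are 1 in position 0, so \<open>h\<close> vanishes
    there and is null-homotopic.\<close>
  define h where "h i a b = mm (ext_rank G i) (\<psi> i) (\<phi> i) a b - (if a = b then 1 else 0)" for i a b
  have h1: "graded_map N F F (\<lambda>i. i) h"
    unfolding graded_map_def
  proof (intro allI impI)
    fix i b assume b: "b < ext_rank F i"
    have "hvec N F i (ext_shift F i b) (\<lambda>a. mm (ext_rank G i) (\<psi> i) (\<phi> i) a b)"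
      using \<phi>(1) \<psi>(1) b
      by (intro hvec_mm[where d = "ext_shift G i"]) (auto simp: graded_map_def hvec_def)
    then show "hvec N F i (ext_shift F i b) (\<lambda>a. h i a b)"
      by (auto simp: hvec_def h_def polys_diff homogeneous_diff polys_closed homogeneous_1 homogeneous_0)
  qed
  have h2: "chain_map F F h"
    unfolding chain_map_def
  proof (intro allI impI)
    fix i a b assume a: "a < ext_rank F i" and b: "b < ext_rank F (Suc i)"
    have "mm (ext_rank F (Suc i)) (ext_mat F i) (mm (ext_rank G (Suc i)) (\<psi> (Suc i)) (\<phi> (Suc i))) a b
      = mm (ext_rank G (Suc i)) (mm (ext_rank G i) (\<psi> i) (ext_mat G i)) (\<phi> (Suc i)) a b"
      unfolding mm_assoc[symmetric] using \<psi>(2) a by (intro mm_cong) (auto simp: chain_map_def)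
    also have "\<dots> = mm (ext_rank G i) (\<psi> i) (mm (ext_rank F i) (\<phi> i) (ext_mat F i)) a b"
      unfolding mm_assoc using \<phi>(2) b by (intro mm_cong) (auto simp: chain_map_def)
    finally have 1: "mm (ext_rank F (Suc i)) (ext_mat F i) (mm (ext_rank G (Suc i)) (\<psi> (Suc i)) (\<phi> (Suc i))) a b
      = mm (ext_rank F i) (mm (ext_rank G i) (\<psi> i) (\<phi> i)) (ext_mat F i) a b" by (simp add: mm_assoc)
    have "mm (ext_rank F (Suc i)) (ext_mat F i) (\<lambda>a b. if a = b then 1 else 0) a b = ext_mat F i a b"
      "mm (ext_rank F i) (\<lambda>a b. if a = b then 1 else 0) (ext_mat F i) a b = ext_mat F i a b"
      using a b by (simp_all add: mm_def if_distrib[of "\<lambda>z. _ * z"] if_distrib[of "\<lambda>z. z * _"] cong: if_cong)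
    then show "mm (ext_rank F (Suc i)) (ext_mat F i) (h (Suc i)) a b = mm (ext_rank F i) (h i) (ext_mat F i) a b"
      using 1 unfolding h_def mm_def by (simp add: algebra_simps sum_subtractf)
  qed
  have h3: "h 0 0 0 = 0" using \<phi>(3) \<psi>(3) by (simp add: h_def mm_def ext_rank_def)
  obtain s where s: "graded_map N F F Suc s" "\<And>a b. s 0 a b = 0"
    "\<And>i a b. a < ext_rank F (Suc i) \<Longrightarrow> b < ext_rank F (Suc i) \<Longrightarrow>
      h (Suc i) a b = mm (ext_rank F (Suc (Suc i))) (ext_mat F (Suc i)) (s (Suc i)) a b
        + mm (ext_rank F i) (s i) (ext_mat F i) a b"
    using null_homotopy[OF F h1 h2 h3] by blast
  let ?f = "mat_app (rnk G i) (rnk F i) (const_mat (\<phi> (Suc i)))"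
  let ?g = "\<lambda>i. mat_app (rnk F i) (rnk G i) (const_mat (\<psi> (Suc i)))"
  let ?s = "mat_app (rnk F (Suc i)) (rnk F i) (const_mat (s (Suc i)))"
  have f_fibre: "mat_app (rnk G i) (rnk F i) (const_mat (\<phi> (Suc i))) v \<in> fibre G i j" if "v \<in> fibre F i j" for v i
    by (rule fibre_mat_app[OF _ that])
      (use graded_map_const[OF \<phi>(1), where i = "Suc i"] in \<open>simp add: ext_rank_def ext_shift_def\<close>)
  have g_fibre: "?g i v \<in> fibre F i j" if "v \<in> fibre G i j" for v i
    by (rule fibre_mat_app[OF _ that])
      (use graded_map_const[OF \<psi>(1), where i = "Suc i"] in \<open>simp add: ext_rank_def ext_shift_def\<close>)
  have s_fibre: "?s v \<in> fibre F (Suc i) j" if "v \<in> fibre F i j" for v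
    by (rule fibre_mat_app[OF _ that])
      (use graded_map_const[OF s(1), where i = "Suc i"] in \<open>simp add: ext_rank_def ext_shift_def\<close>)
  have chain: "fibre_diff G' i' (mat_app (rnk G' (Suc i')) (rnk F' (Suc i')) (const_mat (\<chi> (Suc (Suc i')))) v)
      = mat_app (rnk G' i') (rnk F' i') (const_mat (\<chi> (Suc i'))) (fibre_diff F' i' v)"
    if "chain_map F' G' \<chi>" for F' G' :: "'a mpoly free_complex" and \<chi> i' v
    unfolding fibre_diff_eq mat_app_mat_app const_mat_mm[symmetric]
    using that by (intro mat_app_cong) (simp add: chain_map_def const_mat_def ext_rank_def)
  have homotopy: "?g i (?f v) = v + fibre_diff F i (?s v)" if v: "v \<in> tor_cycles F i j" for v
  proof -
    have vf: "v \<in> fibre F i j" using v by (auto simp: tor_cycles_def split: nat.splits)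
    have id: "mat_app (rnk F i) (rnk F i) (\<lambda>a b. if a = b then 1 else 0) v = v"
      using vf by (auto simp: mat_app_def fibre_def fun_eq_iff if_distrib[of "\<lambda>z. z * _"] cong: if_cong)
    \<comment> \<open>The homotopy term that begins with the differential. For \<open>i > 0\<close>
      the differential kills the cycle \<open>v\<close>; for \<open>i = 0\<close>, where the
      differential is the augmentation, \<open>s 0\<close> vanishes.\<close>
    have 0: "mat_app (rnk F i) (rnk F i) (const_mat (mm (ext_rank F i) (s i) (ext_mat F i))) v = 0"
    proof (cases i)
      case 0
      then show ?thesis using s(2) by (simp add: const_mat_def mm_def const_coeff_simps mat_app_zero)
    next
      case (Suc i')
      then have "mat_app (ext_rank F i) (rnk F i) (const_mat (ext_mat F i)) v = 0"
        using v by (simp add: tor_cycles_def fibre_diff_eq ext_rank_def)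
      then have "mat_app (rnk F i) (ext_rank F i) (const_mat (s i))
          (mat_app (ext_rank F i) (rnk F i) (const_mat (ext_mat F i)) v) = 0"
        by (simp only: mat_app_zero)
      then show ?thesis by (simp only: mat_app_mat_app const_mat_mm)
    qed
    have "?g i (?f v) = mat_app (rnk F i) (rnk F i) (const_mat (mm (rnk G i) (\<psi> (Suc i)) (\<phi> (Suc i)))) v"
      by (simp add: mat_app_mat_app const_mat_mm)
    also have "\<dots> = mat_app (rnk F i) (rnk F i) (\<lambda>a b. (if a = b then 1 else 0)
        + (const_mat (mm (rnk F (Suc i)) (ext_mat F (Suc i)) (s (Suc i))) a b
        + const_mat (mm (ext_rank F i) (s i) (ext_mat F i)) a b)) v"
    proof (rule mat_app_cong)
      fix a b assume ab: "a < rnk F i" "b < rnk F i"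
      have "mm (rnk G i) (\<psi> (Suc i)) (\<phi> (Suc i)) a b = (if a = b then 1 else 0)
        + (mm (rnk F (Suc i)) (ext_mat F (Suc i)) (s (Suc i)) a b + mm (ext_rank F i) (s i) (ext_mat F i) a b)"
        using s(3)[of a i b] ab by (simp add: h_def ext_rank_def algebra_simps)
      then show "const_mat (mm (rnk G i) (\<psi> (Suc i)) (\<phi> (Suc i))) a b = (if a = b then 1 else 0)
        + (const_mat (mm (rnk F (Suc i)) (ext_mat F (Suc i)) (s (Suc i))) a b
        + const_mat (mm (ext_rank F i) (s i) (ext_mat F i)) a b)"
        by (simp add: const_mat_def const_coeff_simps)
    qed
    also have "\<dots> = v + fibre_diff F i (?s v)"
      unfolding mat_app_mat_add id 0 fibre_diff_eq by (simp add: mat_app_mat_app const_mat_mm)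
    finally show ?thesis .
  qed
  have cyc: "vs.subspace (tor_cycles F i j)" for F :: "'a mpoly free_complex" and i
    unfolding tor_cycles_def
    by (cases i; intro vs.subspaceI)
      (auto simp: fibre_add fibre_vscale fibre_0 fibre_diff_def mat_app_add mat_app_vscale mat_app_zero
        vs.scale_zero_right)
  have bnd: "vs.subspace (tor_boundaries F i j)" for F :: "'a mpoly free_complex" and i
  proof (rule vs.subspaceI)
    show "0 \<in> tor_boundaries F i j"
      unfolding tor_boundaries_def
      by (rule image_eqI[OF _ fibre_0]) (simp add: fibre_diff_def mat_app_zero)
    show "x + y \<in> tor_boundaries F i j" if xy: "x \<in> tor_boundaries F i j" "y \<in> tor_boundaries F i j" for x y
    proof -
      obtain u w where "u \<in> fibre F (Suc i) j" "x = fibre_diff F i u" "w \<in> fibre F (Suc i) j" "y = fibre_diff F i w"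
        using xy unfolding tor_boundaries_def by blast
      then show ?thesis
        unfolding tor_boundaries_def
        by (intro image_eqI[OF _ fibre_add[of u F "Suc i" j w]]) (auto simp: fibre_diff_def mat_app_add)
    qed
    show "vscale c x \<in> tor_boundaries F i j" if xb: "x \<in> tor_boundaries F i j" for c x
    proof -
      obtain u where "u \<in> fibre F (Suc i) j" "x = fibre_diff F i u"
        using xb unfolding tor_boundaries_def by blast
      then show ?thesis
        unfolding tor_boundaries_def by (intro image_eqI[OF _ fibre_vscale[of u]]) (auto simp: fibre_diff_def mat_app_vscale)
    qed
  qed
  have bz: "tor_boundaries F i j \<subseteq> tor_cycles F i j" if F: "graded_free_resolution N M F"
    for F :: "'a mpoly free_complex" and i
  proof
    fix x assume "x \<in> tor_boundaries F i j"
    then obtain w where w: "w \<in> fibre F (Suc i) j" "x = fibre_diff F i w" by (auto simp: tor_boundaries_def)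
    have "fibre_diff F i' x = 0" if "i = Suc i'" for i'
    proof -
      have "fibre_diff F i' x = mat_app (rnk F i') (rnk F (Suc i)) (\<lambda>a b. 0) w"
        unfolding w fibre_diff_eq that mat_app_mat_app const_mat_mm[symmetric]
        using ext_mat_complex[OF F, of _ "Suc i'"]
        by (intro mat_app_cong) (simp add: const_mat_def const_coeff_simps ext_rank_def)
      then show ?thesis by (simp add: mat_app_zero)
    qed
    then show "x \<in> tor_cycles F i j"
      using fibre_diff_fibre[OF F w(1)] w(2) by (auto simp: tor_cycles_def split: nat.splits)
  qed
  have fin: "finite ((\<lambda>b a. if a = b then 1 else 0 :: 'a) ` {b. b < rnk F i \<and> shift F i b = j})"
    for F :: "'a mpoly free_complex" by simp
  have cf: "tor_cycles F i j \<subseteq> fibre F i j" for F :: "'a mpoly free_complex"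
    by (auto simp: tor_cycles_def split: nat.splits)
  show ?thesis
    unfolding tor_dim_def
  proof (rule vs.dim_quotient_le[where f = ?f, OF cyc bnd bz[OF F] cyc bnd bz[OF G] fin _ fin])
    show "tor_cycles F i j \<subseteq> vs.span ((\<lambda>b a. if a = b then 1 else 0) ` {b. b < rnk F i \<and> shift F i b = j})"
      "tor_cycles G i j \<subseteq> vs.span ((\<lambda>b a. if a = b then 1 else 0) ` {b. b < rnk G i \<and> shift G i b = j})"
      using cf fibre_span by blast+
    show "?f (x + y) = ?f x + ?f y" for x y by (rule mat_app_add)
    show "?f (vscale c x) = vscale c (?f x)" for c x by (rule mat_app_vscale)
    show "?f z \<in> tor_cycles G i j" if z: "z \<in> tor_cycles F i j" for z
    proof (cases i)
      case 0
      then show ?thesis using f_fibre[of z i] z by (simp add: tor_cycles_def)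
    next
      case (Suc i')
      have "fibre_diff F i' z = 0" using z by (simp add: tor_cycles_def Suc)
      then have "fibre_diff G i' (?f z) = 0"
        using chain[OF \<phi>(2), of i' z] by (simp add: Suc mat_app_zero)
      then show ?thesis using f_fibre[of z i] z cf[of F] by (auto simp: tor_cycles_def Suc)
    qed
    show "z \<in> tor_boundaries F i j" if z: "z \<in> tor_cycles F i j" "?f z \<in> tor_boundaries G i j" for z
    proof -
      obtain w where w: "w \<in> fibre G (Suc i) j" "?f z = fibre_diff G i w" using z(2) by (auto simp: tor_boundaries_def)
      \<comment> \<open>Up to a boundary, \<open>z\<close> is \<open>?g i (?f z)\<close>, and
        \<open>?g\<close> carries the boundary of \<open>w\<close> to the boundary of
        \<open>?g (Suc i) w\<close>.\<close>
      have "z = fibre_diff F i (?g (Suc i) w) - fibre_diff F i (?s z)"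
        using homotopy[OF z(1)] w(2) chain[OF \<psi>(2), of i w] by simp
      moreover have "fibre_diff F i (?g (Suc i) w) \<in> tor_boundaries F i j" "fibre_diff F i (?s z) \<in> tor_boundaries F i j"
        using g_fibre[OF w(1)] s_fibre[of z] z(1) cf[of F] by (auto simp: tor_boundaries_def)
      ultimately show ?thesis using vs.subspace_diff[OF bnd] by metis
    qed
  qed
qed

lemma tor_dim_unique:
  "graded_free_resolution N M F \<Longrightarrow> graded_free_resolution N M G \<Longrightarrow> tor_dim F i j = tor_dim G i j"
  by (intro antisym tor_dim_le)

text \<open>The choice in \<open>graded_betti\<close> is meaningful once some resolution exists; it
  need not pick the given one, but both yield the same dimension.\<close>

lemma graded_betti_eq:
  assumes F: "graded_free_resolution N M F"
  shows "graded_betti N M i j = tor_dim F i j"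
  unfolding graded_betti_def using tor_dim_unique[OF someI[of "graded_free_resolution N M", OF F] F] .

text \<open>Without constant terms all differentials vanish after tensoring with k, so every basis
  element is a cycle and 0 is the only boundary.\<close>

lemma tor_dim_minimal:
  assumes "\<And>i a b. a < rnk F i \<Longrightarrow> b < rnk F (Suc i) \<Longrightarrow> const_coeff (dmat F i a b) = 0"
  shows "tor_dim F i j = card {a. a < rnk F i \<and> shift F i a = j}"
proof -
  interpret vs: vector_space "vscale :: 'a \<Rightarrow> _" by (rule vector_space_vscale)
  have 0: "fibre_diff F i v = 0" for i v
    using assms by (simp add: fibre_diff_def mat_app_def fun_eq_iff const_coeff_def)
  let ?e = "\<lambda>b a. if a = b then 1 else 0 :: 'a" and ?A = "{b. b < rnk F i \<and> shift F i b = j}"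
  have inj: "inj_on ?e ?A" by (auto simp: inj_on_def fun_eq_iff split: if_splits)
  have "vs.dim (tor_cycles F i j) = card (?e ` ?A)"
  proof (rule vs.dim_unique)
    show "?e ` ?A \<subseteq> tor_cycles F i j"
      using 0 by (auto simp: tor_cycles_def fibre_def split: nat.splits if_splits)
    show "tor_cycles F i j \<subseteq> vs.span (?e ` ?A)"
      using fibre_span[of F i j] by (auto simp: tor_cycles_def split: nat.splits)
    show "vs.independent (?e ` ?A)"
    proof (rule vs.independent_if_scalars_zero)
      show "finite (?e ` ?A)" by simp
      fix f x assume s: "(\<Sum>x\<in>?e ` ?A. vscale (f x) x) = 0" and x: "x \<in> ?e ` ?A"
      then obtain b where b: "b \<in> ?A" "x = ?e b" by blast
      have fn: "finite ?A" by simp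
      have "(\<Sum>c\<in>?A. vscale (f (?e c)) (?e c)) = 0" using s by (simp add: sum.reindex[OF inj])
      then have "(\<Sum>c\<in>?A. vscale (f (?e c)) (?e c)) b = 0" by simp
      also have "(\<Sum>c\<in>?A. vscale (f (?e c)) (?e c)) b = (\<Sum>c\<in>?A. vscale (f (?e c)) (?e c) b)"
        by (induction rule: finite_induct[OF fn]) auto
      also have "\<dots> = (\<Sum>c\<in>?A. if c = b then f (?e c) else 0)"
        by (intro sum.cong) (auto simp: vscale_def)
      also have "\<dots> = f x" using b by (simp add: sum.delta')
      finally show "f x = 0" .
    qed
  qed simp
  moreover have "vs.dim (tor_boundaries F i j) = 0"
  proof -
    have "tor_boundaries F i j \<subseteq> {0}" using 0 by (auto simp: tor_boundaries_def)
    then show ?thesis using vs.dim_le_card[of "tor_boundaries F i j" "{}"] by auto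
  qed
  ultimately show ?thesis by (simp add: tor_dim_def card_image[OF inj])
qed

section \<open>From multigraded resolutions to graded free resolutions\<close>

definition mono_ideal :: "nat \<Rightarrow> (nat \<Rightarrow> nat) set \<Rightarrow> 'k::field mpoly set"
  where "mono_ideal N M = {p \<in> polys N. \<forall>e\<in>Poly_Mapping.keys p. lookup e \<in> M}"

lemma le_lookup_iff: "lookup e \<le> lookup f \<longleftrightarrow> (\<exists>g. f = e + g)"
  for e f :: "nat \<Rightarrow>\<^sub>0 nat"
proof
  assume le: "lookup e \<le> lookup f"
  have "f = e + (f - e)"
    using le by (intro poly_mapping_eqI) (simp add: lookup_add lookup_minus le_fun_def)
  then show "\<exists>g. f = e + g" ..
qed (auto simp: le_fun_def lookup_add)

lemma lookup_single_times:
  fixes e f :: "nat \<Rightarrow>\<^sub>0 nat" and p :: "'k::field mpoly"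
  shows "lookup (Poly_Mapping.single e c * p) f
    = (if lookup e \<le> lookup f then c * lookup p (f - e) else 0)"
proof -
  have "prod_fun (lookup (Poly_Mapping.single e c)) (lookup p) f
    = (\<Sum>l. lookup (Poly_Mapping.single e c) l * (\<Sum>q. lookup p q when f = l + q))"
    by (simp add: prod_fun_def)
  also have "(\<lambda>l. lookup (Poly_Mapping.single e c) l * (\<Sum>q. lookup p q when f = l + q))
    = (\<lambda>l. c * (\<Sum>q. lookup p q when f = e + q) when l = e)"
    by (rule ext) (simp add: lookup_single when_def)
  also have "(\<Sum>l. c * (\<Sum>q. lookup p q when f = e + q) when l = e)
    = c * (\<Sum>q. lookup p q when f = e + q)" by simp
  also have "(\<Sum>q. lookup p q when f = e + q)
    = (if lookup e \<le> lookup f then lookup p (f - e) else 0)"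
  proof (cases "lookup e \<le> lookup f")
    case True
    then obtain g where g: "f = e + g" using le_lookup_iff by blast
    have "(\<lambda>q. lookup p q when f = e + q) = (\<lambda>q. lookup p g when q = g)"
      by (rule ext) (auto simp: g when_def)
    then show ?thesis using True by (simp add: g)
  next
    case False
    then have *: "(\<lambda>q. lookup p q when f = e + q) = (\<lambda>q. 0)"
      using le_lookup_iff by (auto simp: when_def fun_eq_iff)
    show ?thesis unfolding * using False by simp
  qed
  finally have "prod_fun (lookup (Poly_Mapping.single e c)) (lookup p) f
    = c * (if lookup e \<le> lookup f then lookup p (f - e) else 0)" .
  then show ?thesis by (simp add: lookup_mult prod_fun_def)
qed

lemma keys_minus: "Poly_Mapping.keys (e - f) \<subseteq> Poly_Mapping.keys e" for e f :: "nat \<Rightarrow>\<^sub>0 nat"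
  by (auto simp: in_keys_iff lookup_minus)

lemma polys_single: "Poly_Mapping.keys e \<subseteq> {1..N} \<Longrightarrow> Poly_Mapping.single e c \<in> polys N"
  by (simp add: polys_def)

text \<open>The enumerations \<open>en i\<close> translate basis sets into the natural number
  indices of a \<open>free_complex\<close>. The assumption \<open>up\<close> keeps the exponents of
  multiples of generators inside \<open>M\<close>.\<close>

locale indexed_min_res =
  fixes N :: nat and M :: "(nat \<Rightarrow> nat) set" and B :: "nat \<Rightarrow> 'a set" and deg :: "'a \<Rightarrow> nat \<Rightarrow> nat"
    and C :: "nat \<Rightarrow> 'a \<Rightarrow> 'a \<Rightarrow> 'k::field" and en :: "nat \<Rightarrow> nat \<Rightarrow> 'a"
  assumes res: "min_res N M B deg C" and en: "bij_betw (en i) {..<card (B i)} (B i)" and up: "upset M"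
begin

definition expo :: "'a \<Rightarrow> nat \<Rightarrow>\<^sub>0 nat"
  where "expo b = Poly_Mapping.Abs_poly_mapping (deg b)"

definition idx :: "nat \<Rightarrow> 'a \<Rightarrow> nat"
  where "idx i = inv_into {..<card (B i)} (en i)"

text \<open>Subtraction of exponents is truncated, which does no harm: a nonzero scalar
  \<open>C (Suc i) a b\<close> forces \<open>deg a < deg b\<close>, and an entry with scalar 0 is
  the zero polynomial.\<close>

definition poly_complex :: "'k mpoly free_complex"
  where "poly_complex = \<lparr>rnk = \<lambda>i. card (B i), shift = \<lambda>i a. int (mon_deg (expo (en i a))),
    dmat = \<lambda>i a b. Poly_Mapping.single (expo (en (Suc i) b) - expo (en i a)) (C (Suc i) (en i a) (en (Suc i) b)),
    aug = \<lambda>b. Poly_Mapping.single (expo (en 0 b)) 1\<rparr>"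

text \<open>The component of multidegree \<open>\<alpha>\<close> of the vector \<open>v\<close>.\<close>

definition slice :: "nat \<Rightarrow> (nat \<Rightarrow> 'k mpoly) \<Rightarrow> (nat \<Rightarrow>\<^sub>0 nat) \<Rightarrow> 'a \<Rightarrow> 'k"
  where "slice i v \<alpha> = (\<lambda>b. if b \<in> B i \<and> deg b \<le> lookup \<alpha>
    then lookup (v (idx i b)) (\<alpha> - expo b) else 0)"

lemmas resD = min_resD[OF res]

lemma en_mem: "k < card (B i) \<Longrightarrow> en i k \<in> B i"
  using en bij_betwE by blast

lemma en_idx: "b \<in> B i \<Longrightarrow> en i (idx i b) = b" "b \<in> B i \<Longrightarrow> idx i b < card (B i)"
  using en[of i] bij_betw_inv_into_right[OF en] bij_betwE[OF bij_betw_inv_into[OF en]] unfolding idx_def by blast+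

lemma idx_en: "k < card (B i) \<Longrightarrow> idx i (en i k) = k"
  using bij_betw_inv_into_left[OF en] unfolding idx_def by blast

lemma lookup_expo:
  assumes "b \<in> B i"
  shows "lookup (expo b) = deg b"
proof -
  have "finite {v. deg b v \<noteq> 0}" using resD(3)[OF assms] finite_subset by blast
  then show ?thesis by (simp add: expo_def)
qed

lemma keys_expo: "b \<in> B i \<Longrightarrow> Poly_Mapping.keys (expo b) \<subseteq> {1..N}"
  using lookup_expo resD(3) by (fastforce simp: in_keys_iff)

lemma slice_chain: "slice i v \<alpha> \<in> chain_space (B i) deg (lookup \<alpha>)"
  by (auto simp: slice_def chain_space_def)

lemma slice_add_expo: "b \<in> B i \<Longrightarrow> slice i v (\<gamma> + expo b) b = lookup (v (idx i b)) \<gamma>"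
  by (simp add: slice_def lookup_add lookup_expo le_fun_def)

lemma slice_zero: "slice i (\<lambda>_. 0) \<alpha> = 0"
  by (simp add: slice_def fun_eq_iff)

lemma slice_eqI:
  assumes "\<And>\<alpha>. slice i v \<alpha> = slice i w \<alpha>" "\<And>a. card (B i) \<le> a \<Longrightarrow> v a = 0" "\<And>a. card (B i) \<le> a \<Longrightarrow> w a = 0"
  shows "v = w"
proof
  fix k
  show "v k = w k"
  proof (cases "k < card (B i)")
    case True
    show ?thesis
    proof (rule poly_mapping_eqI)
      fix \<gamma>
      show "lookup (v k) \<gamma> = lookup (w k) \<gamma>"
        using slice_add_expo[OF en_mem[OF True], of v \<gamma>] slice_add_expo[OF en_mem[OF True], of w \<gamma>] assms(1)
        by (simp add: idx_en[OF True])
    qed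
  qed (use assms in simp)
qed

lemma add_expo_inj: "inj (\<lambda>\<gamma>. \<gamma> + expo b)"
  by (simp add: inj_on_def)

lemma slice_finite: "finite {\<alpha>. slice i v \<alpha> \<noteq> 0}"
proof -
  have "{\<alpha>. slice i v \<alpha> \<noteq> 0} \<subseteq> (\<Union>b\<in>B i. (\<lambda>\<gamma>. \<gamma> + expo b) ` Poly_Mapping.keys (v (idx i b)))"
  proof
    fix \<alpha> assume "\<alpha> \<in> {\<alpha>. slice i v \<alpha> \<noteq> 0}"
    then obtain b where b: "b \<in> B i" "deg b \<le> lookup \<alpha>" "lookup (v (idx i b)) (\<alpha> - expo b) \<noteq> 0"
      by (auto simp: slice_def fun_eq_iff split: if_splits)
    have "expo b + (\<alpha> - expo b) = \<alpha>"
      using b(2) by (intro poly_mapping_eqI) (simp add: lookup_add lookup_minus lookup_expo[OF b(1)] le_fun_def)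
    then have "\<alpha> = (\<alpha> - expo b) + expo b" by (simp add: add.commute)
    then show "\<alpha> \<in> (\<Union>b\<in>B i. (\<lambda>\<gamma>. \<gamma> + expo b) ` Poly_Mapping.keys (v (idx i b)))"
      using b by (intro UN_I[OF b(1)] image_eqI[of _ _ "\<alpha> - expo b"]) (auto simp: in_keys_iff)
  qed
  then show ?thesis using resD(1) by (auto intro: finite_subset)
qed

lemma slice_support:
  assumes "v \<in> free_mod N (card (B i))" "slice i v \<alpha> \<noteq> 0"
  shows "Poly_Mapping.keys \<alpha> \<subseteq> {1..N}"
proof -
  obtain b where b: "b \<in> B i" "deg b \<le> lookup \<alpha>" "lookup (v (idx i b)) (\<alpha> - expo b) \<noteq> 0"
    using assms(2) by (auto simp: slice_def fun_eq_iff split: if_splits)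
  have "v (idx i b) \<in> polys N" using assms(1) en_idx(2)[OF b(1)] by (simp add: free_mod_def)
  then have 1: "Poly_Mapping.keys (\<alpha> - expo b) \<subseteq> {1..N}" using b(3) unfolding polys_def in_keys_iff[symmetric] by blast
  show ?thesis
  proof
    fix x assume "x \<in> Poly_Mapping.keys \<alpha>"
    then have "x \<in> Poly_Mapping.keys (\<alpha> - expo b) \<or> x \<in> Poly_Mapping.keys (expo b)"
      by (auto simp: in_keys_iff lookup_minus)
    then show "x \<in> {1..N}" using 1 keys_expo[OF b(1)] by blast
  qed
qed

text \<open>Inverse of slicing: the coefficient of x^\<gamma> in coordinate \<open>k\<close> is read
  off in multidegree \<open>\<gamma> + expo (en i k)\<close>. Finiteness makes the coordinates
  polynomials, and the support condition confines them to the variables 1, ...,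
  \<open>N\<close>.\<close>

lemma slice_assemble:
  assumes y: "\<And>\<alpha>. y \<alpha> \<in> chain_space (B i) deg (lookup \<alpha>)" and fin: "finite {\<alpha>. y \<alpha> \<noteq> 0}"
    and supp: "\<And>\<alpha>. y \<alpha> \<noteq> 0 \<Longrightarrow> Poly_Mapping.keys \<alpha> \<subseteq> {1..N}"
  shows "\<exists>w\<in>free_mod N (card (B i)). \<forall>\<alpha>. slice i w \<alpha> = y \<alpha>"
proof -
  define w where "w k = (if k < card (B i) then Poly_Mapping.Abs_poly_mapping (\<lambda>\<gamma>. y (\<gamma> + expo (en i k)) (en i k)) else 0)" for k
  have lw: "lookup (w k) \<gamma> = y (\<gamma> + expo (en i k)) (en i k)" if "k < card (B i)" for k \<gamma>
  proof -
    have "finite ((\<lambda>\<gamma>. \<gamma> + expo (en i k)) -` {\<alpha>. y \<alpha> \<noteq> 0})"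
      by (rule finite_vimageI[OF fin add_expo_inj])
    then have "finite {\<gamma>. y (\<gamma> + expo (en i k)) (en i k) \<noteq> 0}"
      by (rule rev_finite_subset) auto
    then show ?thesis using that by (simp add: w_def)
  qed
  show ?thesis
  proof (intro bexI allI)
    show "w \<in> free_mod N (card (B i))"
      unfolding free_mod_def
    proof (intro CollectI conjI allI impI)
      fix k assume k: "k < card (B i)"
      show "w k \<in> polys N"
        unfolding polys_def
      proof (intro CollectI ballI subsetI)
        fix \<gamma> x assume g: "\<gamma> \<in> Poly_Mapping.keys (w k)" and x: "x \<in> Poly_Mapping.keys \<gamma>"
        have "y (\<gamma> + expo (en i k)) \<noteq> 0" using g lw[OF k] by (auto simp: in_keys_iff)
        moreover have "x \<in> Poly_Mapping.keys (\<gamma> + expo (en i k))" using x by (simp add: in_keys_iff lookup_add)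
        ultimately show "x \<in> {1..N}" using supp by blast
      qed
    qed (simp add: w_def)
    fix \<alpha>
    show "slice i w \<alpha> = y \<alpha>"
    proof
      fix b
      show "slice i w \<alpha> b = y \<alpha> b"
      proof (cases "b \<in> B i \<and> deg b \<le> lookup \<alpha>")
        case True
        then have "\<alpha> - expo b + expo b = \<alpha>"
          using lookup_expo[of b i] by (intro poly_mapping_eqI) (simp add: lookup_add lookup_minus le_fun_def)
        then show ?thesis using True en_idx[of b i] by (simp add: slice_def lw)
      next
        case False
        then show ?thesis using y[of \<alpha>] by (auto simp: slice_def chain_space_def)
      qed
    qed
  qed
qed

lemma poly_complex_sel:
  "rnk poly_complex = (\<lambda>i. card (B i))" "shift poly_complex = (\<lambda>i a. int (mon_deg (expo (en i a))))"
  "dmat poly_complex = (\<lambda>i a b. Poly_Mapping.single (expo (en (Suc i) b) - expo (en i a)) (C (Suc i) (en i a) (en (Suc i) b)))"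
  "aug poly_complex = (\<lambda>b. Poly_Mapping.single (expo (en 0 b)) 1)"
  by (simp_all add: poly_complex_def)

lemma sum_en: "(\<Sum>k<card (B i). f (en i k)) = (\<Sum>b\<in>B i. f b)"
  by (rule sum.reindex_bij_betw[OF en])

text \<open>The coefficient at \<open>\<alpha> - expo a\<close> of x^(deg b - deg a) times
  coordinate \<open>b\<close> of \<open>v\<close> is the coefficient of that coordinate at
  \<open>\<alpha> - expo b\<close>. So in each multidegree the polynomial differential acts by the
  scalar matrix, and exactness can be tested there.\<close>

lemma slice_cdiff: "slice i (cdiff poly_complex i v) \<alpha> = mx (B (Suc i)) (C (Suc i)) (slice (Suc i) v \<alpha>)"
proof
  fix a
  let ?rhs = "\<Sum>b\<in>B (Suc i). C (Suc i) a b * slice (Suc i) v \<alpha> b"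
  show "slice i (cdiff poly_complex i v) \<alpha> a = mx (B (Suc i)) (C (Suc i)) (slice (Suc i) v \<alpha>) a"
  proof (cases "a \<in> B i \<and> deg a \<le> lookup \<alpha>")
    case True
    then have a: "a \<in> B i" "deg a \<le> lookup \<alpha>" by auto
    have t: "lookup (Poly_Mapping.single (expo b - expo a) (C (Suc i) a b) * v (idx (Suc i) b)) (\<alpha> - expo a)
      = C (Suc i) a b * slice (Suc i) v \<alpha> b" if b: "b \<in> B (Suc i)" for b
    proof (cases "C (Suc i) a b = 0")
      case False
      then have ab: "deg a \<le> deg b" using resD(5) by (simp add: less_imp_le)
      have "lookup (expo b - expo a) \<le> lookup (\<alpha> - expo a) \<longleftrightarrow> deg b \<le> lookup \<alpha>"
        using a ab by (auto simp: le_fun_def lookup_minus lookup_expo[OF a(1)] lookup_expo[OF b])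
          (metis diff_le_mono le_diff_iff)+
      moreover have "\<alpha> - expo a - (expo b - expo a) = \<alpha> - expo b"
        using a ab by (intro poly_mapping_eqI) (simp add: lookup_minus lookup_expo[OF a(1)] lookup_expo[OF b] le_fun_def)
      ultimately show ?thesis using b by (simp add: lookup_single_times slice_def)
    qed simp
    have "slice i (cdiff poly_complex i v) \<alpha> a = lookup (cdiff poly_complex i v (idx i a)) (\<alpha> - expo a)"
      using a by (simp add: slice_def)
    also have "cdiff poly_complex i v (idx i a) = (\<Sum>k<card (B (Suc i)).
        (\<lambda>b. Poly_Mapping.single (expo b - expo a) (C (Suc i) a b) * v (idx (Suc i) b)) (en (Suc i) k))"
      using a en_idx by (simp add: cdiff_def mat_app_def poly_complex_sel idx_en)
    also have "\<dots> = (\<Sum>b\<in>B (Suc i). Poly_Mapping.single (expo b - expo a) (C (Suc i) a b) * v (idx (Suc i) b))"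
      by (rule sum_en)
    finally show ?thesis using t by (simp add: lookup_sum mx_def)
  next
    case False
    have "C (Suc i) a b * slice (Suc i) v \<alpha> b = 0" for b
      using False resD(5)[of i a b] by (auto simp: slice_def) (meson less_imp_le order_trans)
    then have "mx (B (Suc i)) (C (Suc i)) (slice (Suc i) v \<alpha>) a = 0"
      unfolding mx_def by (rule sum.neutral[OF ballI])
    moreover have "slice i (cdiff poly_complex i v) \<alpha> a = 0"
      unfolding slice_def using False by (rule if_not_P)
    ultimately show ?thesis by simp
  qed
qed

lemma lookup_aug_map: "lookup (aug_map poly_complex v) \<alpha> = sum (slice 0 v \<alpha>) (B 0)"
proof -
  have "aug_map poly_complex v = (\<Sum>k<card (B 0). (\<lambda>b. Poly_Mapping.single (expo b) 1 * v (idx 0 b)) (en 0 k))"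
    by (simp add: aug_map_def poly_complex_sel idx_en mult.commute)
  also have "\<dots> = (\<Sum>b\<in>B 0. Poly_Mapping.single (expo b) 1 * v (idx 0 b))" by (rule sum_en)
  finally show ?thesis
    by (auto simp: lookup_sum lookup_single_times slice_def lookup_expo intro!: sum.cong)
qed

lemma cdiff_free_mod:
  assumes "w \<in> free_mod N (card (B (Suc i)))"
  shows "cdiff poly_complex i w \<in> free_mod N (card (B i))"
proof -
  have "dmat poly_complex i a b \<in> polys N" if "a < card (B i)" "b < card (B (Suc i))" for a b
    unfolding poly_complex_sel
  proof (rule polys_single)
    show "Poly_Mapping.keys (expo (en (Suc i) b) - expo (en i a)) \<subseteq> {1..N}"
      using keys_expo[OF en_mem[OF that(2)]] by (auto simp: in_keys_iff lookup_minus)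
  qed
  then show ?thesis
    using assms by (auto simp: free_mod_def cdiff_def mat_app_def poly_complex_sel(1) intro!: polys_sum polys_closed(4))
qed

lemma solve_slices:
  assumes v: "v \<in> free_mod N (card (B i))"
    and z: "\<And>\<alpha>. mx (B i) (C i) (slice i v \<alpha>) = 0"
  shows "\<exists>w\<in>free_mod N (card (B (Suc i))). cdiff poly_complex i w = v"
proof -
  \<comment> \<open>Choosing 0 wherever the slice of \<open>v\<close> is 0 leaves only finitely many
    nonzero solutions, so that they assemble to polynomials.\<close>
  have "\<exists>y. y \<in> chain_space (B (Suc i)) deg (lookup \<alpha>) \<and> mx (B (Suc i)) (C (Suc i)) y = slice i v \<alpha>
    \<and> (slice i v \<alpha> = 0 \<longrightarrow> y = 0)" for \<alpha>
  proof (cases "slice i v \<alpha> = 0")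
    case True
    then show ?thesis using chain_space_zero by (intro exI[of _ 0]) (simp add: mx_zero)
  next
    case False
    then show ?thesis using resD(8)[OF slice_chain z] by blast
  qed
  then obtain y where y: "\<And>\<alpha>. y \<alpha> \<in> chain_space (B (Suc i)) deg (lookup \<alpha>)"
    "\<And>\<alpha>. mx (B (Suc i)) (C (Suc i)) (y \<alpha>) = slice i v \<alpha>" "\<And>\<alpha>. slice i v \<alpha> = 0 \<Longrightarrow> y \<alpha> = 0" by metis
  have "\<exists>w\<in>free_mod N (card (B (Suc i))). \<forall>\<alpha>. slice (Suc i) w \<alpha> = y \<alpha>"
  proof (rule slice_assemble[OF y(1)])
    show "finite {\<alpha>. y \<alpha> \<noteq> 0}" using y(3) by (intro finite_subset[OF _ slice_finite[of i v]]) auto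
    show "Poly_Mapping.keys \<alpha> \<subseteq> {1..N}" if "y \<alpha> \<noteq> 0" for \<alpha>
      using slice_support[OF v] y(3) that by blast
  qed
  then obtain w where w: "w \<in> free_mod N (card (B (Suc i)))" "\<And>\<alpha>. slice (Suc i) w \<alpha> = y \<alpha>" by blast
  have "cdiff poly_complex i w = v"
  proof (rule slice_eqI[of i])
    show "slice i (cdiff poly_complex i w) \<alpha> = slice i v \<alpha>" for \<alpha> by (simp add: slice_cdiff w y)
  qed (use v cdiff_free_mod[OF w(1)] in \<open>auto simp: free_mod_def\<close>)
  then show ?thesis using w by blast
qed

lemma graded_free_resolution_complex: "graded_free_resolution N (mono_ideal N M) poly_complex"
proof -
  have hom: "homogeneous (int (mon_deg e)) (Poly_Mapping.single e c)" for e and c :: 'k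
    by (auto simp: homogeneous_def)
  have aug: "aug poly_complex b \<in> polys N" "homogeneous (shift poly_complex 0 b) (aug poly_complex b)" if "b < rnk poly_complex 0" for b
    using that keys_expo[OF en_mem, of b 0] hom by (simp_all add: poly_complex_sel polys_single)
  have dm: "dmat poly_complex i a b \<in> polys N" "homogeneous (shift poly_complex (Suc i) b - shift poly_complex i a) (dmat poly_complex i a b)"
    if ab: "a < rnk poly_complex i" "b < rnk poly_complex (Suc i)" for i a b
  proof -
    have m: "en i a \<in> B i" "en (Suc i) b \<in> B (Suc i)" using ab en_mem by (auto simp: poly_complex_sel)
    show "dmat poly_complex i a b \<in> polys N"
      using subset_trans[OF keys_minus keys_expo[OF m(2)]] by (simp add: poly_complex_sel polys_single)
    show "homogeneous (shift poly_complex (Suc i) b - shift poly_complex i a) (dmat poly_complex i a b)"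
    proof (cases "C (Suc i) (en i a) (en (Suc i) b) = 0")
      case True
      then show ?thesis by (simp add: poly_complex_sel homogeneous_0)
    next
      case False
      then have "deg (en i a) \<le> deg (en (Suc i) b)" using resD(5) by (simp add: less_imp_le)
      then have e: "expo (en (Suc i) b) = expo (en i a) + (expo (en (Suc i) b) - expo (en i a))"
        by (intro poly_mapping_eqI) (simp add: lookup_add lookup_minus lookup_expo[OF m(1)] lookup_expo[OF m(2)] le_fun_def)
      have "mon_deg (expo (en (Suc i) b)) = mon_deg (expo (en i a)) + mon_deg (expo (en (Suc i) b) - expo (en i a))"
        by (subst e) (rule mon_deg_add)
      then show ?thesis using hom[of "expo (en (Suc i) b) - expo (en i a)"] by (simp add: poly_complex_sel)
    qed
  qed
  have aug_polys: "aug_map poly_complex v \<in> polys N" if "v \<in> free_mod N (card (B 0))" for v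
    using that aug(1) by (auto simp: aug_map_def free_mod_def poly_complex_sel(1) intro!: polys_sum polys_closed(4))
  have "aug_map poly_complex ` free_mod N (rnk poly_complex 0) = mono_ideal N M"
  proof (intro equalityI subsetI)
    fix p assume "p \<in> aug_map poly_complex ` free_mod N (rnk poly_complex 0)"
    then obtain v where v: "v \<in> free_mod N (card (B 0))" "p = aug_map poly_complex v" by (auto simp: poly_complex_sel)
    have "lookup e \<in> M" if "e \<in> Poly_Mapping.keys p" for e
    proof -
      have "sum (slice 0 v e) (B 0) \<noteq> 0" using that v(2) by (simp add: in_keys_iff lookup_aug_map)
      then obtain b where "b \<in> B 0" "slice 0 v e b \<noteq> 0"
        using sum.neutral[of "B 0" "slice 0 v e"] by blast
      then have "deg b \<in> M" "deg b \<le> lookup e" using resD(2) by (auto simp: slice_def split: if_splits)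
      then show ?thesis using up unfolding upset_def by blast
    qed
    then show "p \<in> mono_ideal N M" using aug_polys[OF v(1)] v(2) by (simp add: mono_ideal_def)
  next
    fix p :: "'k mpoly" assume p: "p \<in> mono_ideal N M"
    have "\<exists>y. y \<in> chain_space (B 0) deg (lookup \<alpha>) \<and> sum y (B 0) = lookup p \<alpha>
      \<and> (lookup p \<alpha> = 0 \<longrightarrow> y = 0)" for \<alpha>
    proof (cases "lookup p \<alpha> = 0")
      case True
      then show ?thesis using chain_space_zero by (intro exI[of _ 0]) simp
    next
      case False
      then have "lookup \<alpha> \<in> M" using p by (simp add: mono_ideal_def in_keys_iff)
      then obtain b where "b \<in> B 0" "deg b \<le> lookup \<alpha>" using resD(7) by blast
      then show ?thesis using False resD(1)[of 0]
        by (intro exI[of _ "\<lambda>c. if c = b then lookup p \<alpha> else 0"]) (auto simp: chain_space_def)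
    qed
    then obtain y where y: "\<And>\<alpha>. y \<alpha> \<in> chain_space (B 0) deg (lookup \<alpha>)"
      "\<And>\<alpha>. sum (y \<alpha>) (B 0) = lookup p \<alpha>" "\<And>\<alpha>. lookup p \<alpha> = 0 \<Longrightarrow> y \<alpha> = 0" by metis
    have "\<exists>w\<in>free_mod N (card (B 0)). \<forall>\<alpha>. slice 0 w \<alpha> = y \<alpha>"
    proof (rule slice_assemble[OF y(1)])
      show "finite {\<alpha>. y \<alpha> \<noteq> 0}"
        using y(3) by (intro finite_subset[OF _ finite_keys[of p]]) (auto simp: in_keys_iff)
      show "Poly_Mapping.keys \<alpha> \<subseteq> {1..N}" if "y \<alpha> \<noteq> 0" for \<alpha>
        using y(3)[of \<alpha>] that p in_keys_iff[of \<alpha> p] unfolding mono_ideal_def polys_def by blast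
    qed
    then obtain w where w: "w \<in> free_mod N (card (B 0))" "\<And>\<alpha>. slice 0 w \<alpha> = y \<alpha>" by blast
    have "p = aug_map poly_complex w"
      by (rule poly_mapping_eqI) (simp add: lookup_aug_map w y)
    then show "p \<in> aug_map poly_complex ` free_mod N (rnk poly_complex 0)" using w by (simp add: poly_complex_sel)
  qed
  moreover have "{v \<in> free_mod N (rnk poly_complex 0). aug_map poly_complex v = 0} = cdiff poly_complex 0 ` free_mod N (rnk poly_complex 1)"
  proof (intro equalityI subsetI)
    fix v assume "v \<in> {v \<in> free_mod N (rnk poly_complex 0). aug_map poly_complex v = 0}"
    then have v: "v \<in> free_mod N (card (B 0))" "aug_map poly_complex v = 0" by (auto simp: poly_complex_sel)
    have "mx (B 0) (C 0) (slice 0 v \<alpha>) = 0" for \<alpha>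
      using lookup_aug_map[of v \<alpha>] v(2) by (simp add: resD(4) mx_one fun_eq_iff)
    from solve_slices[OF v(1) this] show "v \<in> cdiff poly_complex 0 ` free_mod N (rnk poly_complex 1)"
      by (auto simp: poly_complex_sel(1))
  next
    fix v assume "v \<in> cdiff poly_complex 0 ` free_mod N (rnk poly_complex 1)"
    then obtain w where w: "w \<in> free_mod N (card (B (Suc 0)))" "v = cdiff poly_complex 0 w" by (auto simp: poly_complex_sel(1))
    have "aug_map poly_complex v = 0"
    proof (rule poly_mapping_eqI)
      fix \<alpha>
      have "mx (B 0) (C 0) (slice 0 v \<alpha>) = 0" using resD(6) by (simp add: w slice_cdiff)
      then show "lookup (aug_map poly_complex v) \<alpha> = lookup 0 \<alpha>"
        by (simp add: lookup_aug_map resD(4) mx_one fun_eq_iff)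
    qed
    then show "v \<in> {v \<in> free_mod N (rnk poly_complex 0). aug_map poly_complex v = 0}"
      using cdiff_free_mod[OF w(1)] w(2) by (simp add: poly_complex_sel(1))
  qed
  moreover have "{v \<in> free_mod N (rnk poly_complex (Suc i)). cdiff poly_complex i v = 0}
      = cdiff poly_complex (Suc i) ` free_mod N (rnk poly_complex (Suc (Suc i)))" for i
  proof (intro equalityI subsetI)
    fix v assume "v \<in> {v \<in> free_mod N (rnk poly_complex (Suc i)). cdiff poly_complex i v = 0}"
    then have v: "v \<in> free_mod N (card (B (Suc i)))" "cdiff poly_complex i v = (\<lambda>_. 0)" by (auto simp: poly_complex_sel(1) func_zero)
    have "mx (B (Suc i)) (C (Suc i)) (slice (Suc i) v \<alpha>) = 0" for \<alpha>
      using slice_cdiff[of i v \<alpha>] v(2) by (simp add: slice_zero)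
    from solve_slices[OF v(1) this]
    show "v \<in> cdiff poly_complex (Suc i) ` free_mod N (rnk poly_complex (Suc (Suc i)))" by (auto simp: poly_complex_sel(1))
  next
    fix v assume "v \<in> cdiff poly_complex (Suc i) ` free_mod N (rnk poly_complex (Suc (Suc i)))"
    then obtain w where w: "w \<in> free_mod N (card (B (Suc (Suc i))))" "v = cdiff poly_complex (Suc i) w"
      by (auto simp: poly_complex_sel(1))
    have v: "v \<in> free_mod N (card (B (Suc i)))" using cdiff_free_mod[OF w(1)] w(2) by simp
    have "cdiff poly_complex i v = (\<lambda>_. 0)"
    proof (rule slice_eqI[of i])
      show "slice i (cdiff poly_complex i v) \<alpha> = slice i (\<lambda>_. 0) \<alpha>" for \<alpha>
        using resD(6) by (simp add: w slice_cdiff slice_zero)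
    qed (use cdiff_free_mod[OF v] in \<open>auto simp: free_mod_def\<close>)
    then show "v \<in> {v \<in> free_mod N (rnk poly_complex (Suc i)). cdiff poly_complex i v = 0}"
      using v by (simp add: poly_complex_sel(1) func_zero)
  qed
  ultimately show ?thesis
    unfolding graded_free_resolution_def using aug dm by (intro conjI allI impI)
qed

text \<open>A nonzero constant coefficient needs a nonzero scalar, hence
  \<open>deg a < deg b\<close>, and a truncated exponent equal to 0, hence
  \<open>deg b \<le> deg a\<close>. So the complex is minimal and Tor counts its generators.\<close>

lemma tor_dim_complex: "tor_dim poly_complex i j = card {b \<in> B i. int (\<Sum>v\<in>{1..N}. deg b v) = j}"
proof -
  have "tor_dim poly_complex i j = card {a. a < rnk poly_complex i \<and> shift poly_complex i a = j}"
  proof (rule tor_dim_minimal)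
    fix i a b assume "a < rnk poly_complex i" "b < rnk poly_complex (Suc i)"
    then have m: "en i a \<in> B i" "en (Suc i) b \<in> B (Suc i)" using en_mem by (auto simp: poly_complex_sel)
    show "const_coeff (dmat poly_complex i a b) = 0"
    proof (rule ccontr)
      assume "const_coeff (dmat poly_complex i a b) \<noteq> 0"
      then have "C (Suc i) (en i a) (en (Suc i) b) \<noteq> 0" "expo (en (Suc i) b) - expo (en i a) = 0"
        by (auto simp: const_coeff_def poly_complex_sel lookup_single when_def split: if_splits)
      then have "deg (en i a) < deg (en (Suc i) b)"
        "\<And>x. lookup (expo (en (Suc i) b) - expo (en i a)) x = 0"
        using resD(5) by simp_all
      then have "deg (en i a) < deg (en (Suc i) b)" "\<And>x. deg (en (Suc i) b) x - deg (en i a) x = 0"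
        by (simp_all add: lookup_minus lookup_expo[OF m(1)] lookup_expo[OF m(2)])
      then have "deg (en (Suc i) b) \<le> deg (en i a)" by (simp add: le_fun_def)
      then show False using \<open>deg (en i a) < deg (en (Suc i) b)\<close> by (simp add: less_le_not_le)
    qed
  qed
  also have "\<dots> = card (en i ` {a. a < card (B i) \<and> int (mon_deg (expo (en i a))) = j})"
    using en[of i] by (subst card_image) (auto simp: poly_complex_sel bij_betw_def inj_on_def)
  also have "en i ` {a. a < card (B i) \<and> int (mon_deg (expo (en i a))) = j} = {b \<in> B i. int (mon_deg (expo b)) = j}"
    using en[of i] by (auto simp: bij_betw_def image_iff)
  also have "\<dots> = {b \<in> B i. int (\<Sum>v\<in>{1..N}. deg b v) = j}"
    using mon_deg_superset[of "{1..N}"] keys_expo by (auto simp: lookup_expo)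
  finally show ?thesis .
qed

end

lemma graded_betti_mono_ideal:
  assumes "has_min_res (TYPE('k::field)) N M \<beta>" "upset M"
  shows "graded_betti N (mono_ideal N M :: 'k mpoly set) i j = (if 0 \<le> j then \<beta> i (nat j) else 0)"
proof -
  obtain B deg and C :: "nat \<Rightarrow> lab \<Rightarrow> lab \<Rightarrow> 'k" where res: "min_res N M B deg C"
    and c: "\<And>i j. card {b \<in> B i. (\<Sum>v\<in>{1..N}. deg b v) = j} = \<beta> i j"
    using assms(1) unfolding has_min_res_def by blast
  have "\<exists>f. bij_betw f {..<card (B i)} (B i)" for i
    using ex_bij_betw_nat_finite[OF min_resD(1)[OF res]] by (simp add: atLeast0LessThan)
  then obtain en where "\<And>i. bij_betw (en i) {..<card (B i)} (B i)" by metis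
  then interpret indexed_min_res N M B deg C en
    using res assms(2) by unfold_locales
  have "graded_betti N (mono_ideal N M :: 'k mpoly set) i j = card {b \<in> B i. int (\<Sum>v\<in>{1..N}. deg b v) = j}"
    using graded_betti_eq[OF graded_free_resolution_complex] tor_dim_complex by simp
  also have "\<dots> = (if 0 \<le> j then \<beta> i (nat j) else 0)"
  proof (cases "0 \<le> j")
    case True
    then have *: "int s = j \<longleftrightarrow> s = nat j" for s by auto
    show ?thesis unfolding * using c[of i "nat j"] True by simp
  next
    case False
    then have *: "int s \<noteq> j" for s by auto
    then have "{b \<in> B i. int (\<Sum>v\<in>{1..N}. deg b v) = j} = {}" by blast
    then show ?thesis using False by (simp only: card.empty if_False)
  qed
  finally show ?thesis .
qed

section \<open>Path ideals as monomial ideals\<close>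

definition path_mon :: "nat \<Rightarrow> nat \<Rightarrow> nat \<Rightarrow> nat"
  where "path_mon m c = (\<lambda>v. if c + 1 \<le> v \<and> v \<le> c + m then 1 else 0)"

text \<open>Exponent vectors of the monomials in the \<open>t\<close>-th power of the ideal generated by the first \<open>k\<close>
  path monomials.\<close>

fun path_powers :: "nat \<Rightarrow> nat \<Rightarrow> nat \<Rightarrow> (nat \<Rightarrow> nat) set" where
  "path_powers m k 0 = UNIV"
| "path_powers m k (Suc t) = {\<alpha>. \<exists>c<k. path_mon m c \<le> \<alpha> \<and> \<alpha> - path_mon m c \<in> path_powers m k t}"

lemma upset_path_powers: "upset (path_powers m k t)"
proof (induction t)
  case (Suc t)
  have "\<beta> \<in> path_powers m k (Suc t)" if \<alpha>: "\<alpha> \<in> path_powers m k (Suc t)" "\<alpha> \<le> \<beta>" for \<alpha> \<beta>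
  proof -
    obtain c where c: "c < k" "path_mon m c \<le> \<alpha>" "\<alpha> - path_mon m c \<in> path_powers m k t" using \<alpha> by auto
    have "\<alpha> - path_mon m c \<le> \<beta> - path_mon m c" using \<alpha>(2) by (simp add: le_fun_def diff_le_mono)
    then have "\<beta> - path_mon m c \<in> path_powers m k t" using c(3) Suc unfolding upset_def by blast
    then show ?thesis using c(1) order_trans[OF c(2) \<alpha>(2)] by auto
  qed
  then show ?case unfolding upset_def by blast
qed (simp add: upset_def)

lemma sum_singles: "p = (\<Sum>e\<in>Poly_Mapping.keys p. Poly_Mapping.single e (lookup p e))"
  by (rule poly_mapping_eqI) (auto simp: lookup_sum lookup_single when_def in_keys_iff)

lemma sum_mem_ideal:
  assumes I: "ideal I (poly_ring N)" and f: "\<And>x. x \<in> A \<Longrightarrow> f x \<in> I"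
  shows "sum f A \<in> I"
proof -
  interpret ideal I "poly_ring N" by (rule I)
  have "\<zero>\<^bsub>poly_ring N\<^esub> \<in> I" by (rule additive_subgroup.zero_closed[OF is_additive_subgroup])
  then have 0: "0 \<in> I" by (simp add: poly_ring_def)
  have "x + y \<in> I" if "x \<in> I" "y \<in> I" for x y using additive_subgroup.a_closed[OF is_additive_subgroup that] by (simp add: poly_ring_def)
  then show ?thesis using f 0 by (induction A rule: infinite_finite_induct) auto
qed

lemma ideal_mono_ideal:
  assumes "upset M"
  shows "ideal (mono_ideal N M :: 'k::field mpoly set) (poly_ring N)"
proof -
  interpret cring "poly_ring N :: 'k mpoly ring" by (rule cring_poly_ring)
  have mult: "x * a \<in> mono_ideal N M" if "a \<in> mono_ideal N M" "x \<in> polys N" for a x :: "'k mpoly"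
  proof -
    have "lookup e \<in> M" if "e \<in> Poly_Mapping.keys (x * a)" for e
    proof -
      obtain c d where "e = c + d" "d \<in> Poly_Mapping.keys a"
        using \<open>e \<in> Poly_Mapping.keys (x * a)\<close> Poly_Mapping.keys_mult[of x a] by blast
      then have "lookup d \<in> M" "lookup d \<le> lookup e"
        using \<open>a \<in> mono_ideal N M\<close> by (auto simp: mono_ideal_def lookup_add le_fun_def)
      then show ?thesis using assms unfolding upset_def by blast
    qed
    then show ?thesis using that polys_closed(4)[of x N a] by (simp add: mono_ideal_def)
  qed
  have um: "- a \<in> mono_ideal N M" if "a \<in> mono_ideal N M" for a :: "'k mpoly"
    using that polys_closed(5)[of a N] by (auto simp: mono_ideal_def in_keys_iff)
  have add: "a + b \<in> mono_ideal N M" if "a \<in> mono_ideal N M" "b \<in> mono_ideal N M" for a b :: "'k mpoly"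
    using that polys_closed(3)[of a N b] Poly_Mapping.keys_add[of a b] by (auto simp: mono_ideal_def)
  show ?thesis
  proof (rule idealI[OF ring_axioms])
    show "subgroup (mono_ideal N M) (add_monoid (poly_ring N :: 'k mpoly ring))"
    proof (rule add.subgroupI)
      show "mono_ideal N M \<subseteq> carrier (poly_ring N :: 'k mpoly ring)" by (auto simp: mono_ideal_def poly_ring_def)
      show "mono_ideal N M \<noteq> ({} :: 'k mpoly set)" using polys_closed(1)[of N] by (auto simp: mono_ideal_def intro!: exI[of _ 0])
      show "\<ominus>\<^bsub>poly_ring N\<^esub> a \<in> mono_ideal N M" if a: "a \<in> mono_ideal N M" for a :: "'k mpoly"
      proof -
        have "a \<in> polys N" using a by (simp add: mono_ideal_def)
        then have "\<ominus>\<^bsub>poly_ring N\<^esub> a = - a"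
          by (intro minus_equality) (simp_all add: poly_ring_def polys_closed)
        then show ?thesis using um[OF a] by simp
      qed
      show "a \<oplus>\<^bsub>poly_ring N\<^esub> b \<in> mono_ideal N M" if "a \<in> mono_ideal N M" "b \<in> mono_ideal N M" for a b :: "'k mpoly"
        using add[OF that] by (simp add: poly_ring_def)
    qed
  qed (use mult in \<open>simp_all add: poly_ring_def mult.commute\<close>)
qed

lemma mono_ideal_single:
  "Poly_Mapping.keys e \<subseteq> {1..N} \<Longrightarrow> lookup e \<in> M \<Longrightarrow> Poly_Mapping.single e c \<in> mono_ideal N M"
  by (simp add: mono_ideal_def polys_def)

lemma path_mon_exists:
  obtains u where "lookup u = path_mon m c" "Poly_Mapping.keys u = {c+1..c+m}"
    "(\<Prod>v\<in>{c+1..c+m}. pvar v) = (Poly_Mapping.single u 1 :: 'k::field mpoly)"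
proof
  let ?u = "\<Sum>v\<in>{c+1..c+m}. Poly_Mapping.single v (1::nat)"
  show l: "lookup ?u = path_mon m c"
    by (auto simp: fun_eq_iff lookup_sum lookup_single when_def path_mon_def)
  show "Poly_Mapping.keys ?u = {c+1..c+m}"
    unfolding set_eq_iff in_keys_iff l by (simp add: path_mon_def)
  have "(\<Prod>v\<in>A. pvar v) = (Poly_Mapping.single (\<Sum>v\<in>A. Poly_Mapping.single v 1) 1 :: 'k mpoly)" if "finite A" for A
    using that
  proof induction
    case (insert x F)
    then show ?case by (simp add: pvar_def Poly_Mapping.mult_single)
  qed (simp add: single_one)
  then show "(\<Prod>v\<in>{c+1..c+m}. pvar v) = (Poly_Mapping.single ?u 1 :: 'k mpoly)" by simp
qed

text \<open>An ideal containing the path monomials contains every term divisible by one of them,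
  hence every polynomial all of whose terms are of this kind.\<close>

lemma path_ideal_eq: "path_ideal n m = (mono_ideal (n + m) (path_powers m (Suc n) 1) :: 'k::field mpoly set)"
proof -
  let ?R = "poly_ring (n + m) :: 'k mpoly ring" and ?E = "path_powers m (Suc n) 1"
  interpret cring ?R by (rule cring_poly_ring)
  let ?G = "(\<lambda>s. \<Prod>v\<in>{s+1..s+m}. pvar v) ` {0..n} :: 'k mpoly set"
  have GE: "?G \<subseteq> mono_ideal (n + m) ?E"
  proof
    fix g assume "g \<in> ?G"
    then obtain s where s: "s \<le> n" "g = (\<Prod>v\<in>{s+1..s+m}. pvar v)" by auto
    obtain u where u: "lookup u = path_mon m s" "Poly_Mapping.keys u = {s+1..s+m}" "g = Poly_Mapping.single u 1"
      using path_mon_exists[of m s] s(2) by metis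
    have "lookup u \<in> ?E" using s(1) by (auto simp: u(1) intro!: exI[of _ s])
    moreover have "Poly_Mapping.keys u \<subseteq> {1..n+m}" using s(1) u(2) by auto
    ultimately show "g \<in> mono_ideal (n + m) ?E" unfolding u(3) by (intro mono_ideal_single)
  qed
  have "mono_ideal (n + m) ?E \<subseteq> I" if I: "ideal I ?R" and GI: "?G \<subseteq> I" for I
  proof
    fix p :: "'k mpoly" assume p: "p \<in> mono_ideal (n + m) ?E"
    interpret I: ideal I ?R by (rule I)
    have "Poly_Mapping.single e (lookup p e) \<in> I" if e: "e \<in> Poly_Mapping.keys p" for e
    proof -
      have "lookup e \<in> ?E" and ek: "Poly_Mapping.keys e \<subseteq> {1..n+m}"
        using p e by (auto simp: mono_ideal_def polys_def)
      then obtain c where c: "c \<le> n" "path_mon m c \<le> lookup e" by (auto simp: less_Suc_eq_le)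
      obtain u where u: "lookup u = path_mon m c" "(\<Prod>v\<in>{c+1..c+m}. pvar v) = (Poly_Mapping.single u 1 :: 'k mpoly)"
        using path_mon_exists[of m c] by metis
      obtain f where f: "e = u + f" using c(2) u(1) le_lookup_iff[of u e] by auto
      have "Poly_Mapping.keys f \<subseteq> Poly_Mapping.keys e" by (auto simp: f in_keys_iff lookup_add)
      then have "Poly_Mapping.single f (lookup p e) \<in> carrier ?R"
        using polys_single[OF subset_trans[OF _ ek]] by (simp add: poly_ring_def)
      moreover have "Poly_Mapping.single u 1 \<in> I" using GI c(1) u(2)[symmetric] by auto
      ultimately have "Poly_Mapping.single f (lookup p e) \<otimes>\<^bsub>?R\<^esub> Poly_Mapping.single u 1 \<in> I"
        by (intro I.I_l_closed)
      then show ?thesis by (simp add: poly_ring_def f Poly_Mapping.mult_single add.commute)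
    qed
    then show "p \<in> I" by (subst sum_singles) (rule sum_mem_ideal[OF I])
  qed
  then show ?thesis
    unfolding path_ideal_def genideal_def using ideal_mono_ideal[OF upset_path_powers] GE by blast
qed

lemma mono_ideal_prod:
  assumes "upset M"
  shows "ideal_prod (poly_ring (n + m)) (mono_ideal (n + m) M) (mono_ideal (n + m) (path_powers m (Suc n) 1))
    = (mono_ideal (n + m) {\<alpha>. \<exists>c<Suc n. path_mon m c \<le> \<alpha> \<and> \<alpha> - path_mon m c \<in> M} :: 'k::field mpoly set)"
    (is "ideal_prod ?R ?I ?J = ?K")
proof -
  have up: "upset {\<alpha>. \<exists>c<Suc n. path_mon m c \<le> \<alpha> \<and> \<alpha> - path_mon m c \<in> M}" (is "upset ?E")
  proof -
    have "\<beta> \<in> ?E" if \<alpha>: "\<alpha> \<in> ?E" "\<alpha> \<le> \<beta>" for \<alpha> \<beta>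
    proof -
      obtain c where c: "c < Suc n" "path_mon m c \<le> \<alpha>" "\<alpha> - path_mon m c \<in> M" using \<alpha> by blast
      have "\<alpha> - path_mon m c \<le> \<beta> - path_mon m c" using \<alpha>(2) by (simp add: le_fun_def diff_le_mono)
      then have "\<beta> - path_mon m c \<in> M" using c(3) assms unfolding upset_def by blast
      then show ?thesis using c(1) order_trans[OF c(2) \<alpha>(2)] by blast
    qed
    then show ?thesis unfolding upset_def by blast
  qed
  interpret cring "?R :: 'k mpoly ring" by (rule cring_poly_ring)
  have IJ: "ideal (ideal_prod ?R ?I ?J) (?R :: 'k mpoly ring)"
    by (intro ideal_prod_is_ideal ideal_mono_ideal assms upset_path_powers)
  show ?thesis
  proof (intro equalityI subsetI)
    fix p :: "'k mpoly" assume "p \<in> ideal_prod ?R ?I ?J"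
    then show "p \<in> ?K"
    proof induction
      case (prod i j)
      have "lookup e \<in> ?E" if "e \<in> Poly_Mapping.keys (i * j)" for e
      proof -
        obtain a b where ab: "e = a + b" "a \<in> Poly_Mapping.keys i" "b \<in> Poly_Mapping.keys j"
          using \<open>e \<in> Poly_Mapping.keys (i * j)\<close> Poly_Mapping.keys_mult[of i j] by blast
        have "lookup a \<in> M" "lookup b \<in> path_powers m (Suc n) 1"
          using prod ab by (auto simp: mono_ideal_def)
        then obtain c where c: "c < Suc n" "path_mon m c \<le> lookup b" by auto
        have "lookup b \<le> lookup e" by (simp add: ab(1) le_fun_def lookup_add)
        then have "path_mon m c \<le> lookup e" using c(2) by (rule order_trans[rotated])
        moreover have "lookup a \<le> lookup e - path_mon m c"
        proof (rule le_funI)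
          fix v
          have "path_mon m c v \<le> lookup b v" using c(2) by (simp add: le_fun_def)
          then show "lookup a v \<le> (lookup e - path_mon m c) v"
            by (simp add: ab(1) lookup_add)
        qed
        then have "lookup e - path_mon m c \<in> M"
          using \<open>lookup a \<in> M\<close> assms unfolding upset_def by blast
        ultimately show ?thesis using c(1) by blast
      qed
      moreover have "i * j \<in> polys (n + m)" using prod by (intro polys_closed) (auto simp: mono_ideal_def)
      ultimately have "i * j \<in> ?K" unfolding mono_ideal_def by blast
      moreover have "i \<otimes>\<^bsub>?R\<^esub> j = i * j" by (simp add: poly_ring_def)
      ultimately show ?case by metis
    next
      case (sum s1 s2)
      interpret K: ideal ?K "?R :: 'k mpoly ring" by (rule ideal_mono_ideal[OF up])
      show ?case using sum.IH by (intro additive_subgroup.a_closed[OF K.is_additive_subgroup])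
    qed
  next
    fix p :: "'k mpoly" assume p: "p \<in> ?K"
    have "Poly_Mapping.single e (lookup p e) \<in> ideal_prod ?R ?I ?J" if e: "e \<in> Poly_Mapping.keys p" for e
    proof -
      have "lookup e \<in> ?E" and ek: "Poly_Mapping.keys e \<subseteq> {1..n+m}"
        using p e by (auto simp: mono_ideal_def polys_def)
      then obtain c where c: "c \<le> n" "path_mon m c \<le> lookup e" "lookup e - path_mon m c \<in> M"
        unfolding mem_Collect_eq less_Suc_eq_le by blast
      obtain u where u: "lookup u = path_mon m c" "Poly_Mapping.keys u = {c+1..c+m}"
        using path_mon_exists[of m c] by metis
      obtain f where f: "e = u + f" using c(2) u(1) le_lookup_iff[of u e] by auto
      have "lookup e - path_mon m c = lookup f"
        by (simp add: f lookup_add u(1) fun_eq_iff)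
      then have fM: "lookup f \<in> M" using c(3) by simp
      have fk: "Poly_Mapping.keys f \<subseteq> {1..n+m}" using ek by (auto simp: f in_keys_iff lookup_add)
      have 1: "Poly_Mapping.single f (lookup p e) \<in> ?I" using fk fM by (rule mono_ideal_single)
      have "Poly_Mapping.keys u \<subseteq> {1..n+m}" "lookup u \<in> path_powers m (Suc n) 1"
        using c(1) by (auto simp: u intro!: exI[of _ c])
      then have 2: "Poly_Mapping.single u 1 \<in> ?J" by (rule mono_ideal_single)
      have "Poly_Mapping.single f (lookup p e) \<otimes>\<^bsub>?R\<^esub> Poly_Mapping.single u 1 \<in> ideal_prod ?R ?I ?J"
        using 1 2 by (rule ideal_prod.prod)
      then show ?thesis by (simp add: poly_ring_def f Poly_Mapping.mult_single add.commute)
    qed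
    then show "p \<in> ideal_prod ?R ?I ?J" by (subst sum_singles) (rule sum_mem_ideal[OF IJ])
  qed
qed

text \<open>The power in the monoid of ideals multiplies by one more factor on the right, matching
  the removal of one path monomial in \<open>path_powers\<close>; its unit is the whole ring,
  matching \<open>UNIV\<close> for exponent 0.\<close>

lemma path_ideal_power_eq:
  "path_ideal_power n m t = (mono_ideal (n + m) (path_powers m (Suc n) t) :: 'k::field mpoly set)"
proof (induction t)
  case 0
  then show ?case by (simp add: path_ideal_power_def ideals_set_def poly_ring_def mono_ideal_def)
next
  case (Suc t)
  have "path_ideal_power n m (Suc t)
    = ideal_prod (poly_ring (n + m)) (path_ideal_power n m t) (path_ideal n m :: 'k mpoly set)"
    by (simp add: path_ideal_power_def ideals_set_def)
  also have "\<dots> = mono_ideal (n + m) (path_powers m (Suc n) (Suc t))"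
    unfolding Suc path_ideal_eq mono_ideal_prod[OF upset_path_powers] by simp
  finally show ?case .
qed

section \<open>Exponents of powers of path ideals\<close>

definition unit_vec :: "nat \<Rightarrow> nat \<Rightarrow> nat"
  where "unit_vec n = (\<lambda>v. if v = n then 1 else 0)"

lemma path_powers_upI: "\<alpha> \<in> path_powers m k t \<Longrightarrow> \<alpha> \<le> \<beta> \<Longrightarrow> \<beta> \<in> path_powers m k t"
  using upset_path_powers unfolding upset_def by blast

lemma path_powers_mono: "k \<le> k' \<Longrightarrow> path_powers m k t \<subseteq> path_powers m k' t"
proof (induction t)
  case (Suc t)
  show ?case
  proof
    fix \<alpha> assume "\<alpha> \<in> path_powers m k (Suc t)"
    then obtain c where "c < k" "path_mon m c \<le> \<alpha>" "\<alpha> - path_mon m c \<in> path_powers m k t" by auto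
    then have "c < k'" "path_mon m c \<le> \<alpha>" "\<alpha> - path_mon m c \<in> path_powers m k' t" using Suc by auto
    then show "\<alpha> \<in> path_powers m k' (Suc t)" by auto
  qed
qed simp

lemma path_powers_Suc_I: "c < k \<Longrightarrow> path_mon m c \<le> \<alpha> \<Longrightarrow> \<alpha> - path_mon m c \<in> path_powers m k t \<Longrightarrow> \<alpha> \<in> path_powers m k (Suc t)"
  by auto

lemma path_powers_Suc_E:
  assumes "\<alpha> \<in> path_powers m k (Suc t)"
  obtains c where "c < k" "path_mon m c \<le> \<alpha>" "\<alpha> - path_mon m c \<in> path_powers m k t"
  using assms by auto

declare path_powers.simps(2) [simp del]

lemma path_powers_0_Suc: "path_powers m 0 (Suc t) = {}"
  by (simp add: path_powers.simps)

text \<open>The factors commute: if some other factor is removed first and u_k is found among the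
  remaining ones, the two removals are exchanged.\<close>

lemma path_powers_split:
  "\<alpha> \<in> path_powers m (Suc k) (Suc t) \<Longrightarrow>
    \<alpha> \<in> path_powers m k (Suc t) \<or> path_mon m k \<le> \<alpha> \<and> \<alpha> - path_mon m k \<in> path_powers m (Suc k) t"
proof (induction t arbitrary: \<alpha>)
  case 0
  then obtain c where "c < Suc k" "path_mon m c \<le> \<alpha>" by (rule path_powers_Suc_E)
  then show ?case by (cases "c = k") (auto intro: path_powers_Suc_I[of c])
next
  case (Suc t)
  let ?u = "path_mon m"
  obtain c where c: "c < Suc k" "?u c \<le> \<alpha>" "\<alpha> - ?u c \<in> path_powers m (Suc k) (Suc t)"
    using Suc.prems by (rule path_powers_Suc_E)
  show ?case
  proof (cases "c = k")
    case True
    then show ?thesis using c by blast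
  next
    case False
    then have ck: "c < k" using c by simp
    from Suc.IH[OF c(3)] show ?thesis
    proof
      assume "\<alpha> - ?u c \<in> path_powers m k (Suc t)"
      then show ?thesis using path_powers_Suc_I[OF ck c(2)] by blast
    next
      assume a: "?u k \<le> \<alpha> - ?u c \<and> \<alpha> - ?u c - ?u k \<in> path_powers m (Suc k) t"
      have le: "?u k v + ?u c v \<le> \<alpha> v" for v
      proof -
        have "?u k v \<le> \<alpha> v - ?u c v" "?u c v \<le> \<alpha> v" using a c(2) by (auto simp: le_fun_def)
        then show ?thesis by simp
      qed
      have "?u k \<le> \<alpha>" using le by (auto simp: le_fun_def intro: add_leD1)
      moreover have "?u c \<le> \<alpha> - ?u k"
      proof (rule le_funI)
        fix v show "?u c v \<le> (\<alpha> - ?u k) v" using le[of v] by simp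
      qed
      moreover have "\<alpha> - ?u k - ?u c = \<alpha> - ?u c - ?u k" by (simp add: fun_eq_iff add.commute)
      ultimately have "?u k \<le> \<alpha> \<and> \<alpha> - ?u k \<in> path_powers m (Suc k) (Suc t)"
        using path_powers_Suc_I[OF c(1)] a by simp
      then show ?thesis by blast
    qed
  qed
qed

lemma path_powers_Suc_eq:
  "path_powers m (Suc k) (Suc t) = path_powers m k (Suc t) \<union> shifted (path_mon m k) (path_powers m (Suc k) t)"
proof (intro equalityI subsetI)
  fix \<alpha> assume "\<alpha> \<in> path_powers m (Suc k) (Suc t)"
  then show "\<alpha> \<in> path_powers m k (Suc t) \<union> shifted (path_mon m k) (path_powers m (Suc k) t)"
    using path_powers_split by (auto simp: shifted_def)
next
  fix \<alpha> assume "\<alpha> \<in> path_powers m k (Suc t) \<union> shifted (path_mon m k) (path_powers m (Suc k) t)"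
  then show "\<alpha> \<in> path_powers m (Suc k) (Suc t)"
    using path_powers_mono[of k "Suc k" m "Suc t"] path_powers_Suc_I[of k "Suc k" m \<alpha> t]
    by (auto simp: shifted_def)
qed

text \<open>Removing the factor of largest index \<open>c\<close> from a factorisation leaves only
  factors of index at most \<open>c\<close>. All factors then involve only variables up to
  x_(c+m).\<close>

lemma path_powers_max:
  "\<alpha> \<in> path_powers m k (Suc t) \<Longrightarrow> \<exists>c<k. path_mon m c \<le> \<alpha> \<and> \<alpha> - path_mon m c \<in> path_powers m (Suc c) t"
proof (induction k)
  case 0
  then show ?case by (simp add: path_powers_0_Suc)
next
  case (Suc k)
  from path_powers_split[OF Suc.prems] show ?case
    using Suc.IH less_SucI[of _ k] lessI[of k] by blast
qed

text \<open>The first \<open>k\<close> path monomials contain only the variables x_1, ...,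
  x_(k+m-1), so membership depends on the exponents below \<open>k + m\<close>.\<close>

lemma path_powers_local:
  "\<gamma> \<in> path_powers m k t \<Longrightarrow> (\<And>v. v < k + m \<Longrightarrow> \<gamma> v \<le> \<gamma>' v) \<Longrightarrow> \<gamma>' \<in> path_powers m k t"
proof (induction t arbitrary: \<gamma> \<gamma>')
  case (Suc t)
  obtain c where c: "c < k" "path_mon m c \<le> \<gamma>" "\<gamma> - path_mon m c \<in> path_powers m k t"
    using Suc.prems(1) by (rule path_powers_Suc_E)
  have "path_mon m c v \<le> \<gamma>' v" for v
  proof (cases "v < k + m")
    case True
    then show ?thesis using c(2) Suc.prems(2)[OF True] order_trans by (auto simp: le_fun_def)
  next
    case False
    then show ?thesis using c(1) by (simp add: path_mon_def)
  qed
  moreover have "\<gamma>' - path_mon m c \<in> path_powers m k t"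
    by (rule Suc.IH[OF c(3)]) (use Suc.prems(2) in \<open>simp add: diff_le_mono\<close>)
  ultimately show ?case using c(1) by (intro path_powers_Suc_I) (auto simp: le_fun_def)
qed simp

text \<open>Path monomials are squarefree, so lowering one exponent by 1 destroys at most one factor
  of the product.\<close>

lemma path_powers_lower:
  "\<gamma> \<in> path_powers m k (Suc t) \<Longrightarrow> \<gamma> - unit_vec v \<in> path_powers m k t"
proof (induction t arbitrary: \<gamma>)
  case (Suc t)
  obtain c where c: "c < k" "path_mon m c \<le> \<gamma>" "\<gamma> - path_mon m c \<in> path_powers m k (Suc t)"
    using Suc.prems by (rule path_powers_Suc_E)
  show ?case
  proof (cases "path_mon m c v = 0")
    case True
    have "path_mon m c \<le> \<gamma> - unit_vec v"
      using c(2) True by (auto simp: le_fun_def unit_vec_def)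
    moreover have "\<gamma> - unit_vec v - path_mon m c = \<gamma> - path_mon m c - unit_vec v"
      by (simp add: fun_eq_iff add.commute)
    ultimately show ?thesis
      using Suc.IH[OF c(3)] by (intro path_powers_Suc_I[OF c(1)]) (simp_all only:)
  next
    case False
    then have "path_mon m c v = 1" by (simp add: path_mon_def split: if_splits)
    then have "\<gamma> - path_mon m c \<le> \<gamma> - unit_vec v"
      by (auto simp: le_fun_def unit_vec_def)
    then show ?thesis using c(3) path_powers_upI by blast
  qed
qed simp

lemma path_powers_decseq: "path_powers m k (Suc t) \<subseteq> path_powers m k t"
proof
  fix \<alpha> assume "\<alpha> \<in> path_powers m k (Suc t)"
  then have "\<alpha> - unit_vec 0 \<in> path_powers m k t" by (rule path_powers_lower)
  then show "\<alpha> \<in> path_powers m k t" by (rule path_powers_upI) (simp add: le_fun_def)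
qed

lemma upset_shifted: "upset M \<Longrightarrow> upset (shifted u M)"
proof -
  assume M: "upset M"
  have "\<beta> \<in> shifted u M" if \<alpha>: "\<alpha> \<in> shifted u M" "\<alpha> \<le> \<beta>" for \<alpha> \<beta>
  proof -
    have "\<alpha> - u \<le> \<beta> - u" using \<alpha>(2) by (simp add: le_fun_def diff_le_mono)
    then show ?thesis using \<alpha> M order_trans[of u \<alpha> \<beta>] unfolding shifted_def upset_def by blast
  qed
  then show ?thesis unfolding upset_def by blast
qed

text \<open>The colon ideal \<open>I\<^sub>n\<^bsup>t+1\<^esup> : u\<^sub>n\<close>. The truncated difference is intended: for \<open>n \<le> m\<close> the second part is
  empty.\<close>

abbreviation overlap :: "nat \<Rightarrow> nat \<Rightarrow> nat \<Rightarrow> (nat \<Rightarrow> nat) set"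
  where "overlap m n t \<equiv> shifted (unit_vec n) (path_powers m n t) \<union> path_powers m (n - m) (Suc t)"

lemma unit_vec_le: "unit_vec v \<le> \<alpha> \<longleftrightarrow> 0 < \<alpha> v"
  by (auto simp: le_fun_def unit_vec_def Suc_le_eq)

lemma overlap_subset:
  assumes "1 \<le> n"
  shows "overlap m n t \<subseteq> path_powers m (Suc n) t"
proof -
  have "shifted (unit_vec n) (path_powers m n t) \<subseteq> path_powers m n t"
    using path_powers_upI[of _ m n t] by (auto simp: shifted_def le_fun_def)
  moreover have "path_powers m (n - m) (Suc t) \<subseteq> path_powers m n t"
    using path_powers_mono[of "n - m" n m t] path_powers_decseq[of m "n - m" t] by auto
  moreover have "path_powers m n t \<subseteq> path_powers m (Suc n) t" by (rule path_powers_mono) simp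
  ultimately show ?thesis by blast
qed

text \<open>Let \<open>c\<close> be the largest index in a factorisation. If x_n divides u_c, then
  on the variables up to x_(c+m) the monomial u_n x_n divides u_c, so it can be removed in place of
  u_c without loss. If not, then c + m < n, all factors avoid the variables of u_n and belong to
  I_(n-m). Conversely, u_(n-1) divides u_n x_n.\<close>

lemma path_powers_Int:
  assumes n: "1 \<le> n" and m: "1 \<le> m"
  shows "path_powers m n (Suc t) \<inter> shifted (path_mon m n) (path_powers m (Suc n) t)
    = shifted (path_mon m n) (overlap m n t)"
proof (intro equalityI subsetI)
  let ?u = "path_mon m"
  fix \<alpha> assume "\<alpha> \<in> path_powers m n (Suc t) \<inter> shifted (?u n) (path_powers m (Suc n) t)"
  then have \<alpha>: "\<alpha> \<in> path_powers m n (Suc t)" and un: "?u n \<le> \<alpha>" by (auto simp: shifted_def)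
  obtain c where c: "c < n" "?u c \<le> \<alpha>" "\<alpha> - ?u c \<in> path_powers m (Suc c) t"
    using path_powers_max[OF \<alpha>] by blast
  show "\<alpha> \<in> shifted (?u n) (overlap m n t)"
  proof (cases "n \<le> c + m")
    case True
    have "?u c n \<le> \<alpha> n" using c(2) by (simp add: le_fun_def)
    then have "1 \<le> \<alpha> n" using True c(1) by (simp add: path_mon_def)
    then have "unit_vec n \<le> \<alpha> - ?u n" by (simp add: unit_vec_le path_mon_def)
    moreover have "\<alpha> - ?u n - unit_vec n \<in> path_powers m (Suc c) t"
    proof (rule path_powers_local[OF c(3)])
      fix v assume "v < Suc c + m"
      then have "?u n v + unit_vec n v \<le> ?u c v"
        using True c(1) by (auto simp: path_mon_def unit_vec_def)
      then show "(\<alpha> - ?u c) v \<le> (\<alpha> - ?u n - unit_vec n) v" by simp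
    qed
    then have "\<alpha> - ?u n - unit_vec n \<in> path_powers m n t"
      using path_powers_mono[of "Suc c" n m t] c(1) by auto
    ultimately show ?thesis using un by (simp add: shifted_def)
  next
    case False
    have "\<alpha> \<in> path_powers m (Suc c) (Suc t)" using c by (intro path_powers_Suc_I[of c]) auto
    then have "\<alpha> - ?u n \<in> path_powers m (Suc c) (Suc t)"
      by (rule path_powers_local) (use False in \<open>simp add: path_mon_def\<close>)
    moreover have "Suc c \<le> n - m" using False by simp
    ultimately have "\<alpha> - ?u n \<in> path_powers m (n - m) (Suc t)"
      using path_powers_mono[of "Suc c" "n - m" m "Suc t"] by blast
    then show ?thesis using un by (simp add: shifted_def)
  qed
next
  let ?u = "path_mon m"
  fix \<alpha> assume \<alpha>: "\<alpha> \<in> shifted (?u n) (overlap m n t)"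
  then have un: "?u n \<le> \<alpha>" and P: "\<alpha> - ?u n \<in> overlap m n t" by (auto simp: shifted_def)
  have "\<alpha> \<in> path_powers m n (Suc t)"
    using P
  proof
    assume "\<alpha> - ?u n \<in> shifted (unit_vec n) (path_powers m n t)"
    then have s: "unit_vec n \<le> \<alpha> - ?u n" "\<alpha> - ?u n - unit_vec n \<in> path_powers m n t"
      by (auto simp: shifted_def)
    have le: "?u (n - 1) v \<le> ?u n v + unit_vec n v" for v
      using n by (auto simp: path_mon_def unit_vec_def)
    have ge: "?u n v + unit_vec n v \<le> \<alpha> v" for v
    proof -
      have "unit_vec n v \<le> \<alpha> v - ?u n v" "?u n v \<le> \<alpha> v" using s(1) un by (auto simp: le_fun_def)
      then show ?thesis by simp
    qed
    have "?u (n - 1) \<le> \<alpha>" using order_trans[OF le ge] by (simp add: le_fun_def)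
    moreover have "\<alpha> - ?u n - unit_vec n \<le> \<alpha> - ?u (n - 1)"
    proof (rule le_funI)
      fix v show "(\<alpha> - ?u n - unit_vec n) v \<le> (\<alpha> - ?u (n - 1)) v" using le[of v] by simp
    qed
    then have "\<alpha> - ?u (n - 1) \<in> path_powers m n t" using s(2) path_powers_upI by blast
    ultimately show ?thesis using n by (intro path_powers_Suc_I[of "n - 1"]) auto
  next
    assume "\<alpha> - ?u n \<in> path_powers m (n - m) (Suc t)"
    then have "\<alpha> \<in> path_powers m (n - m) (Suc t)"
      by (rule path_powers_upI) (simp add: le_fun_def)
    then show ?thesis using path_powers_mono[of "n - m" n m "Suc t"] by auto
  qed
  then show "\<alpha> \<in> path_powers m n (Suc t) \<inter> shifted (?u n) (path_powers m (Suc n) t)"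
    using un P overlap_subset[OF n] by (auto simp: shifted_def)
qed

text \<open>For n > m the generators of I_(n-m) use only variables before x_n. For n <= m the
  truncated difference is 0 and the positive power has no elements.\<close>

lemma path_powers_remove_unit:
  assumes "\<gamma> \<in> path_powers m (n - m) (Suc t)" "\<And>v. v < n \<Longrightarrow> \<gamma> v \<le> \<gamma>' v"
  shows "\<gamma>' \<in> path_powers m (n - m) (Suc t)"
proof (cases "n \<le> m")
  case True
  then show ?thesis using assms(1) by (simp add: path_powers_0_Suc)
next
  case False
  then show ?thesis using assms by (intro path_powers_local[OF assms(1)]) simp
qed

text \<open>The variable x_n does not occur in the generators of I_(n-m), so a multiple of x_n in
  I_(n-m)^(t+1) can be divided by it. The quotient also lies in I_n^t, because I_(n-m)^(t+1) is
  contained in it.\<close>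

lemma overlap_Int:
  assumes n: "1 \<le> n"
  shows "shifted (unit_vec n) (path_powers m n t) \<inter> path_powers m (n - m) (Suc t)
    = shifted (unit_vec n) (path_powers m (n - m) (Suc t))"
proof (intro equalityI subsetI)
  fix \<alpha> assume "\<alpha> \<in> shifted (unit_vec n) (path_powers m n t) \<inter> path_powers m (n - m) (Suc t)"
  then have \<alpha>: "unit_vec n \<le> \<alpha>" "\<alpha> \<in> path_powers m (n - m) (Suc t)" by (auto simp: shifted_def)
  have "\<alpha> - unit_vec n \<in> path_powers m (n - m) (Suc t)"
    by (rule path_powers_remove_unit[OF \<alpha>(2)]) (simp add: unit_vec_def)
  then show "\<alpha> \<in> shifted (unit_vec n) (path_powers m (n - m) (Suc t))" using \<alpha> by (simp add: shifted_def)
next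
  fix \<alpha> assume "\<alpha> \<in> shifted (unit_vec n) (path_powers m (n - m) (Suc t))"
  then have \<alpha>: "unit_vec n \<le> \<alpha>" "\<alpha> - unit_vec n \<in> path_powers m (n - m) (Suc t)" by (auto simp: shifted_def)
  have "\<alpha> \<in> path_powers m (n - m) (Suc t)"
    by (rule path_powers_upI[OF \<alpha>(2)]) (simp add: le_fun_def)
  moreover have "\<alpha> - unit_vec n \<in> path_powers m n t"
    using \<alpha>(2) path_powers_decseq[of m "n - m" t] path_powers_mono[of "n - m" n m t] by auto
  ultimately show "\<alpha> \<in> shifted (unit_vec n) (path_powers m n t) \<inter> path_powers m (n - m) (Suc t)"
    using \<alpha>(1) by (simp add: shifted_def)
qed

section \<open>Division by variables inside the two intersections\<close>

lemma lower_eq: "lower k \<alpha> = \<alpha> - unit_vec (pivot k \<alpha>)"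
  by (simp add: lower_def unit_vec_def fun_eq_iff)

text \<open>Some factor u_c with c < n - m occurs, so its first variable x_(c+1) lies in the support
  and the least variable of the support comes before x_n. The assumption on \<open>k\<close> ensures
  the same when the front variable is taken instead.\<close>

lemma path_powers_pivot:
  assumes "\<gamma> \<in> path_powers m (n - m) (Suc t)" "\<gamma> \<le> \<alpha>" "1 \<le> m" "\<alpha> k = 0 \<or> k < n"
  shows "pivot k \<alpha> < n"
proof -
  obtain c where c: "c < n - m" "path_mon m c \<le> \<gamma>" using assms(1) by (rule path_powers_Suc_E)
  have "path_mon m c (c + 1) \<le> \<gamma> (c + 1)" "\<gamma> (c + 1) \<le> \<alpha> (c + 1)"
    using c(2) assms(2) by (auto simp: le_fun_def)
  then have "0 < \<alpha> (c + 1)" using assms(3) by (simp add: path_mon_def)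
  then have "(LEAST v. 0 < \<alpha> v) \<le> c + 1" by (rule Least_le)
  then show ?thesis using c(1) assms(3,4) by (auto simp: pivot_def)
qed

text \<open>The two summands call for different front variables. x_(n+m) divides u_n but no
  generator of I_n, so dividing by it does not leave I_n^(t+1). For u_n I_(n+1)^t the divisor must
  avoid u_n, so x_n is put in front: on the first part of the overlap this undoes the multiplication
  by x_n, on the second it costs at most one of t + 1 factors. If x_n does not occur, the second
  part applies and the divisor is an earlier variable.\<close>

lemma lower_overlap:
  assumes n: "1 \<le> n" and m: "1 \<le> m" and \<alpha>: "\<alpha> \<in> shifted (path_mon m n) (overlap m n t)"
  shows "lower (n + m) \<alpha> \<in> path_powers m n (Suc t)"
    and "lower n \<alpha> \<in> shifted (path_mon m n) (path_powers m (Suc n) t)"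
proof -
  let ?u = "path_mon m n"
  have un: "?u \<le> \<alpha>" and P: "\<alpha> - ?u \<in> overlap m n t" using \<alpha> by (auto simp: shifted_def)
  have J: "\<alpha> \<in> path_powers m n (Suc t)" using \<alpha> path_powers_Int[OF n m] by blast
  have "?u (n + m) \<le> \<alpha> (n + m)" using un by (simp add: le_fun_def)
  then have "0 < \<alpha> (n + m)" using m by (simp add: path_mon_def)
  then have "lower (n + m) \<alpha> = \<alpha> - unit_vec (n + m)" by (simp add: lower_eq pivot_def)
  then show "lower (n + m) \<alpha> \<in> path_powers m n (Suc t)"
    by (simp, intro path_powers_local[OF J]) (simp add: unit_vec_def)
  have sub: "?u \<le> \<alpha> - unit_vec v" if "v \<le> n" for v
  proof (rule le_funI)
    fix x
    have "?u x \<le> \<alpha> x" using un by (simp add: le_fun_def)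
    then show "?u x \<le> (\<alpha> - unit_vec v) x" using that by (cases "x = v") (simp_all add: unit_vec_def path_mon_def)
  qed
  have comm: "\<alpha> - unit_vec v - ?u = \<alpha> - ?u - unit_vec v" for v by (simp add: fun_eq_iff add.commute)
  have mono: "path_powers m n t \<subseteq> path_powers m (Suc n) t" "path_powers m (n - m) t \<subseteq> path_powers m (Suc n) t"
    by (intro path_powers_mono; simp)+
  show "lower n \<alpha> \<in> shifted ?u (path_powers m (Suc n) t)"
  proof (cases "0 < \<alpha> n")
    case True
    then have l: "lower n \<alpha> = \<alpha> - unit_vec n" by (simp add: lower_eq pivot_def)
    have "\<alpha> - ?u - unit_vec n \<in> path_powers m (Suc n) t"
      using P
    proof
      assume "\<alpha> - ?u \<in> shifted (unit_vec n) (path_powers m n t)"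
      then show ?thesis using mono by (auto simp: shifted_def)
    next
      assume "\<alpha> - ?u \<in> path_powers m (n - m) (Suc t)"
      then show ?thesis using path_powers_lower mono by blast
    qed
    then show ?thesis using sub[of n] comm by (simp add: l shifted_def)
  next
    case False
    then have "\<not> unit_vec n \<le> \<alpha> - ?u" by (simp add: unit_vec_le)
    then have g: "\<alpha> - ?u \<in> path_powers m (n - m) (Suc t)" using P by (simp add: shifted_def)
    have "pivot n \<alpha> < n"
      by (rule path_powers_pivot[OF g _ m]) (use False in \<open>auto simp: le_fun_def\<close>)
    moreover have "\<alpha> - ?u - unit_vec (pivot n \<alpha>) \<in> path_powers m (Suc n) t"
      using path_powers_lower[OF g] mono by blast
    ultimately show ?thesis using sub[of "pivot n \<alpha>"] comm by (simp add: lower_eq shifted_def)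
  qed
qed

text \<open>For x_n I_n^t the factor x_n must be kept, so a variable before x_n is removed; for
  I_(n-m)^(t+1) it is x_n that is removed. The front variable 0 leaves the natural order of the
  variables unchanged.\<close>

lemma lower_overlap_Int:
  assumes n: "1 \<le> n" and m: "1 \<le> m" and \<alpha>: "\<alpha> \<in> shifted (unit_vec n) (path_powers m (n - m) (Suc t))"
  shows "lower 0 \<alpha> \<in> shifted (unit_vec n) (path_powers m n t)"
    and "lower n \<alpha> \<in> path_powers m (n - m) (Suc t)"
proof -
  have g: "\<alpha> - unit_vec n \<in> path_powers m (n - m) (Suc t)" and a: "0 < \<alpha> n"
    using \<alpha> by (auto simp: shifted_def unit_vec_le)
  then show "lower n \<alpha> \<in> path_powers m (n - m) (Suc t)" by (simp add: lower_eq pivot_def)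
  have p: "pivot 0 \<alpha> < n"
    by (rule path_powers_pivot[OF g _ m]) (use n in \<open>auto simp: le_fun_def\<close>)
  have "\<alpha> - unit_vec n - unit_vec (pivot 0 \<alpha>) \<in> path_powers m n t"
    using path_powers_lower[OF g] path_powers_mono[of "n - m" n m t] by auto
  moreover have "\<alpha> - unit_vec (pivot 0 \<alpha>) - unit_vec n = \<alpha> - unit_vec n - unit_vec (pivot 0 \<alpha>)"
    by (simp add: fun_eq_iff add.commute)
  moreover have "unit_vec n \<le> \<alpha> - unit_vec (pivot 0 \<alpha>)"
    using p a by (simp add: unit_vec_le) (simp add: unit_vec_def)
  ultimately show "lower 0 \<alpha> \<in> shifted (unit_vec n) (path_powers m n t)"
    by (simp add: lower_eq shifted_def)
qed

section \<open>Betti numbers\<close>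

text \<open>The closed formula in the coordinates \<open>N\<close> = n - lm and \<open>p\<close> = i
  - l. The guard stands for the convention that a negative lower index gives 0. For
  \<open>t = 0\<close> the truncated \<open>t + l - 1\<close> makes the first factor 1 for
  \<open>l = 0\<close> and 0 otherwise, as the unit ideal requires.\<close>

definition binomial_term :: "nat \<Rightarrow> nat \<Rightarrow> nat \<Rightarrow> nat \<Rightarrow> nat"
  where "binomial_term N t p l = (t + l - 1 choose l) * (N choose p) *
    (if p \<le> t + l then N + t - p choose (t + l - p) else 0)"

lemma binomial_term_0: "binomial_term 0 t p l = (if p = 0 \<and> l = 0 then 1 else 0)"
  by (cases p; cases l) (auto simp: binomial_term_def binomial_eq_0)

text \<open>For \<open>p \<le> Suc N\<close>, Pascal's rule for each of the three factors writes the
  left side as (c + d)(a + b)(x + y). The terms on the right are (c + d)ax, c(a + b)y, cbx and d(ay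
  + b(x + y)), which contain each of the eight products exactly once.\<close>

lemma binomial_term_rec:
  "binomial_term (Suc N) (Suc t) p l = binomial_term N (Suc t) p l + binomial_term (Suc N) t p l
    + (case p of 0 \<Rightarrow> 0 | Suc p' \<Rightarrow> binomial_term N t p' l)
    + (case l of 0 \<Rightarrow> 0 | Suc l' \<Rightarrow> binomial_term N (Suc t) p l'
        + (case p of 0 \<Rightarrow> 0 | Suc p' \<Rightarrow> binomial_term N (Suc t) p' l'))"
proof (cases "p \<le> Suc N")
  case False
  then show ?thesis by (auto simp: binomial_term_def binomial_eq_0 split: nat.split)
next
  case True
  define a where "a = (N choose p)"
  define b where "b = (case p of 0 \<Rightarrow> 0 | Suc p' \<Rightarrow> N choose p')"
  define c where "c = (t + l - 1 choose l)"
  define d where "d = (case l of 0 \<Rightarrow> 0 | Suc l' \<Rightarrow> t + l' choose l')"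
  define x where "x = (if p \<le> Suc t + l then N + Suc t - p choose (Suc t + l - p) else 0)"
  define y where "y = (if p \<le> t + l then N + Suc t - p choose (t + l - p) else 0)"
  have ab: "Suc N choose p = a + b" by (cases p) (simp_all add: a_def b_def)
  have cd: "Suc t + l - 1 choose l = c + d" by (cases l) (simp_all add: c_def d_def)
  have xy: "(if p \<le> Suc t + l then Suc N + Suc t - p choose (Suc t + l - p) else 0) = x + y"
  proof -
    have "Suc N + Suc t - p = Suc (N + Suc t - p)" using True by simp
    moreover have "Suc t + l - p = Suc (t + l - p)" if "p \<le> t + l" using that by simp
    ultimately show ?thesis by (auto simp: x_def y_def le_Suc_eq)
  qed
  have t0: "binomial_term (Suc N) (Suc t) p l = (c + d) * (a + b) * (x + y)"
    unfolding binomial_term_def ab cd xy ..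
  have t1: "binomial_term N (Suc t) p l = (c + d) * a * x"
    unfolding binomial_term_def cd a_def x_def ..
  have t2: "binomial_term (Suc N) t p l = c * (a + b) * y"
    unfolding binomial_term_def ab c_def y_def by simp
  have t3: "(case p of 0 \<Rightarrow> 0 | Suc p' \<Rightarrow> binomial_term N t p' l) = c * b * x"
    by (cases p) (simp_all add: binomial_term_def b_def c_def x_def)
  have t4: "(case l of 0 \<Rightarrow> 0 | Suc l' \<Rightarrow> binomial_term N (Suc t) p l'
        + (case p of 0 \<Rightarrow> 0 | Suc p' \<Rightarrow> binomial_term N (Suc t) p' l')) = d * (a * y + b * (x + y))"
  proof (cases l)
    case 0
    then show ?thesis by (simp add: d_def)
  next
    case (Suc l')
    have "binomial_term N (Suc t) p l' = d * a * y"
      by (simp add: binomial_term_def d_def a_def y_def Suc)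
    moreover have "(case p of 0 \<Rightarrow> 0 | Suc p' \<Rightarrow> binomial_term N (Suc t) p' l') = d * b * (x + y)"
      unfolding xy[symmetric] by (cases p) (simp_all add: binomial_term_def d_def b_def Suc)
    ultimately show ?thesis by (simp add: Suc algebra_simps)
  qed
  show ?thesis unfolding t0 t1 t2 t3 t4 by (simp add: algebra_simps)
qed

text \<open>The contribution of homological degree \<open>i\<close> and internal degree \<open>i + tm + (m - 1)l\<close>; the paper's
  \<open>n\<close> is \<open>k - 1\<close>.\<close>

definition path_betti :: "nat \<Rightarrow> nat \<Rightarrow> nat \<Rightarrow> nat \<Rightarrow> nat \<Rightarrow> nat"
  where "path_betti m k t i l =
    (if k \<le> l * m \<or> i < l then 0 else binomial_term (k - 1 - l * m) t (i - l) l)"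

lemma path_betti_t0: "1 \<le> k \<Longrightarrow> path_betti m k 0 i l = (if i = 0 \<and> l = 0 then 1 else 0)"
  by (cases l) (auto simp: path_betti_def binomial_term_def binomial_eq_0)

lemma path_betti_k1: "1 \<le> m \<Longrightarrow> path_betti m 1 t i l = (if i = 0 \<and> l = 0 then 1 else 0)"
  by (cases l) (auto simp: path_betti_def binomial_term_0)

lemma path_betti_k0: "path_betti m 0 t i l = 0"
  by (simp add: path_betti_def)

text \<open>Passing to n - m and l - 1 preserves n - lm, so for n > lm this is
  \<open>binomial_term_rec\<close> with N = n - lm - 1. In the boundary case n = lm, the assumption
  n >= 1 gives l > 0 and every term is 0.\<close>

lemma path_betti_rec:
  assumes m: "1 \<le> m" and n: "1 \<le> n"
  shows "path_betti m (Suc n) (Suc t) i l = path_betti m n (Suc t) i l + path_betti m (Suc n) t i l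
    + (case i of 0 \<Rightarrow> 0 | Suc i' \<Rightarrow> path_betti m n t i' l + (case l of 0 \<Rightarrow> 0 | Suc l' \<Rightarrow> path_betti m (n - m) (Suc t) i' l')
        + (case i' of 0 \<Rightarrow> 0 | Suc i'' \<Rightarrow> (case l of 0 \<Rightarrow> 0 | Suc l' \<Rightarrow> path_betti m (n - m) (Suc t) i'' l')))"
proof (cases "n < l * m \<or> i < l")
  case True
  then show ?thesis
  proof
    assume "i < l"
    then show ?thesis by (auto simp: path_betti_def split: nat.split)
  next
    assume a: "n < l * m"
    have "n - m \<le> l' * m" if "l = Suc l'" for l' using a that by simp
    then show ?thesis using a by (auto simp: path_betti_def split: nat.split)
  qed
next
  case False
  then have nl: "l * m \<le> n" and il: "l \<le> i" by auto
  obtain p where i: "i = l + p" using il le_Suc_ex by blast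
  show ?thesis
  proof (cases "n - l * m")
    case 0
    then have nlm: "n = l * m" using nl by simp
    have "n - m \<le> l' * m" if "l = Suc l'" for l' using nlm that by simp
    moreover have "0 < l" using nlm n by (cases l) auto
    ultimately show ?thesis
      using 0 nl nlm by (auto simp: path_betti_def binomial_term_0 i split: nat.split)
  next
    case (Suc N)
    then have nN: "n = l * m + Suc N" using nl by simp
    have s1: "path_betti m (Suc n) t' i l = binomial_term (Suc N) t' p l" for t'
      by (simp add: path_betti_def i nN)
    have s2: "path_betti m n t' i l = binomial_term N t' p l" for t'
      by (simp add: path_betti_def i nN)
    have s3: "(case i of 0 \<Rightarrow> 0 | Suc i' \<Rightarrow> path_betti m n t i' l)
      = (case p of 0 \<Rightarrow> 0 | Suc p' \<Rightarrow> binomial_term N t p' l)"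
      by (cases p; cases l) (simp_all add: path_betti_def i nN)
    have k: "n - m = l' * m + Suc N" if "l = Suc l'" for l' using that nN by simp
    have s4: "(case i of 0 \<Rightarrow> 0 | Suc i' \<Rightarrow> (case l of 0 \<Rightarrow> 0 | Suc l' \<Rightarrow> path_betti m (n - m) (Suc t) i' l'))
      = (case l of 0 \<Rightarrow> 0 | Suc l' \<Rightarrow> binomial_term N (Suc t) p l')"
    proof (cases l)
      case (Suc l')
      then show ?thesis unfolding k[OF Suc] by (simp add: path_betti_def i)
    qed (simp split: nat.split)
    have s5: "(case i of 0 \<Rightarrow> 0 | Suc i' \<Rightarrow> (case i' of 0 \<Rightarrow> 0 | Suc i'' \<Rightarrow>
        (case l of 0 \<Rightarrow> 0 | Suc l' \<Rightarrow> path_betti m (n - m) (Suc t) i'' l')))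
      = (case l of 0 \<Rightarrow> 0 | Suc l' \<Rightarrow> (case p of 0 \<Rightarrow> 0 | Suc p' \<Rightarrow> binomial_term N (Suc t) p' l'))"
    proof (cases l)
      case (Suc l')
      then show ?thesis unfolding k[OF Suc]
        by (cases p; cases l') (simp_all add: path_betti_def i)
    qed (simp split: nat.split)
    have "(case i of 0 \<Rightarrow> 0 | Suc i' \<Rightarrow> path_betti m n t i' l + (case l of 0 \<Rightarrow> 0 | Suc l' \<Rightarrow> path_betti m (n - m) (Suc t) i' l')
        + (case i' of 0 \<Rightarrow> 0 | Suc i'' \<Rightarrow> (case l of 0 \<Rightarrow> 0 | Suc l' \<Rightarrow> path_betti m (n - m) (Suc t) i'' l')))
      = (case i of 0 \<Rightarrow> 0 | Suc i' \<Rightarrow> path_betti m n t i' l)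
        + (case i of 0 \<Rightarrow> 0 | Suc i' \<Rightarrow> (case l of 0 \<Rightarrow> 0 | Suc l' \<Rightarrow> path_betti m (n - m) (Suc t) i' l'))
        + (case i of 0 \<Rightarrow> 0 | Suc i' \<Rightarrow> (case i' of 0 \<Rightarrow> 0 | Suc i'' \<Rightarrow>
          (case l of 0 \<Rightarrow> 0 | Suc l' \<Rightarrow> path_betti m (n - m) (Suc t) i'' l')))"
      by (cases i) simp_all
    then show ?thesis
      unfolding s1 s2 s3 s4 s5 binomial_term_rec[of N t p l] by (cases l) simp_all
  qed
qed

text \<open>A Betti table described by strands: \<open>s\<close> is the degree at which strand 0
  starts in homological degree 0. Here \<open>l\<close> is unbounded; the restriction to l <= i will
  be carried by \<open>f\<close>.\<close>

definition betti_shape :: "nat \<Rightarrow> nat \<Rightarrow> (nat \<Rightarrow> nat \<Rightarrow> nat) \<Rightarrow> (nat \<Rightarrow> nat \<Rightarrow> nat) \<Rightarrow> bool"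
  where "betti_shape m s f \<beta> \<longleftrightarrow> (\<forall>i l. \<beta> i (i + s + (m - 1) * l) = f i l) \<and>
    (\<forall>i j. (\<forall>l. j \<noteq> i + s + (m - 1) * l) \<longrightarrow> \<beta> i j = 0)"

lemma betti_shapeD:
  assumes "betti_shape m s f \<beta>"
  shows "\<beta> i (i + s + (m - 1) * l) = f i l" and "(\<And>l. j \<noteq> i + s + (m - 1) * l) \<Longrightarrow> \<beta> i j = 0"
  using assms unfolding betti_shape_def by blast+

definition has_shape :: "'k::field itself \<Rightarrow> nat \<Rightarrow> nat \<Rightarrow> (nat \<Rightarrow> nat) set \<Rightarrow> nat \<Rightarrow> (nat \<Rightarrow> nat \<Rightarrow> nat) \<Rightarrow> bool"
  where "has_shape T N m M s f \<longleftrightarrow> (\<exists>\<beta>. has_min_res T N M \<beta> \<and> betti_shape m s f \<beta>)"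

lemma has_shape_shifted:
  assumes "has_shape T N m M s f" "{v. u v \<noteq> 0} \<subseteq> {1..N}" "(\<Sum>v\<in>{1..N}. u v) = d"
  shows "has_shape T N m (shifted u M) (s + d) f"
proof -
  obtain \<beta> where \<beta>: "has_min_res T N M \<beta>" "betti_shape m s f \<beta>" using assms(1) unfolding has_shape_def by blast
  have "betti_shape m (s + d) f (\<lambda>i j. if d \<le> j then \<beta> i (j - d) else 0)"
    unfolding betti_shape_def
  proof (intro conjI allI impI)
    fix i l
    have "i + (s + d) + (m - 1) * l - d = i + s + (m - 1) * l" "d \<le> i + (s + d) + (m - 1) * l" by simp_all
    then show "(if d \<le> i + (s + d) + (m - 1) * l then \<beta> i (i + (s + d) + (m - 1) * l - d) else 0) = f i l"
      by (simp only: if_True betti_shapeD(1)[OF \<beta>(2)])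
  next
    fix i j assume j: "\<forall>l. j \<noteq> i + (s + d) + (m - 1) * l"
    have "j - d \<noteq> i + s + (m - 1) * l" if "d \<le> j" for l
    proof
      assume "j - d = i + s + (m - 1) * l"
      then have "j = i + (s + d) + (m - 1) * l" using that by simp
      then show False using j by blast
    qed
    then show "(if d \<le> j then \<beta> i (j - d) else 0) = 0" using betti_shapeD(2)[OF \<beta>(2), of "j - d" i] by simp
  qed
  then show ?thesis using has_min_res_shifted[OF \<beta>(1) assms(2,3)] unfolding has_shape_def by blast
qed

text \<open>A start m - 1 degrees higher amounts to renumbering the strands from 1. Strand 0 is then
  empty because m - 1 > 0.\<close>

lemma betti_shape_reindex:
  assumes m: "2 \<le> m" and b: "betti_shape m (s + (m - 1)) f \<beta>"
  shows "betti_shape m s (\<lambda>i l. case l of 0 \<Rightarrow> 0 | Suc l' \<Rightarrow> f i l') \<beta>"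
  unfolding betti_shape_def
proof (intro conjI allI impI)
  fix i l
  show "\<beta> i (i + s + (m - 1) * l) = (case l of 0 \<Rightarrow> 0 | Suc l' \<Rightarrow> f i l')"
  proof (cases l)
    case 0
    have "i + s + (m - 1) * l \<noteq> i + (s + (m - 1)) + (m - 1) * l'" for l' using 0 m by simp
    then have "\<beta> i (i + s + (m - 1) * l) = 0" by (rule betti_shapeD(2)[OF b])
    then show ?thesis by (simp add: 0)
  next
    case (Suc l')
    have "i + s + (m - 1) * l = i + (s + (m - 1)) + (m - 1) * l'" by (simp add: Suc)
    then have "\<beta> i (i + s + (m - 1) * l) = f i l'" by (simp only: betti_shapeD(1)[OF b])
    then show ?thesis by (simp add: Suc)
  qed
next
  fix i j assume j: "\<forall>l. j \<noteq> i + s + (m - 1) * l"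
  have "j \<noteq> i + (s + (m - 1)) + (m - 1) * l" for l using j[rule_format, of "Suc l"] by simp
  then show "\<beta> i j = 0" by (rule betti_shapeD(2)[OF b])
qed

lemma has_shape_reindex:
  "2 \<le> m \<Longrightarrow> has_shape T N m M (s + (m - 1)) f \<Longrightarrow>
    has_shape T N m M s (\<lambda>i l. case l of 0 \<Rightarrow> 0 | Suc l' \<Rightarrow> f i l')"
  unfolding has_shape_def using betti_shape_reindex by blast

text \<open>The third table enters one homological degree higher at the same internal degree, so it
  has to start at \<open>Suc s\<close> for its strands to line up with the others.\<close>

lemma betti_shape_cone:
  assumes "betti_shape m s f \<beta>\<^sub>1" "betti_shape m s g \<beta>\<^sub>2" "betti_shape m (Suc s) h \<beta>\<^sub>3"
  shows "betti_shape m s (\<lambda>i l. f i l + g i l + (case i of 0 \<Rightarrow> 0 | Suc i' \<Rightarrow> h i' l))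
    (\<lambda>i j. \<beta>\<^sub>1 i j + \<beta>\<^sub>2 i j + (case i of 0 \<Rightarrow> 0 | Suc i' \<Rightarrow> \<beta>\<^sub>3 i' j))"
  unfolding betti_shape_def
proof (intro conjI allI impI)
  fix i l
  have "(case i of 0 \<Rightarrow> 0 | Suc i' \<Rightarrow> \<beta>\<^sub>3 i' (i + s + (m - 1) * l)) = (case i of 0 \<Rightarrow> 0 | Suc i' \<Rightarrow> h i' l)"
  proof (cases i)
    case (Suc i')
    have "i + s + (m - 1) * l = i' + Suc s + (m - 1) * l" by (simp add: Suc)
    then have "\<beta>\<^sub>3 i' (i + s + (m - 1) * l) = h i' l" by (simp only: betti_shapeD(1)[OF assms(3)])
    then show ?thesis by (simp add: Suc)
  qed simp
  then show "\<beta>\<^sub>1 i (i + s + (m - 1) * l) + \<beta>\<^sub>2 i (i + s + (m - 1) * l)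
      + (case i of 0 \<Rightarrow> 0 | Suc i' \<Rightarrow> \<beta>\<^sub>3 i' (i + s + (m - 1) * l))
    = f i l + g i l + (case i of 0 \<Rightarrow> 0 | Suc i' \<Rightarrow> h i' l)"
    by (simp only: betti_shapeD(1)[OF assms(1)] betti_shapeD(1)[OF assms(2)])
next
  fix i j assume j: "\<forall>l. j \<noteq> i + s + (m - 1) * l"
  have "(case i of 0 \<Rightarrow> 0 | Suc i' \<Rightarrow> \<beta>\<^sub>3 i' j) = 0"
  proof (cases i)
    case (Suc i')
    have "j \<noteq> i' + Suc s + (m - 1) * l" for l using j by (simp add: Suc)
    then have "\<beta>\<^sub>3 i' j = 0" by (rule betti_shapeD(2)[OF assms(3)])
    then show ?thesis by (simp add: Suc)
  qed simp
  then show "\<beta>\<^sub>1 i j + \<beta>\<^sub>2 i j + (case i of 0 \<Rightarrow> 0 | Suc i' \<Rightarrow> \<beta>\<^sub>3 i' j) = 0"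
    using betti_shapeD(2)[OF assms(1), of j i] betti_shapeD(2)[OF assms(2), of j i] j by simp
qed

lemma has_shape_Un:
  assumes J: "has_shape T N m J s f" and K: "has_shape T N m K s g" and L: "has_shape T N m (J \<inter> K) (Suc s) h"
    and up: "upset J" "upset K"
    and pos: "\<And>\<alpha>. \<alpha> \<in> J \<inter> K \<Longrightarrow> \<exists>v. 0 < \<alpha> v"
    and low: "\<And>\<alpha>. \<alpha> \<in> J \<inter> K \<Longrightarrow> lower p \<alpha> \<in> J" "\<And>\<alpha>. \<alpha> \<in> J \<inter> K \<Longrightarrow> lower q \<alpha> \<in> K"
  shows "has_shape T N m (J \<union> K) s (\<lambda>i l. f i l + g i l + (case i of 0 \<Rightarrow> 0 | Suc i' \<Rightarrow> h i' l))"
proof -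
  obtain \<beta>\<^sub>1 \<beta>\<^sub>2 \<beta>\<^sub>3 where \<beta>: "has_min_res T N J \<beta>\<^sub>1" "has_min_res T N K \<beta>\<^sub>2" "has_min_res T N (J \<inter> K) \<beta>\<^sub>3"
    "betti_shape m s f \<beta>\<^sub>1" "betti_shape m s g \<beta>\<^sub>2" "betti_shape m (Suc s) h \<beta>\<^sub>3"
    using J K L unfolding has_shape_def by blast
  show ?thesis
    unfolding has_shape_def
    using has_min_res_Un[OF \<beta>(1-3) up pos low] betti_shape_cone[OF \<beta>(4-6)] by blast
qed

lemma sum_unit_vec: "1 \<le> n \<Longrightarrow> n \<le> N \<Longrightarrow> {v. unit_vec n v \<noteq> 0} \<subseteq> {1..N} \<and> (\<Sum>v\<in>{1..N}. unit_vec n v) = 1"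
  by (auto simp: unit_vec_def)

lemma sum_path_mon: "c + m \<le> N \<Longrightarrow> {v. path_mon m c v \<noteq> 0} \<subseteq> {1..N} \<and> (\<Sum>v\<in>{1..N}. path_mon m c v) = m"
proof -
  assume c: "c + m \<le> N"
  have "(\<Sum>v\<in>{1..N}. path_mon m c v) = (\<Sum>v\<in>{c+1..c+m}. 1)"
    using c by (intro sum.mono_neutral_cong_right) (auto simp: path_mon_def)
  then show ?thesis using c by (auto simp: path_mon_def split: if_splits)
qed

text \<open>Two splittings are nested: the inner one computes the table of the overlap, which after
  multiplication by u_n is the table of the intersection in the outer one.\<close>

lemma has_shape_path_powers_step:
  fixes T :: "'k::field itself"
  assumes m: "2 \<le> m" and n: "1 \<le> n" "n + m \<le> N"
    and J: "has_shape T N m (path_powers m n (Suc t)) (Suc t * m) (path_betti m n (Suc t))"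
    and K: "has_shape T N m (path_powers m (Suc n) t) (t * m) (path_betti m (Suc n) t)"
    and A: "has_shape T N m (path_powers m n t) (t * m) (path_betti m n t)"
    and B: "has_shape T N m (path_powers m (n - m) (Suc t)) (Suc t * m) (path_betti m (n - m) (Suc t))"
  shows "has_shape T N m (path_powers m (Suc n) (Suc t)) (Suc t * m) (path_betti m (Suc n) (Suc t))"
proof -
  have m1: "1 \<le> m" using m by simp
  have uv: "{v. unit_vec n v \<noteq> 0} \<subseteq> {1..N}" "(\<Sum>v\<in>{1..N}. unit_vec n v) = 1"
    using sum_unit_vec[of n N] n by auto
  have pm: "{v. path_mon m n v \<noteq> 0} \<subseteq> {1..N}" "(\<Sum>v\<in>{1..N}. path_mon m n v) = m"
    using sum_path_mon[of n m N] n by auto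
  \<comment> \<open>The second part of the overlap starts m - 1 degrees above the first, and this is
    where the strand number goes up. The same gap reappears for the intersection of the two
    parts.\<close>
  have e: "Suc t * m = (t * m + 1) + (m - 1)" using m by simp
  have A': "has_shape T N m (shifted (unit_vec n) (path_powers m n t)) (t * m + 1) (path_betti m n t)"
    by (rule has_shape_shifted[OF A uv])
  have B': "has_shape T N m (path_powers m (n - m) (Suc t)) (t * m + 1)
    (\<lambda>i l. case l of 0 \<Rightarrow> 0 | Suc l' \<Rightarrow> path_betti m (n - m) (Suc t) i l')"
    by (rule has_shape_reindex[OF m]) (use B in \<open>simp only: e\<close>)
  have "has_shape T N m (shifted (unit_vec n) (path_powers m (n - m) (Suc t))) (Suc (t * m + 1))
    (\<lambda>i l. case l of 0 \<Rightarrow> 0 | Suc l' \<Rightarrow> path_betti m (n - m) (Suc t) i l')"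
  proof (rule has_shape_reindex[OF m])
    have "Suc (t * m + 1) + (m - 1) = Suc t * m + 1" using m by simp
    then show "has_shape T N m (shifted (unit_vec n) (path_powers m (n - m) (Suc t))) (Suc (t * m + 1) + (m - 1))
      (path_betti m (n - m) (Suc t))"
      using has_shape_shifted[OF B uv] by (simp only:)
  qed
  then have C': "has_shape T N m (shifted (unit_vec n) (path_powers m n t) \<inter> path_powers m (n - m) (Suc t)) (Suc (t * m + 1))
    (\<lambda>i l. case l of 0 \<Rightarrow> 0 | Suc l' \<Rightarrow> path_betti m (n - m) (Suc t) i l')"
    by (simp only: overlap_Int[OF n(1)])
  have P: "has_shape T N m (overlap m n t) (t * m + 1)
    (\<lambda>i l. path_betti m n t i l + (case l of 0 \<Rightarrow> 0 | Suc l' \<Rightarrow> path_betti m (n - m) (Suc t) i l')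
      + (case i of 0 \<Rightarrow> 0 | Suc i' \<Rightarrow> (case l of 0 \<Rightarrow> 0 | Suc l' \<Rightarrow> path_betti m (n - m) (Suc t) i' l')))"
  proof (rule has_shape_Un[OF A' B' C' upset_shifted[OF upset_path_powers] upset_path_powers])
    fix \<alpha> assume a: "\<alpha> \<in> shifted (unit_vec n) (path_powers m n t) \<inter> path_powers m (n - m) (Suc t)"
    then show "\<exists>v. 0 < \<alpha> v" by (auto simp: shifted_def unit_vec_le)
    show "lower 0 \<alpha> \<in> shifted (unit_vec n) (path_powers m n t)" "lower n \<alpha> \<in> path_powers m (n - m) (Suc t)"
      using lower_overlap_Int[OF n(1) m1] a unfolding overlap_Int[OF n(1)] by blast+
  qed
  have K': "has_shape T N m (shifted (path_mon m n) (path_powers m (Suc n) t)) (Suc t * m) (path_betti m (Suc n) t)"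
    using has_shape_shifted[OF K pm] by (simp add: add.commute)
  have L: "has_shape T N m (path_powers m n (Suc t) \<inter> shifted (path_mon m n) (path_powers m (Suc n) t)) (Suc (Suc t * m))
    (\<lambda>i l. path_betti m n t i l + (case l of 0 \<Rightarrow> 0 | Suc l' \<Rightarrow> path_betti m (n - m) (Suc t) i l')
      + (case i of 0 \<Rightarrow> 0 | Suc i' \<Rightarrow> (case l of 0 \<Rightarrow> 0 | Suc l' \<Rightarrow> path_betti m (n - m) (Suc t) i' l')))"
    unfolding path_powers_Int[OF n(1) m1] using has_shape_shifted[OF P pm] by (simp add: add.commute)
  have "has_shape T N m (path_powers m n (Suc t) \<union> shifted (path_mon m n) (path_powers m (Suc n) t)) (Suc t * m)
    (\<lambda>i l. path_betti m n (Suc t) i l + path_betti m (Suc n) t i l + (case i of 0 \<Rightarrow> 0 | Suc i' \<Rightarrow>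
      path_betti m n t i' l + (case l of 0 \<Rightarrow> 0 | Suc l' \<Rightarrow> path_betti m (n - m) (Suc t) i' l')
      + (case i' of 0 \<Rightarrow> 0 | Suc i'' \<Rightarrow> (case l of 0 \<Rightarrow> 0 | Suc l' \<Rightarrow> path_betti m (n - m) (Suc t) i'' l'))))"
  proof (rule has_shape_Un[OF J K' L upset_path_powers upset_shifted[OF upset_path_powers]])
    fix \<alpha> assume a: "\<alpha> \<in> path_powers m n (Suc t) \<inter> shifted (path_mon m n) (path_powers m (Suc n) t)"
    then have "path_mon m n (n + 1) \<le> \<alpha> (n + 1)" by (auto simp: shifted_def le_fun_def)
    then have "0 < \<alpha> (n + 1)" using m1 by (simp add: path_mon_def)
    then show "\<exists>v. 0 < \<alpha> v" by blast
    show "lower (n + m) \<alpha> \<in> path_powers m n (Suc t)"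
      "lower n \<alpha> \<in> shifted (path_mon m n) (path_powers m (Suc n) t)"
      using lower_overlap[OF n(1) m1] a unfolding path_powers_Int[OF n(1) m1] by blast+
  qed
  moreover have "path_betti m (Suc n) (Suc t) = (\<lambda>i l. path_betti m n (Suc t) i l + path_betti m (Suc n) t i l + (case i of 0 \<Rightarrow> 0 | Suc i' \<Rightarrow>
      path_betti m n t i' l + (case l of 0 \<Rightarrow> 0 | Suc l' \<Rightarrow> path_betti m (n - m) (Suc t) i' l')
      + (case i' of 0 \<Rightarrow> 0 | Suc i'' \<Rightarrow> (case l of 0 \<Rightarrow> 0 | Suc l' \<Rightarrow> path_betti m (n - m) (Suc t) i'' l'))))"
    using path_betti_rec[OF m1 n(1)] by (intro ext)
  ultimately show ?thesis by (simp only: path_powers_Suc_eq)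
qed

text \<open>The pair k = 0, t = 0 is excluded since the power 0 is the unit ideal, whereas
  \<open>path_betti m 0 0\<close> is 0. The inner induction on \<open>k\<close> is strong because
  the splitting refers to n - m. The principal ideal \<open>k = 1\<close> is treated directly, as
  the splitting step requires n >= 1.\<close>

lemma has_shape_path_powers:
  fixes T :: "'k::field itself"
  assumes m: "2 \<le> m"
  shows "k + m \<le> Suc N \<Longrightarrow> k \<noteq> 0 \<or> t \<noteq> 0 \<Longrightarrow> has_shape T N m (path_powers m k t) (t * m) (path_betti m k t)"
proof (induction t arbitrary: k)
  case 0
  have "betti_shape m (0 * m) (path_betti m k 0) (\<lambda>i j. if i = 0 \<and> j = 0 then 1 else 0)"
    using 0 m by (auto simp: betti_shape_def path_betti_t0)
  then show ?case unfolding has_shape_def using has_min_res_UNIV by auto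
next
  case (Suc t)
  note IH_t = Suc.IH
  show ?case
    using Suc.prems(1)
  proof (induction k rule: less_induct)
    case (less k)
    consider "k = 0" | "k = 1" | n where "k = Suc n" "1 \<le> n" by (cases k) (auto simp: Suc_le_eq)
    then show ?case
    proof cases
      case 1
      have "betti_shape m (Suc t * m) (path_betti m 0 (Suc t)) (\<lambda>i j. 0)"
        by (simp add: betti_shape_def path_betti_k0)
      then show ?thesis unfolding has_shape_def 1 path_powers_0_Suc using has_min_res_empty by blast
    next
      case 2
      have "path_betti m 1 (Suc t) = path_betti m 1 t"
        using m by (intro ext) (simp only: path_betti_k1 one_le_numeral order_trans[of 1 2 m])
      moreover have "path_powers m 1 (Suc t) = shifted (path_mon m 0) (path_powers m 1 t)"
        using path_powers_Suc_eq[of m 0 t] by (simp add: path_powers_0_Suc)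
      moreover have "has_shape T N m (shifted (path_mon m 0) (path_powers m 1 t)) (t * m + m) (path_betti m 1 t)"
        using sum_path_mon[of 0 m N] less.prems 2 by (intro has_shape_shifted IH_t) auto
      ultimately show ?thesis by (simp add: 2 add.commute)
    next
      case (3 n)
      show ?thesis
        unfolding 3(1)
      proof (rule has_shape_path_powers_step[OF m 3(2)])
        show "n + m \<le> N" using less.prems 3 by simp
        show "has_shape T N m (path_powers m n (Suc t)) (Suc t * m) (path_betti m n (Suc t))"
          using less.prems 3 by (intro less.IH) auto
        show "has_shape T N m (path_powers m (Suc n) t) (t * m) (path_betti m (Suc n) t)"
          using less.prems 3 by (intro IH_t) auto
        show "has_shape T N m (path_powers m n t) (t * m) (path_betti m n t)"
          using less.prems 3 by (intro IH_t) auto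
        show "has_shape T N m (path_powers m (n - m) (Suc t)) (Suc t * m) (path_betti m (n - m) (Suc t))"
          using less.prems 3 by (intro less.IH) auto
      qed
    qed
  qed
qed

section \<open>Translation to the integer convention for binomial coefficients\<close>

lemma binom_int: "binom (int a) (int b) = (a choose b)"
  by (simp add: binom_def binomial_eq_0)

text \<open>The assumption t >= 1 concerns the first factor: for t = l = 0 its integer upper index
  is -1, while the truncated one is 0. Outside the range n >= lm, i >= l the second factor is
  0.\<close>

lemma path_betti_binom:
  assumes "1 \<le> t"
  shows "path_betti m (Suc n) t i l = binom (int t + int l - 1) (int l)
      * binom (int n - int l * int m) (int i - int l)
      * binom (int n + int t - int l * int m - int i + int l) (int t - int i + 2 * int l)"
proof (cases "n < l * m \<or> i < l")
  case True
  then have "int n < int l * int m \<or> i < l" by (metis of_nat_less_iff of_nat_mult)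
  then have "binom (int n - int l * int m) (int i - int l) = 0" by (auto simp: binom_def)
  then show ?thesis using True by (auto simp: path_betti_def)
next
  case False
  obtain p where i: "i = l + p" using False le_Suc_ex by (metis not_less)
  obtain N where n: "n = l * m + N" using False le_Suc_ex by (metis not_less)
  have 1: "binom (int t + int l - 1) (int l) = (t + l - 1 choose l)"
  proof -
    have "int t + int l - 1 = int (t + l - 1)" using assms by simp
    then show ?thesis by (simp only: binom_int)
  qed
  have 2: "binom (int n - int l * int m) (int i - int l) = (N choose p)"
  proof -
    have "int n - int l * int m = int N" "int i - int l = int p" by (simp_all add: i n)
    then show ?thesis by (simp only: binom_int)
  qed
  \<comment> \<open>For \<open>p \<le> N\<close> the upper index is not truncated; for larger
    \<open>p\<close> the second factor N choose p is 0 anyway.\<close>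
  have 3: "binom (int n + int t - int l * int m - int i + int l) (int t - int i + 2 * int l)
    = (if p \<le> t + l then N + t - p choose (t + l - p) else 0)" if "p \<le> N"
  proof -
    have "int n + int t - int l * int m - int i + int l = int (N + t - p)" using that by (simp add: i n)
    moreover have "int t - int i + 2 * int l = int (t + l - p)" if "p \<le> t + l" using that by (simp add: i)
    moreover have "int t - int i + 2 * int l < 0" if "\<not> p \<le> t + l" using that by (simp add: i)
    ultimately show ?thesis by (cases "p \<le> t + l") (simp_all only: binom_int if_True if_False, simp add: binom_def)
  qed
  have "path_betti m (Suc n) t i l = binomial_term N t p l" by (simp add: path_betti_def i n)
  also have "\<dots> = (t + l - 1 choose l) * (N choose p)
      * binom (int n + int t - int l * int m - int i + int l) (int t - int i + 2 * int l)"
    using 3 by (cases "p \<le> N") (auto simp: binomial_term_def binomial_eq_0)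
  finally show ?thesis by (simp only: 1 2)
qed

theorem theorem1p1:
  fixes m n t :: nat
  assumes "m \<ge> 2" and "n \<ge> 0" and "t \<ge> 1"
  shows "(\<forall>(i::nat) (j::int).
            \<not> (\<exists>l::int. 0 \<le> l \<and> l \<le> int i \<and> j = int i + int t * int m + (int m - 1) * l) \<longrightarrow>
            graded_betti (n + m) (path_ideal_power n m t :: 'k::field mpoly set) i j = 0)
       \<and> (\<forall>(i::nat) (l::int). 0 \<le> l \<and> l \<le> int i \<longrightarrow>
            graded_betti (n + m) (path_ideal_power n m t :: 'k::field mpoly set) i
              (int i + int t * int m + (int m - 1) * l)
            = binom (int t + l - 1) l
              * binom (int n - l * int m) (int i - l)
              * binom (int n + int t - l * int m - int i + l) (int t - int i + 2 * l))"
proof -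
  \<comment> \<open>There are n + 1 generators in n + m variables, which is the extreme case of the
    bound \<open>k + m \<le> Suc N\<close>.\<close>
  obtain \<beta> where \<beta>: "has_min_res (TYPE('k)) (n + m) (path_powers m (Suc n) t) \<beta>"
    and shape: "betti_shape m (t * m) (path_betti m (Suc n) t) \<beta>"
    using has_shape_path_powers[OF assms(1), of "Suc n" "n + m" t "TYPE('k)"] unfolding has_shape_def by auto
  have betti: "graded_betti (n + m) (path_ideal_power n m t :: 'k mpoly set) i j = (if 0 \<le> j then \<beta> i (nat j) else 0)" for i j
    unfolding path_ideal_power_eq by (rule graded_betti_mono_ideal[OF \<beta> upset_path_powers])
  have deg: "int i + int t * int m + (int m - 1) * int l = int (i + t * m + (m - 1) * l)" for i l
    using assms(1) by (simp add: of_nat_diff)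
  show ?thesis
  proof (intro conjI allI impI)
    fix i :: nat and j :: int
    assume none: "\<not> (\<exists>l::int. 0 \<le> l \<and> l \<le> int i \<and> j = int i + int t * int m + (int m - 1) * l)"
    show "graded_betti (n + m) (path_ideal_power n m t :: 'k mpoly set) i j = 0"
    proof (cases "0 \<le> j \<and> (\<exists>l. nat j = i + t * m + (m - 1) * l)")
      case True
      then obtain l where l: "0 \<le> j" "nat j = i + t * m + (m - 1) * l" by blast
      have "j = int (nat j)" using l(1) by simp
      then have "j = int (i + t * m + (m - 1) * l)" by (simp only: l(2))
      \<comment> \<open>Since \<open>betti_shape\<close> allows every \<open>l\<close>, the degree
        may still have the stated form with l > i; then \<open>path_betti\<close> is 0 by
        definition.\<close>
      then have "\<not> l \<le> i" using none deg[of i l] by (metis of_nat_0_le_iff of_nat_le_iff)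
      then have "path_betti m (Suc n) t i l = 0" by (simp add: path_betti_def)
      then show ?thesis using l betti_shapeD(1)[OF shape, of i l] by (simp only: betti if_True)
    next
      case False
      then show ?thesis using betti_shapeD(2)[OF shape, of "nat j" i] by (auto simp: betti)
    qed
  next
    fix i :: nat and l :: int
    assume "0 \<le> l \<and> l \<le> int i"
    then obtain l' where l: "l = int l'" by (metis nonneg_int_cases)
    have "graded_betti (n + m) (path_ideal_power n m t :: 'k mpoly set) i
        (int i + int t * int m + (int m - 1) * l) = path_betti m (Suc n) t i l'"
      unfolding betti l deg using betti_shapeD(1)[OF shape, of i l'] by (simp only: nat_int of_nat_0_le_iff if_True)
    then show "graded_betti (n + m) (path_ideal_power n m t :: 'k mpoly set) i
        (int i + int t * int m + (int m - 1) * l)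
      = binom (int t + l - 1) l * binom (int n - l * int m) (int i - l)
        * binom (int n + int t - l * int m - int i + l) (int t - int i + 2 * l)"
      using path_betti_binom[OF assms(3)] by (simp add: l)
  qed
qed

end
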